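(* There exists a sequence of positive integers $(L_r)_{r\ge1}$ such that the posets $P_r$ defined recursively by $P_0=C_2$ and, for $r\ge1$, $$R_r=C_{L_r}\oplus P_{r-1}\oplus C_{L_r},\qquad P_r=R_r\sqcup R_r,$$ satisfy, with $m_s=|R_s|$, for every $r\ge0$, $$\tau(P_r)<3,\qquad \operatorname{gap}(P_r)=\prod_{s=1}^r\frac{2m_s+1}{m_s+1}\ \ge\ (3/2)^r .$$
   Context: $C_k$ is the chain with $k$ elements. For posets $Q,R$ (on disjoint copies of their ground sets): the ordinal sum $Q\oplus R$ keeps the relations inside $Q$ and $R$ and makes every element of $Q$ less than every element of $R$; the parallel sum $Q\sqcup R$ keeps the relations inside $Q$ and $R$ and imposes no further relations. Repeated summands denote distinct isomorphic copies. A linear extension of a finite poset $P$ with $n$ elements is an order-preserving bijection $f:P\to\{1,\dots,n\}$, and $h_P(x)=\mathbb E[f(x)]$ for $f$ a uniformly random linear extension. If $s_1\le\cdots\le s_n$ are the values $h_P(x)$ listed with repetition, then $\operatorname{gap}(P)=\max\{s_1,s_2-s_1,\ldots,s_n-s_{n-1},n+1-s_n\}$. For a finite nonempty poset $P$ let $\boldsymbol\sigma_P$ be a uniformly random linear extension viewed as a total ordering of $P$, and for $\varnothing\ne X\subseteq P$ let $\boldsymbol\sigma_P|_X$ be the relative order it induces on $X$. With $H$ denoting Shannon entropy in bits (base-two logarithm), the hereditary entropy per point is $$\tau(P)=\max_{\varnothing\ne X\subseteq P}\frac{H(\boldsymbol\sigma_P|_X)}{|X|}.$$ Empty products equal $1$.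 *)

theory Defs
  imports "HOL-Probability.Probability" "HOL-Library.Nat_Bijection" "HOL-Library.Multiset"
begin

text \<open>A poset is a reflexive order relation; its ground set is the \<^const>\<open>Field\<close> of the relation.\<close>

definition chain_poset :: "nat \<Rightarrow> nat rel" where
  "chain_poset k = {(i, j). i \<le> j \<and> j < k}"

text \<open>To iterate sums inside one type, ground sets are sets of naturals; the disjoint copies are the
  images under the two halves of the bijection \<^const>\<open>sum_encode\<close> (even and odd numbers).\<close>

definition left_copy :: "nat rel \<Rightarrow> nat rel" where
  "left_copy Q = (\<lambda>(x, y). (sum_encode (Inl x), sum_encode (Inl y))) ` Q"

definition right_copy :: "nat rel \<Rightarrow> nat rel" where
  "right_copy Q = (\<lambda>(x, y). (sum_encode (Inr x), sum_encode (Inr y))) ` Q"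

definition parallel_sum :: "nat rel \<Rightarrow> nat rel \<Rightarrow> nat rel" where
  "parallel_sum Q R = left_copy Q \<union> right_copy R"

definition ordinal_sum :: "nat rel \<Rightarrow> nat rel \<Rightarrow> nat rel" where
  "ordinal_sum Q R =
     left_copy Q \<union> right_copy R \<union> Field (left_copy Q) \<times> Field (right_copy R)"

text \<open>Restricting to extensional functions makes each linear extension count exactly once.\<close>

definition linear_extensions :: "'a rel \<Rightarrow> ('a \<Rightarrow> nat) set" where
  "linear_extensions P =
     {f \<in> extensional (Field P).
        bij_betw f (Field P) {1..card (Field P)} \<and> (\<forall>(x, y)\<in>P. f x \<le> f y)}"

definition random_linext :: "'a rel \<Rightarrow> ('a \<Rightarrow> nat) pmf" where
  "random_linext P = pmf_of_set (linear_extensions P)"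

definition avg_height :: "'a rel \<Rightarrow> 'a \<Rightarrow> real" where
  "avg_height P x = measure_pmf.expectation (random_linext P) (\<lambda>f. real (f x))"

definition sorted_heights :: "'a rel \<Rightarrow> real list" where
  "sorted_heights P = sorted_list_of_multiset (image_mset (avg_height P) (mset_set (Field P)))"

definition gap :: "'a rel \<Rightarrow> real" where
  "gap P =
     (let s = sorted_heights P; n = card (Field P) in
      Max ({s ! 0} \<union> {s ! (i + 1) - s ! i | i. i + 1 < n} \<union> {real n + 1 - s ! (n - 1)}))"

definition linext_order :: "'a rel \<Rightarrow> ('a \<Rightarrow> nat) \<Rightarrow> 'a rel" where
  "linext_order P f = {(x, y) \<in> Field P \<times> Field P. f x \<le> f y}"

definition random_order :: "'a rel \<Rightarrow> 'a rel pmf" where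
  "random_order P = map_pmf (linext_order P) (random_linext P)"

definition induced_entropy :: "'a rel \<Rightarrow> 'a set \<Rightarrow> real" where
  "induced_entropy P X =
     prob_space.entropy (measure_pmf (random_order P)) 2
       (count_space (range (\<lambda>\<sigma>. Restr \<sigma> X))) (\<lambda>\<sigma>. Restr \<sigma> X)"

definition hereditary_entropy :: "'a rel \<Rightarrow> real" where
  "hereditary_entropy P =
     Max ((\<lambda>X. induced_entropy P X / real (card X)) ` {X. X \<subseteq> Field P \<and> X \<noteq> {}})"

definition padded :: "nat \<Rightarrow> nat rel \<Rightarrow> nat rel" where
  "padded l Q = ordinal_sum (ordinal_sum (chain_poset l) Q) (chain_poset l)"

primrec P_poset :: "(nat \<Rightarrow> nat) \<Rightarrow> nat \<Rightarrow> nat rel" where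
  "P_poset L 0 = chain_poset 2"
| "P_poset L (Suc r) =
     parallel_sum (padded (L (Suc r)) (P_poset L r)) (padded (L (Suc r)) (P_poset L r))"

text \<open>Meaningful for \<open>r \<ge> 1\<close> only.\<close>

definition R_poset :: "(nat \<Rightarrow> nat) \<Rightarrow> nat \<Rightarrow> nat rel" where
  "R_poset L r = padded (L r) (P_poset L (r - 1))"

lemma P_poset_eq: "r \<ge> 1 \<Longrightarrow> P_poset L r = parallel_sum (R_poset L r) (R_poset L r)"
  by (cases r) (simp_all add: R_poset_def)

lemma Field_chain_poset: "Field (chain_poset k) = {..<k}"
  by (auto simp: chain_poset_def Field_def)

lemma Field_left_copy: "Field (left_copy Q) = (\<lambda>x. 2 * x) ` Field Q"
  by (force simp: left_copy_def Field_def sum_encode_def)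

lemma Field_right_copy: "Field (right_copy Q) = (\<lambda>x. Suc (2 * x)) ` Field Q"
  by (force simp: right_copy_def Field_def sum_encode_def)

lemma Field_parallel_sum:
  "Field (parallel_sum Q R) = (\<lambda>x. 2 * x) ` Field Q \<union> (\<lambda>x. Suc (2 * x)) ` Field R"
  by (simp add: parallel_sum_def Field_left_copy Field_right_copy)

lemma Field_ordinal_sum:
  "Field (ordinal_sum Q R) = (\<lambda>x. 2 * x) ` Field Q \<union> (\<lambda>x. Suc (2 * x)) ` Field R"
proof -
  have "Field (A \<union> B \<union> Field A \<times> Field B) = Field A \<union> Field B" for A B :: "nat rel"
    by (auto simp: Field_def)
  then have "Field (ordinal_sum Q R) = Field (left_copy Q) \<union> Field (right_copy R)"
    unfolding ordinal_sum_def .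
  then show ?thesis
    by (simp add: Field_left_copy Field_right_copy)
qed

lemma finite_Field_P_poset: "finite (Field (P_poset L r))"
  by (induction r)
     (simp_all add: Field_chain_poset Field_parallel_sum Field_ordinal_sum padded_def)

lemma left_copy_iff: "(x, y) \<in> left_copy Q \<longleftrightarrow> even x \<and> even y \<and> (x div 2, y div 2) \<in> Q"
  by (force simp: left_copy_def sum_encode_def image_iff)

lemma right_copy_iff: "(x, y) \<in> right_copy Q \<longleftrightarrow> odd x \<and> odd y \<and> (x div 2, y div 2) \<in> Q"
  by (force simp: right_copy_def sum_encode_def image_iff)

lemma parallel_sum_iff:
  "(x, y) \<in> parallel_sum Q R \<longleftrightarrow>
     (even x \<and> even y \<and> (x div 2, y div 2) \<in> Q) \<or> (odd x \<and> odd y \<and> (x div 2, y div 2) \<in> R)"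
  by (simp add: parallel_sum_def left_copy_iff right_copy_iff)

lemma ordinal_sum_iff:
  "(x, y) \<in> ordinal_sum Q R \<longleftrightarrow>
     (x, y) \<in> parallel_sum Q R \<or>
     (even x \<and> odd y \<and> x div 2 \<in> Field Q \<and> y div 2 \<in> Field R)"
proof -
  have "x \<in> Field (left_copy Q) \<longleftrightarrow> even x \<and> x div 2 \<in> Field Q"
    by (force simp: Field_left_copy)
  moreover have "y \<in> Field (right_copy R) \<longleftrightarrow> odd y \<and> y div 2 \<in> Field R"
    by (force simp: Field_right_copy)
  ultimately show ?thesis
    by (auto simp: ordinal_sum_def parallel_sum_def)
qed

lemma Partial_order_iff:
  "Partial_order r \<longleftrightarrow> (\<forall>x y. (x, y) \<in> r \<longrightarrow> (x, x) \<in> r \<and> (y, y) \<in> r) \<and> trans r \<and> antisym r"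
  by (auto simp: order_on_defs refl_on_def Field_def)

lemma Partial_order_parallel_sum:
  assumes "Partial_order Q" "Partial_order R"
  shows "Partial_order (parallel_sum Q R)"
proof -
  have Q: "(x, x) \<in> Q" "(y, y) \<in> Q" if "(x, y) \<in> Q" for x y
    using assms(1) that unfolding Partial_order_iff by blast+
  have R: "(x, x) \<in> R" "(y, y) \<in> R" if "(x, y) \<in> R" for x y
    using assms(2) that unfolding Partial_order_iff by blast+
  have t: "trans Q" "trans R" and a: "antisym Q" "antisym R"
    using assms unfolding Partial_order_iff by blast+
  have "trans (parallel_sum Q R)"
    by (rule transI) (auto simp: parallel_sum_iff intro: transD[OF t(1)] transD[OF t(2)])
  moreover have "antisym (parallel_sum Q R)"
  proof (rule antisymI)
    fix x y assume "(x, y) \<in> parallel_sum Q R" "(y, x) \<in> parallel_sum Q R"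
    then have "x div 2 = y div 2 \<and> (even x \<longleftrightarrow> even y)"
      by (auto simp: parallel_sum_iff dest: antisymD[OF a(1)] antisymD[OF a(2)])
    then show "x = y" by presburger
  qed
  ultimately show ?thesis
    unfolding Partial_order_iff by (auto simp: parallel_sum_iff dest: Q R)
qed

lemma Partial_order_ordinal_sum:
  assumes "Partial_order Q" "Partial_order R"
  shows "Partial_order (ordinal_sum Q R)"
proof -
  have p: "Partial_order (parallel_sum Q R)"
    using assms by (rule Partial_order_parallel_sum)
  have Q: "(x, x) \<in> Q" if "x \<in> Field Q" for x
    using assms(1) that unfolding order_on_defs refl_on_def by blast
  have R: "(x, x) \<in> R" if "x \<in> Field R" for x
    using assms(2) that unfolding order_on_defs refl_on_def by blast
  have t: "trans Q" "trans R"
    using assms unfolding Partial_order_iff by blast+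
  have "trans (ordinal_sum Q R)"
    by (rule transI)
       (auto simp: ordinal_sum_iff parallel_sum_iff
             intro: transD[OF t(1)] transD[OF t(2)] FieldI1 FieldI2)
  moreover have "antisym (ordinal_sum Q R)"
  proof (rule antisymI)
    fix x y assume "(x, y) \<in> ordinal_sum Q R" "(y, x) \<in> ordinal_sum Q R"
    then have "(x, y) \<in> parallel_sum Q R" "(y, x) \<in> parallel_sum Q R"
      by (auto simp: ordinal_sum_iff parallel_sum_iff)
    with p show "x = y" unfolding Partial_order_iff antisym_def by blast
  qed
  moreover have "(x, x) \<in> ordinal_sum Q R \<and> (y, y) \<in> ordinal_sum Q R"
    if "(x, y) \<in> ordinal_sum Q R" for x y
    using that by (auto simp: ordinal_sum_iff parallel_sum_iff intro: Q R FieldI1 FieldI2)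
  ultimately show ?thesis
    unfolding Partial_order_iff by blast
qed

lemma Partial_order_chain_poset: "Partial_order (chain_poset k)"
  by (auto simp: Partial_order_iff chain_poset_def trans_def antisym_def)

lemma Partial_order_P_poset: "Partial_order (P_poset L r)"
  by (induction r)
     (simp_all add: padded_def Partial_order_parallel_sum Partial_order_ordinal_sum
        Partial_order_chain_poset)

lemma induced_entropy_eq:
  assumes "finite X"
  shows "induced_entropy P X =
    - (\<Sum>\<rho>\<in>range (\<lambda>\<sigma>. Restr \<sigma> X). let p = pmf (map_pmf (\<lambda>\<sigma>. Restr \<sigma> X) (random_order P)) \<rho> in p * log 2 p)"
proof -
  interpret information_space "measure_pmf (random_order P)" 2
    by unfold_locales simp
  have fin: "finite (range (\<lambda>\<sigma>. Restr \<sigma> X))"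
    by (rule finite_subset[of _ "Pow (X \<times> X)"]) (use assms in auto)
  have sd: "simple_distributed (measure_pmf (random_order P)) (\<lambda>\<sigma>. Restr \<sigma> X)
      (\<lambda>\<rho>. pmf (map_pmf (\<lambda>\<sigma>. Restr \<sigma> X) (random_order P)) \<rho>)"
    by (rule measure_pmf.simple_distributedI)
       (auto simp: simple_function_def fin pmf_map vimage_def)
  show ?thesis
    using entropy_simple_distributed[OF sd] by (simp add: induced_entropy_def Let_def)
qed

end

theory Submission
  imports Defs
begin

text \<open>
  A uniformly random linear extension of \<open>Q \<squnion> R\<close> consists of independent uniform linear
  extensions of \<open>Q\<close> and \<open>R\<close> and an independent uniform set of positions for \<open>Q\<close>. If
  \<open>Q = R\<close> has \<open>m\<close> elements, the mean of the \<open>j\<close>-th smallest position is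
  \<open>j (2m + 1) / (m + 1)\<close>; hence all heights, and with them the gap, are scaled by
  \<open>(2m + 1) / (m + 1)\<close>, while padding with chains only inserts gaps of size \<open>1\<close>.

  For the entropy one shows inductively that \<open>\<sigma>|X\<close> can be encoded with at most \<open>3|X| - 2\<close> bits
  on average. Encode the order on the two middle copies of the previous poset recursively, and then
  the interleaving of the two halves of \<open>X\<close>. If a substantial part of \<open>X\<close> lies on the chains, one
  bit per point is affordable for the interleaving. Otherwise \<open>X\<close> is small, and since the chains
  are long each middle copy is, with high probability, not separated by any other point of \<open>X\<close>; it
  can then be collapsed to a single point in the interleaving. The saving of \<open>2\<close> bits in
  \<open>3|X| - 2\<close> pays for the interleaving of the two collapsed copies.
\<close>

section \<open>Ranks and random subsets\<close>

text \<open>The bound must survive unboundedly many levels, so the induction has to close without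
  any loss. With y > 0 points of X in the middle copies and z outside them, one bit per point is
  affordable if 3y - 2 + y + z <= 3(y + z) - 2, that is y <= 2z. Otherwise |X| <= 3n for the
  previous size n, a bound that does not involve the chain length l; this allows l to be chosen
  last. After collapsing, k points with given numbers on the two sides interleave in at most 2^(k -
  1) ways, and the bit gained over k bits pays both for announcing whether collapsing is possible
  and for the longer code used when it is not. A point separates the opposite middle copy only if
  its position falls into a window of fewer than n values, and each value has probability at most 1
  / sqrt (l + 1). A union bound over X and a fallback of |X| + 2 bits require n^3 / sqrt l to be
  below a constant, whence l = (24 n^3)^2. Large l does not harm the gap, as (2m + 1) / (m + 1) >=
  3/2 for all m >= 1.\<close>

definition ord_on :: "('a \<Rightarrow> nat) \<Rightarrow> 'a set \<Rightarrow> 'a rel" where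
  "ord_on f X = {(x, y) \<in> X \<times> X. f x \<le> f y}"

text \<open>Counting with \<open>\<le>\<close> makes ranks start at 1, as the values of a linear
  extension do.\<close>

definition rk :: "('a \<Rightarrow> nat) \<Rightarrow> 'a set \<Rightarrow> 'a \<Rightarrow> nat" where
  "rk f A x = card {z \<in> A. f z \<le> f x}"

text \<open>Order statistics, counted from 1. As inverses of ranks they inherit bijectivity and
  monotonicity from \<open>rk\<close>, without any sorting.\<close>

definition nth_elem :: "nat set \<Rightarrow> nat \<Rightarrow> nat" where
  "nth_elem T = the_inv_into T (rk (\<lambda>t. t) T)"

lemma rk_mono:
  assumes "finite A" "f x \<le> f y"
  shows "rk f A x \<le> rk f A y"
  unfolding rk_def using assms by (intro card_mono) auto

lemma rk_strict_mono:
  assumes "finite A" "y \<in> A" "f x < f y"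
  shows "rk f A x < rk f A y"
proof -
  have "{z \<in> A. f z \<le> f x} \<subseteq> {z \<in> A. f z \<le> f y}" "y \<in> {z \<in> A. f z \<le> f y}" "y \<notin> {z \<in> A. f z \<le> f x}"
    using assms by auto
  then show ?thesis
    unfolding rk_def using assms(1) by (intro psubset_card_mono) (simp, blast)
qed

lemma rk_le_iff:
  assumes "finite A" "x \<in> A" "y \<in> A"
  shows "rk f A x \<le> rk f A y \<longleftrightarrow> f x \<le> f y"
  using rk_mono[OF assms(1), of f x y] rk_strict_mono[OF assms(1,2), of f y]
  by (meson leD leI)

lemma rk_bij_betw:
  assumes "finite A" "inj_on f A"
  shows "bij_betw (rk f A) A {1..card A}"
proof -
  have inj: "inj_on (rk f A) A"
    using assms by (auto simp: inj_on_def) (metis rk_le_iff antisym order_refl)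
  have "rk f A ` A \<subseteq> {1..card A}"
  proof
    fix v assume "v \<in> rk f A ` A"
    then obtain x where x: "x \<in> A" "v = rk f A x" by auto
    have "v \<le> card A" unfolding x rk_def using assms by (intro card_mono) auto
    moreover have "v > 0" unfolding x rk_def using assms x by (auto simp: card_gt_0_iff)
    ultimately show "v \<in> {1..card A}" by auto
  qed
  moreover have "card (rk f A ` A) = card {1..card A}"
    using inj by (simp add: card_image)
  ultimately have "rk f A ` A = {1..card A}"
    by (intro card_subset_eq) auto
  with inj show ?thesis by (simp add: bij_betw_def)
qed

lemma rk_of_bij:
  assumes "bij_betw f A {1..card A}" "x \<in> A"
  shows "rk f A x = f x"
proof -
  have "f ` {z \<in> A. f z \<le> f x} = {1..f x}"
    using assms unfolding bij_betw_def set_eq_iff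
    by (auto simp: image_iff) (metis atLeastAtMost_iff image_iff le_trans)
  moreover have "inj_on f {z \<in> A. f z \<le> f x}"
    using assms unfolding bij_betw_def inj_on_def by auto
  ultimately have "card {z \<in> A. f z \<le> f x} = card {1..f x}"
    using card_image by fastforce
  then show ?thesis by (simp add: rk_def)
qed

lemma rk_compose:
  assumes "inj_on f A" "\<And>z. z \<in> A \<Longrightarrow> g z \<le> g x \<longleftrightarrow> f z \<le> f x"
  shows "rk (\<lambda>t. t) (f ` A) (f x) = rk g A x"
proof -
  have "{t \<in> f ` A. t \<le> f x} = f ` {z \<in> A. g z \<le> g x}"
    using assms(2) by auto
  moreover have "inj_on f {z \<in> A. g z \<le> g x}"
    using assms(1) by (auto simp: inj_on_def)
  ultimately show ?thesis
    by (simp add: rk_def card_image)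
qed

lemma nth_elem_bij_betw:
  assumes "finite T"
  shows "bij_betw (nth_elem T) {1..card T} T"
  unfolding nth_elem_def by (intro bij_betw_the_inv_into rk_bij_betw assms inj_on_id2)

lemma nth_elem_rk:
  assumes "finite T" "t \<in> T"
  shows "nth_elem T (rk (\<lambda>t. t) T t) = t"
  unfolding nth_elem_def
  using rk_bij_betw[of T "\<lambda>t. t"] assms by (intro the_inv_into_f_f) (auto simp: bij_betw_def)

lemma rk_elem:
  assumes "finite T" "j \<in> {1..card T}"
  shows "rk (\<lambda>t. t) T (nth_elem T j) = j"
  unfolding nth_elem_def
  using rk_bij_betw[of T "\<lambda>t. t"] assms by (intro f_the_inv_into_f) (auto simp: bij_betw_def)

lemma nth_elem_in: "finite T \<Longrightarrow> j \<in> {1..card T} \<Longrightarrow> nth_elem T j \<in> T"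
  using nth_elem_bij_betw[of T] by (auto simp: bij_betw_def)

lemma nth_elem_le_iff:
  assumes "finite T" "i \<in> {1..card T}" "j \<in> {1..card T}"
  shows "nth_elem T i \<le> nth_elem T j \<longleftrightarrow> i \<le> j"
  using rk_le_iff[of T "nth_elem T i" "nth_elem T j" "\<lambda>t. t"] assms by (simp add: rk_elem nth_elem_in)

lemma nth_elem_eqI:
  assumes "finite T" "t \<in> T" "card {s \<in> T. s \<le> t} = j"
  shows "nth_elem T j = t"
  using nth_elem_rk[OF assms(1,2)] assms(3) by (simp add: rk_def)

lemma nth_elem_interval:
  assumes "j \<in> {1..b}"
  shows "nth_elem {a + 1..a + b} j = a + j"
proof (rule nth_elem_eqI)
  have "{s \<in> {a + 1..a + b}. s \<le> a + j} = {a + 1..a + j}" using assms by auto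
  then show "card {s \<in> {a + 1..a + b}. s \<le> a + j} = j" by simp
qed (use assms in auto)

text \<open>An interleaving is a word in two letters: once the order inside each half is known, the
  set of ranks taken by one half fixes everything. This is the decoding step for codes of parallel
  sums.\<close>

lemma ord_on_determined:
  fixes f f' :: "'a \<Rightarrow> nat"
  assumes fin: "finite X" and X: "X = X1 \<union> X2" "X1 \<inter> X2 = {}"
    and inj: "inj_on f X" "inj_on f' X"
    and eq: "ord_on f X1 = ord_on f' X1" "ord_on f X2 = ord_on f' X2"
    and pat: "rk f X ` X1 = rk f' X ` X1"
  shows "ord_on f X = ord_on f' X"
proof -
  \<comment> \<open>The rank of \<open>x\<close> within \<open>Y\<close> and the set of ranks of
    \<open>Y\<close> in \<open>X\<close> are both known, and together they give the rank of
    \<open>x\<close> in \<open>X\<close>.\<close>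
  have half: "rk f X x = rk f' X x"
    if Y: "Y \<subseteq> X" "ord_on f Y = ord_on f' Y" "rk f X ` Y = rk f' X ` Y" and x: "x \<in> Y" for x Y
  proof -
    have "rk (\<lambda>t. t) (rk F X ` Y) (rk F X x) = rk F Y x" if "inj_on F X" for F
    proof (rule rk_compose)
      show "inj_on (rk F X) Y"
        using rk_bij_betw[OF fin that] Y(1) by (meson bij_betw_def inj_on_subset)
    qed (use rk_le_iff[OF fin] x Y(1) in blast)
    moreover have "rk f Y x = rk f' Y x"
    proof -
      have "{z \<in> Y. F z \<le> F x} = {z. (z, x) \<in> ord_on F Y}" for F
        using x by (auto simp: ord_on_def)
      then show ?thesis by (simp add: rk_def Y(2))
    qed
    ultimately have "rk (\<lambda>t. t) (rk f X ` Y) (rk f X x) = rk (\<lambda>t. t) (rk f X ` Y) (rk f' X x)"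
      using inj Y(3) by metis
    moreover have "finite (rk f X ` Y)" using fin Y(1) finite_subset by blast
    ultimately show ?thesis
      using rk_bij_betw[of "rk f X ` Y" "\<lambda>t. t"] x Y(3)
      by (metis bij_betw_def imageI inj_on_id2 inj_onD)
  qed
  have "rk F X ` X2 = {1..card X} - rk F X ` X1" if "inj_on F X" for F
  proof -
    have b: "bij_betw (rk F X) X {1..card X}" using rk_bij_betw[OF fin that] .
    have "X2 = X - X1" using X by auto
    then have "rk F X ` X2 = rk F X ` X - rk F X ` X1"
      using inj_on_image_set_diff[of "rk F X" X X X1] b X(1) by (auto simp: bij_betw_def)
    with b show ?thesis by (simp add: bij_betw_def)
  qed
  then have "rk f X ` X2 = rk f' X ` X2" using inj pat by simp
  then have "rk f X x = rk f' X x" if "x \<in> X" for x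
    using that half[of X1 x] half[of X2 x] eq pat X by auto
  moreover have "ord_on F X = {(x, y) \<in> X \<times> X. rk F X x \<le> rk F X y}" for F
    using rk_le_iff[OF fin] by (auto simp: ord_on_def)
  ultimately show ?thesis by auto
qed

section \<open>Order statistics of a uniformly random k-subset\<close>

definition ksubsets :: "nat \<Rightarrow> nat \<Rightarrow> nat set set" where
  "ksubsets N k = {S. S \<subseteq> {1..N} \<and> card S = k}"

lemma ksubsetsD: "S \<in> ksubsets N k \<Longrightarrow> S \<subseteq> {1..N} \<and> finite S \<and> card S = k"
  unfolding ksubsets_def using finite_subset[of S "{1..N}"] by blast

lemma finite_ksubsets: "finite (ksubsets N k)"
  unfolding ksubsets_def by (rule finite_subset[of _ "Pow {1..N}"]) auto

lemma card_ksubsets: "card (ksubsets N k) = N choose k"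
  unfolding ksubsets_def using n_subsets[of "{1..N}" k] by simp

lemma ksubsets_complement:
  assumes "S \<in> ksubsets (a + b) a"
  shows "{1..a + b} - S \<in> ksubsets (a + b) b" "{1..a + b} - ({1..a + b} - S) = S"
proof -
  have S: "S \<subseteq> {1..a + b}" "finite S" "card S = a" using ksubsetsD[OF assms] by auto
  have "card ({1..a + b} - S) = card {1..a + b} - card S" using S by (intro card_Diff_subset)
  then have "card ({1..a + b} - S) = b" unfolding S(3) by simp
  then show "{1..a + b} - S \<in> ksubsets (a + b) b" unfolding ksubsets_def by blast
  show "{1..a + b} - ({1..a + b} - S) = S" using S(1) by blast
qed

lemma sum_ksubsets_complement:
  "(\<Sum>S\<in>ksubsets (a + b) a. F ({1..a + b} - S)) = (\<Sum>T\<in>ksubsets (a + b) b. F T)"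
proof (rule sum.reindex_bij_witness[of _ "\<lambda>T. {1..a + b} - T" "\<lambda>T. {1..a + b} - T"])
  fix S assume "S \<in> ksubsets (a + b) a"
  then show "{1..a + b} - S \<in> ksubsets (a + b) b" "{1..a + b} - ({1..a + b} - S) = S"
    by (fact ksubsets_complement)+
next
  fix S assume "S \<in> ksubsets (a + b) b"
  then show "{1..a + b} - S \<in> ksubsets (a + b) a" "{1..a + b} - ({1..a + b} - S) = S"
    using ksubsets_complement[of S b a] by (simp_all only: add.commute[of b a])
qed simp

text \<open>Splitting a set at its \<open>j\<close>-th element \<open>v\<close> leaves free choices
  of \<open>j - 1\<close> elements below and \<open>k - j\<close> elements above.\<close>

lemma card_ksubsets_elem:
  assumes "j \<in> {1..k}" "v \<in> {1..N}"
  shows "card {S \<in> ksubsets N k. nth_elem S j = v} = ((v - 1) choose (j - 1)) * ((N - v) choose (k - j))"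
proof -
  let ?A = "{A. A \<subseteq> {1..v - 1} \<and> card A = j - 1}"
  let ?B = "{B. B \<subseteq> {v + 1..N} \<and> card B = k - j}"
  have "bij_betw (\<lambda>(A, B). A \<union> insert v B) (?A \<times> ?B) {S \<in> ksubsets N k. nth_elem S j = v}"
  proof (rule bij_betw_byWitness[where f' = "\<lambda>S. (S \<inter> {1..v - 1}, S \<inter> {v + 1..N})"])
    show "\<forall>a\<in>?A \<times> ?B. (\<lambda>S. (S \<inter> {1..v - 1}, S \<inter> {v + 1..N})) ((\<lambda>(A, B). A \<union> insert v B) a) = a"
    proof
      fix a assume "a \<in> ?A \<times> ?B"
      then obtain A B where a: "a = (A, B)" "A \<subseteq> {1..v - 1}" "B \<subseteq> {v + 1..N}" by auto
      moreover have "{1..v - 1} \<inter> {v + 1..N} = {}" "v \<notin> {1..v - 1}" "v \<notin> {v + 1..N}"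
        using assms by auto
      ultimately have "(A \<union> insert v B) \<inter> {1..v - 1} = A" "(A \<union> insert v B) \<inter> {v + 1..N} = B"
        by blast+
      then show "(\<lambda>S. (S \<inter> {1..v - 1}, S \<inter> {v + 1..N})) ((\<lambda>(A, B). A \<union> insert v B) a) = a"
        by (simp add: a(1))
    qed
    show "\<forall>S\<in>{S \<in> ksubsets N k. nth_elem S j = v}.
        (\<lambda>(A, B). A \<union> insert v B) (S \<inter> {1..v - 1}, S \<inter> {v + 1..N}) = S"
    proof
      fix S assume "S \<in> {S \<in> ksubsets N k. nth_elem S j = v}"
      then have S: "S \<subseteq> {1..N}" "finite S" "card S = k" "nth_elem S j = v"
        using ksubsetsD by auto
      then have "v \<in> S" using nth_elem_in[of S j] assms by auto
      moreover have "t \<in> (S \<inter> {1..v - 1}) \<union> insert v (S \<inter> {v + 1..N})" if "t \<in> S" for t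
      proof -
        have "1 \<le> t" "t \<le> N" using S(1) that by auto
        with that show ?thesis by (cases t v rule: linorder_cases) auto
      qed
      ultimately show "(\<lambda>(A, B). A \<union> insert v B) (S \<inter> {1..v - 1}, S \<inter> {v + 1..N}) = S"
        unfolding prod.case by blast
    qed
    show "(\<lambda>(A, B). A \<union> insert v B) ` (?A \<times> ?B) \<subseteq> {S \<in> ksubsets N k. nth_elem S j = v}"
    proof clarsimp
      fix A B assume A: "A \<subseteq> {Suc 0..v - Suc 0}" "card A = j - Suc 0"
        and B: "B \<subseteq> {Suc v..N}" "card B = k - j"
      have fin: "finite A" "finite B" using A B finite_subset by auto
      have "v \<notin> B" using B by auto
      moreover have "A \<inter> insert v B = {}" using A B assms by fastforce
      ultimately have "card (A \<union> insert v B) = k"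
        using fin A B assms by (subst card_Un_disjoint) auto
      moreover have "A \<union> insert v B \<subseteq> {1..N}" using A B assms by fastforce
      moreover have "nth_elem (A \<union> insert v B) j = v"
      proof (rule nth_elem_eqI)
        have "{s \<in> A \<union> insert v B. s \<le> v} = insert v A" using A B assms by fastforce
        moreover have "v \<notin> A" using A assms by auto
        ultimately show "card {s \<in> A \<union> insert v B. s \<le> v} = j" using fin A assms by auto
      qed (use fin in auto)
      ultimately show "insert v (A \<union> B) \<in> ksubsets N k \<and> nth_elem (insert v (A \<union> B)) j = v"
        by (simp add: ksubsets_def)
    qed
    show "(\<lambda>S. (S \<inter> {1..v - 1}, S \<inter> {v + 1..N})) ` {S \<in> ksubsets N k. nth_elem S j = v} \<subseteq> ?A \<times> ?B"
    proof clarsimp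
      fix S assume "S \<in> ksubsets N k" "v = nth_elem S j"
      then have S: "S \<subseteq> {1..N}" "finite S" "card S = k" "nth_elem S j = v"
        using ksubsetsD by auto
      have v: "v \<in> S" using nth_elem_in[of S j] S assms by auto
      have "card {s \<in> S. s \<le> v} = j"
        using rk_elem[of S j] S assms by (simp add: rk_def)
      moreover have "{s \<in> S. s \<le> v} = insert v (S \<inter> {1..v - 1})" using v S(1) assms by fastforce
      moreover have "v \<notin> S \<inter> {1..v - 1}" using assms by auto
      ultimately have a: "card (S \<inter> {1..v - 1}) = j - 1" using S(2) by simp
      have "S = (S \<inter> {1..v - 1}) \<union> insert v (S \<inter> {v + 1..N})"
      proof (intro equalityI subsetI)
        fix t assume "t \<in> S"
        moreover from this have "1 \<le> t" "t \<le> N" using S(1) by auto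
        ultimately show "t \<in> (S \<inter> {1..v - 1}) \<union> insert v (S \<inter> {v + 1..N})"
          by (cases t v rule: linorder_cases) auto
      qed (use v in auto)
      then have "card S = card ((S \<inter> {1..v - 1}) \<union> insert v (S \<inter> {v + 1..N}))" by simp
      also have "\<dots> = card (S \<inter> {1..v - 1}) + card (insert v (S \<inter> {v + 1..N}))"
        using S by (intro card_Un_disjoint) auto
      also have "\<dots> = (j - 1) + (1 + card (S \<inter> {v + 1..N}))" using a S by simp
      finally show "card (S \<inter> {Suc 0..nth_elem S j - Suc 0}) = j - Suc 0 \<and> card (S \<inter> {Suc (nth_elem S j)..N}) = k - j"
        using S assms a by auto
    qed
  qed
  from bij_betw_same_card[OF this] show ?thesis
    using n_subsets[of "{1..v - 1}" "j - 1"] n_subsets[of "{v + 1..N}" "k - j"]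
    by (simp add: card_cartesian_product)
qed

text \<open>Classifies the \<open>k\<close>-subsets by the value of their \<open>j\<close>-th
  element. With all parameters shifted by one, the same identity evaluates the mean below.\<close>

lemma sum_choose_mult_choose:
  assumes "j \<in> {1..k}"
  shows "(\<Sum>v=1..N. ((v - 1) choose (j - 1)) * ((N - v) choose (k - j))) = N choose k"
proof -
  have "N choose k = card (\<Union>v\<in>{1..N}. {S \<in> ksubsets N k. nth_elem S j = v})"
  proof -
    have "nth_elem S j \<in> {1..N}" if "S \<in> ksubsets N k" for S
      using nth_elem_in[of S j] ksubsetsD[OF that] assms by auto
    then have "(\<Union>v\<in>{1..N}. {S \<in> ksubsets N k. nth_elem S j = v}) = ksubsets N k" by auto
    then show ?thesis by (simp add: card_ksubsets)
  qed
  also have "\<dots> = (\<Sum>v=1..N. card {S \<in> ksubsets N k. nth_elem S j = v})"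
    by (rule card_UN_disjoint) (auto simp: finite_ksubsets)
  finally show ?thesis using card_ksubsets_elem[OF assms] by simp
qed

text \<open>The weight \<open>v\<close> is absorbed by v C(v - 1, j - 1) = j C(v, j); what remains
  counts the \<open>Suc k\<close>-subsets of \<open>{1..Suc N}\<close> by their element number
  \<open>Suc j\<close>.\<close>

lemma sum_elem_ksubsets_nat:
  assumes "j \<in> {1..k}"
  shows "(\<Sum>S\<in>ksubsets N k. nth_elem S j) = j * (Suc N choose Suc k)"
proof -
  have fin: "finite (ksubsets N k)" by (rule finite_ksubsets)
  have img: "(\<lambda>S. nth_elem S j) ` ksubsets N k \<subseteq> {1..N}"
  proof (rule image_subsetI)
    fix S assume "S \<in> ksubsets N k"
    then show "nth_elem S j \<in> {1..N}"
      using nth_elem_in[of S j] ksubsetsD[of S N k] assms by auto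
  qed
  have "(\<Sum>S\<in>ksubsets N k. nth_elem S j) = (\<Sum>v=1..N. \<Sum>S\<in>{S \<in> ksubsets N k. nth_elem S j = v}. nth_elem S j)"
    using sum.group[OF fin _ img, of "\<lambda>S. nth_elem S j"] by simp
  also have "\<dots> = (\<Sum>v=1..N. v * (((v - 1) choose (j - 1)) * ((N - v) choose (k - j))))"
    by (intro sum.cong refl) (simp add: card_ksubsets_elem[OF assms] mult.commute)
  also have "\<dots> = (\<Sum>v=1..N. j * ((v choose j) * ((N - v) choose (k - j))))"
  proof (intro sum.cong refl)
    fix v assume "v \<in> {1..N}"
    then have "v * ((v - 1) choose (j - 1)) = j * (v choose j)"
      using assms Suc_times_binomial_eq[of "v - 1" "j - 1"] by (simp add: mult.commute)
    then show "v * (((v - 1) choose (j - 1)) * ((N - v) choose (k - j))) = j * ((v choose j) * ((N - v) choose (k - j)))"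
      by (metis mult.assoc)
  qed
  \<comment> \<open>The added term \<open>v = 0\<close> vanishes because \<open>j \<ge> 1\<close>;
    with it the range matches the shifted identity.\<close>
  also have "\<dots> = j * (\<Sum>v=0..N. (v choose j) * ((N - v) choose (k - j)))"
    using assms by (simp add: sum_distrib_left sum.atLeast_Suc_atMost[of 0] binomial_eq_0)
  also have "(\<Sum>v=0..N. (v choose j) * ((N - v) choose (k - j))) =
      (\<Sum>v=1..Suc N. ((v - 1) choose (Suc j - 1)) * ((Suc N - v) choose (Suc k - Suc j)))"
    by (rule sum.reindex_bij_witness[of _ "\<lambda>v. v - 1" Suc]) auto
  also have "\<dots> = Suc N choose Suc k"
    by (rule sum_choose_mult_choose) (use assms in auto)
  finally show ?thesis .
qed

text \<open>The point is that the mean is proportional to \<open>j\<close>: this makes a parallel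
  sum scale all heights by one factor, which for \<open>N = 2 * m\<close> and \<open>k = m\<close>
  is (2m + 1) / (m + 1).\<close>

lemma sum_elem_ksubsets:
  assumes "j \<in> {1..k}"
  shows "(\<Sum>S\<in>ksubsets N k. real (nth_elem S j)) =
    real j * ((real N + 1) / (real k + 1)) * real (card (ksubsets N k))"
proof -
  have "(real k + 1) * real (Suc N choose Suc k) = (real N + 1) * real (N choose k)"
    using arg_cong[OF Suc_times_binomial_eq[of N k], of real] unfolding of_nat_mult
    by (simp add: algebra_simps)
  then have "real (Suc N choose Suc k) = (real N + 1) / (real k + 1) * real (N choose k)"
    by (simp add: field_simps)
  moreover have "(\<Sum>S\<in>ksubsets N k. real (nth_elem S j)) = real j * real (Suc N choose Suc k)"
    using arg_cong[OF sum_elem_ksubsets_nat[OF assms, of N], of real] by simp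
  ultimately show ?thesis by (simp add: card_ksubsets)
qed

section \<open>Binomial coefficients up to constants, squared to stay within the natural
  numbers\<close>

lemma central_choose_upper: "((2 * k) choose k)\<^sup>2 * (2 * k + 1) \<le> 16 ^ k"
  and central_choose_lower: "k > 0 \<Longrightarrow> 16 ^ k \<le> ((2 * k) choose k)\<^sup>2 * (4 * k)"
proof -
  have step: "Suc k * ((2 * Suc k) choose Suc k) = 2 * (2 * k + 1) * ((2 * k) choose k)" for k :: nat
  proof -
    have "Suc k * ((2 * Suc k) choose Suc k) = (Suc (2 * k + 1) choose Suc k) * Suc k"
      by (simp only: mult.commute) simp
    also have "\<dots> = Suc (2 * k + 1) * ((2 * k + 1) choose k)"
      by (rule Suc_times_binomial_eq[symmetric])
    also have "(2 * k + 1) choose k = Suc (2 * k) choose Suc k"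
      using binomial_symmetric[of k "2 * k + 1"] by simp
    also have "Suc (2 * k + 1) * (Suc (2 * k) choose Suc k) = 2 * ((Suc (2 * k) choose Suc k) * Suc k)"
      by (simp only: mult_ac) simp
    also have "(Suc (2 * k) choose Suc k) * Suc k = Suc (2 * k) * ((2 * k) choose k)"
      by (rule Suc_times_binomial_eq[symmetric])
    also have "2 * (Suc (2 * k) * ((2 * k) choose k)) = 2 * (2 * k + 1) * ((2 * k) choose k)"
      by simp
    finally show ?thesis .
  qed
  have sq: "(Suc k)\<^sup>2 * (c'\<^sup>2 * d) = (2 * (2 * k + 1) * c)\<^sup>2 * d" if "Suc k * c' = 2 * (2 * k + 1) * c"
    for c c' d k :: nat
    unfolding that[symmetric] by (simp only: power_mult_distrib mult.assoc)
  show "((2 * k) choose k)\<^sup>2 * (2 * k + 1) \<le> 16 ^ k"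
  proof (induction k)
    case (Suc k)
    define c where "c = (2 * k) choose k"
    have "(Suc k)\<^sup>2 * (((2 * Suc k) choose Suc k)\<^sup>2 * (2 * Suc k + 1)) =
        (2 * (2 * k + 1) * c)\<^sup>2 * (2 * Suc k + 1)"
      unfolding c_def by (rule sq[OF step])
    also have "\<dots> = 4 * (2 * k + 1) * (2 * k + 3) * (c\<^sup>2 * (2 * k + 1))"
      by (simp add: power2_eq_square algebra_simps)
    also have "\<dots> \<le> 4 * (2 * k + 1) * (2 * k + 3) * 16 ^ k"
      using Suc.IH unfolding c_def by (intro mult_left_mono) auto
    \<comment> \<open>This is (2k + 1)(2k + 3) <= (2k + 2)^2.\<close>
    also have "\<dots> \<le> (16 * (Suc k)\<^sup>2) * 16 ^ k"
      by (intro mult_right_mono) (auto simp: power2_eq_square algebra_simps)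
    also have "\<dots> = (Suc k)\<^sup>2 * 16 ^ Suc k" by simp
    finally show ?case by (rule mult_left_le_imp_le) simp
  qed auto
  show "k > 0 \<Longrightarrow> 16 ^ k \<le> ((2 * k) choose k)\<^sup>2 * (4 * k)"
  proof (induction k rule: nat_induct_non_zero)
    case 1
    then show ?case by (simp add: choose_two)
  next
    case (Suc k)
    define c where "c = (2 * k) choose k"
    have "(Suc k)\<^sup>2 * 16 ^ Suc k = 16 * (Suc k)\<^sup>2 * 16 ^ k" by simp
    also have "\<dots> \<le> 16 * (Suc k)\<^sup>2 * (c\<^sup>2 * (4 * k))"
      using Suc.IH unfolding c_def by (intro mult_left_mono) auto
    also have "\<dots> = 4 * (Suc k) * (4 * k * Suc k) * (2 * c)\<^sup>2"
      by (simp add: power2_eq_square algebra_simps)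
    \<comment> \<open>This is 4k(k + 1) <= (2k + 1)^2.\<close>
    also have "\<dots> \<le> 4 * (Suc k) * (2 * k + 1)\<^sup>2 * (2 * c)\<^sup>2"
      by (intro mult_mono) (auto simp: power2_eq_square algebra_simps)
    also have "\<dots> = (2 * (2 * k + 1) * c)\<^sup>2 * (4 * Suc k)"
      by (simp only: power_mult_distrib mult_ac)
    also have "\<dots> = (Suc k)\<^sup>2 * (((2 * Suc k) choose Suc k)\<^sup>2 * (4 * Suc k))"
      unfolding c_def by (rule sq[OF step, symmetric])
    finally show ?case by (rule mult_left_le_imp_le) simp
  qed
qed

text \<open>The middle entry is the largest of its row. For odd rows the bound follows from the next
  even row, whose central entry is exactly twice as large.\<close>

lemma choose_upper: "(s choose a)\<^sup>2 * (s + 1) \<le> 4 ^ s"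
proof -
  have "(s choose (s div 2))\<^sup>2 * (s + 1) \<le> 4 ^ s"
  proof (cases "even s")
    case True
    then obtain k where "s = 2 * k" by auto
    then show ?thesis using central_choose_upper[of k] by (simp add: power_mult)
  next
    case False
    then obtain k where k: "s = 2 * k + 1" using oddE by blast
    have "(2 * k + 1) choose (Suc k) = (2 * k + 1) choose k"
      using binomial_symmetric[of k "2 * k + 1"] by simp
    then have "(2 * Suc k) choose Suc k = 2 * ((2 * k + 1) choose k)" by simp
    then have "4 * (((2 * k + 1) choose k)\<^sup>2 * (2 * k + 3)) \<le> 4 * (4 * 16 ^ k)"
      using central_choose_upper[of "Suc k"]
      by (simp only: power_mult_distrib) (simp add: power_mult algebra_simps)
    moreover have "((2 * k + 1) choose k)\<^sup>2 * (2 * k + 2) \<le> ((2 * k + 1) choose k)\<^sup>2 * (2 * k + 3)"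
      by (intro mult_left_mono) auto
    ultimately have "((2 * k + 1) choose k)\<^sup>2 * (2 * k + 2) \<le> 4 * 16 ^ k" by linarith
    then show ?thesis using k by (simp add: power_mult)
  qed
  moreover have "(s choose a)\<^sup>2 * (s + 1) \<le> (s choose (s div 2))\<^sup>2 * (s + 1)"
    using binomial_maximum by (intro mult_right_mono power_mono) auto
  ultimately show ?thesis by linarith
qed

section \<open>Linear extensions of sums\<close>

text \<open>Anti-concentration of an order statistic. The number of subsets with \<open>j\<close>-th
  element \<open>v\<close> is a product of two binomials, each at most 2^s / sqrt (s + 1) for its
  row s, while the total C(2m, m) is at least 4^m / (2 sqrt m). So each of the fewer than
  \<open>n\<close> values in the window has probability at most 1 / sqrt (l + 1).\<close>

lemma card_ksubsets_window:
  assumes m: "m = 2 * l + n" and j: "j \<in> {1..m}"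
  shows "real (card {T \<in> ksubsets (2 * m) m. l + j < nth_elem T j \<and> nth_elem T j < l + n + j})
    \<le> real n / sqrt (real l + 1) * real (card (ksubsets (2 * m) m))"
proof -
  let ?C = "(2 * m) choose m"
  let ?K = "\<lambda>v. {T \<in> ksubsets (2 * m) m. nth_elem T j = v}"
  have m0: "m > 0" using j by auto
  have one: "real (card (?K v)) \<le> real ?C / sqrt (real l + 1)" if v: "v \<in> {l + j<..<l + n + j}" for v
  proof -
    have v': "v \<ge> 1" "v \<le> 2 * m" "v \<ge> l + 1" "2 * m + 1 - v \<ge> l + 1" using v m j by auto
    define a where "a = (v - 1) choose (j - 1)"
    define b where "b = (2 * m - v) choose (m - j)"
    have card: "card (?K v) = a * b" unfolding a_def b_def
      using card_ksubsets_elem[of j m v "2 * m"] j v' by auto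
    have "a\<^sup>2 * v \<le> 4 ^ (v - 1)" unfolding a_def
      using choose_upper[of "v - 1" "j - 1"] v'(1) by simp
    moreover have "b\<^sup>2 * (2 * m + 1 - v) \<le> 4 ^ (2 * m - v)" unfolding b_def
      using choose_upper[of "2 * m - v" "m - j"] v'(2) by (simp add: Suc_diff_le)
    ultimately have "(a\<^sup>2 * v) * (b\<^sup>2 * (2 * m + 1 - v)) \<le> 4 ^ (v - 1) * 4 ^ (2 * m - v)"
      by (rule mult_mono) auto
    also have "\<dots> = 4 ^ (2 * m - 1)" using v' by (simp flip: power_add)
    finally have "4 * ((a * b)\<^sup>2 * (v * (2 * m + 1 - v))) \<le> 4 * 4 ^ (2 * m - 1)"
      by (simp add: power_mult_distrib mult_ac)
    also have "\<dots> = 4 ^ (2 * m)" using m0 by (simp flip: power_Suc)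
    also have "\<dots> = 16 ^ m" by (simp add: power_mult)
    also have "\<dots> \<le> ?C\<^sup>2 * (4 * m)" using central_choose_lower[OF m0] .
    finally have up: "(a * b)\<^sup>2 * (v * (2 * m + 1 - v)) \<le> ?C\<^sup>2 * m" by simp
    \<comment> \<open>The two factors add up to \<open>2 * m + 1\<close>, so one of them is at least
      \<open>m\<close>; the other is at least \<open>l + 1\<close> because the window stays away
      from both ends.\<close>
    have "(l + 1) * m \<le> v * (2 * m + 1 - v)"
    proof (cases "v \<ge> m")
      case True
      then have "m * (l + 1) \<le> v * (2 * m + 1 - v)" using v' by (intro mult_mono) auto
      then show ?thesis by (simp only: mult.commute)
    next
      case False
      then show ?thesis using v' by (intro mult_mono) auto
    qed
    then have "(a * b)\<^sup>2 * ((l + 1) * m) \<le> (a * b)\<^sup>2 * (v * (2 * m + 1 - v))"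
      by (rule mult_left_mono) simp
    with up have "((a * b)\<^sup>2 * (l + 1)) * m \<le> ?C\<^sup>2 * m" by (simp only: mult.assoc)
    then have "(a * b)\<^sup>2 * (l + 1) \<le> ?C\<^sup>2" using m0 by simp
    then have "real ((a * b)\<^sup>2 * (l + 1)) \<le> real (?C\<^sup>2)" by (rule of_nat_mono)
    then have "(real (a * b) * sqrt (real l + 1))\<^sup>2 \<le> (real ?C)\<^sup>2"
      by (simp add: power_mult_distrib algebra_simps)
    then have "real (a * b) * sqrt (real l + 1) \<le> real ?C"
      by (rule power2_le_imp_le) simp
    moreover have "0 < sqrt (real l + 1)" by simp
    ultimately show ?thesis unfolding card by (simp add: pos_le_divide_eq)
  qed
  have "{T \<in> ksubsets (2 * m) m. l + j < nth_elem T j \<and> nth_elem T j < l + n + j} = (\<Union>v\<in>{l + j<..<l + n + j}. ?K v)"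
    by auto
  then have "card {T \<in> ksubsets (2 * m) m. l + j < nth_elem T j \<and> nth_elem T j < l + n + j} \<le> (\<Sum>v\<in>{l + j<..<l + n + j}. card (?K v))"
    using card_UN_le[of "{l + j<..<l + n + j}" ?K] by simp
  then have "real (card {T \<in> ksubsets (2 * m) m. l + j < nth_elem T j \<and> nth_elem T j < l + n + j})
      \<le> (\<Sum>v\<in>{l + j<..<l + n + j}. real (card (?K v)))"
    unfolding of_nat_sum[symmetric] by (rule of_nat_mono)
  also have "\<dots> \<le> (\<Sum>v\<in>{l + j<..<l + n + j}. real ?C / sqrt (real l + 1))"
    by (intro sum_mono one)
  also have "\<dots> = real (n - 1) * (real ?C / sqrt (real l + 1))"
    by simp
  also have "\<dots> \<le> real n * (real ?C / sqrt (real l + 1))"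
    by (intro mult_right_mono) auto
  finally show ?thesis by (simp add: card_ksubsets)
qed

lemma linear_extensionsD:
  assumes "f \<in> linear_extensions P"
  shows "f \<in> extensional (Field P)" "bij_betw f (Field P) {1..card (Field P)}"
    "\<And>x y. (x, y) \<in> P \<Longrightarrow> f x \<le> f y"
  using assms by (auto simp: linear_extensions_def)

lemma linear_extensionsI:
  assumes "f \<in> extensional (Field P)" "bij_betw f (Field P) {1..card (Field P)}"
    "\<And>x y. (x, y) \<in> P \<Longrightarrow> f x \<le> f y"
  shows "f \<in> linear_extensions P"
  using assms by (auto simp: linear_extensions_def)

lemma linear_extension_range:
  "f \<in> linear_extensions P \<Longrightarrow> x \<in> Field P \<Longrightarrow> f x \<in> {1..card (Field P)}"
  using linear_extensionsD(2) bij_betw_apply by metis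

lemma finite_linear_extensions:
  assumes "finite (Field P)"
  shows "finite (linear_extensions P)"
proof (rule finite_subset)
  show "linear_extensions P \<subseteq> Field P \<rightarrow>\<^sub>E {1..card (Field P)}"
  proof
    fix f assume f: "f \<in> linear_extensions P"
    then show "f \<in> Field P \<rightarrow>\<^sub>E {1..card (Field P)}"
      using linear_extensionsD(1)[OF f] linear_extension_range[OF f] by (auto simp: PiE_def)
  qed
  show "finite (Field P \<rightarrow>\<^sub>E {1..card (Field P)})" using assms by (intro finite_PiE) auto
qed

text \<open>Spreading \<open>g\<close> over the positions in \<open>S\<close> keeps relative order,
  so \<open>g\<close> can be read back as a rank. The map \<open>e\<close> stands for the embedding
  \<open>2 * x\<close> or \<open>Suc (2 * x)\<close> of one summand.\<close>

lemma half_merge: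
  assumes "finite S" "card S = card A" "bij_betw g A {1..card A}" "inj_on e A"
    and f: "\<And>x. x \<in> A \<Longrightarrow> f (e x) = nth_elem S (g x)"
  shows "bij_betw f (e ` A) S" "\<And>x. x \<in> A \<Longrightarrow> rk f (e ` A) (e x) = g x"
proof -
  have "bij_betw (nth_elem S \<circ> g) A S"
    using bij_betw_trans[OF assms(3)] nth_elem_bij_betw[OF assms(1)] assms(2) by simp
  then have "bij_betw (f \<circ> e) A S"
    using f by (subst bij_betw_cong[of A _ "nth_elem S \<circ> g"]) auto
  then show b: "bij_betw f (e ` A) S"
    by (simp add: bij_betw_def image_comp inj_on_imageI)
  fix x assume x: "x \<in> A"
  have "rk f (e ` A) (e x) = rk (\<lambda>t. t) (f ` e ` A) (f (e x))"
    using b by (intro rk_compose[symmetric]) (auto simp: bij_betw_def)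
  also have "\<dots> = rk (\<lambda>t. t) S (nth_elem S (g x))" using b f[OF x] by (simp add: bij_betw_def)
  also have "\<dots> = g x"
    using assms(1-3) x bij_betw_apply by (intro rk_elem) (auto, fastforce+)
  finally show "rk f (e ` A) (e x) = g x" .
qed

lemma half_split:
  assumes "finite A" "inj_on e A" "inj_on f (e ` A)"
  shows "bij_betw (\<lambda>x. rk f (e ` A) (e x)) A {1..card A}"
    "\<And>x. x \<in> A \<Longrightarrow> nth_elem (f ` e ` A) (rk f (e ` A) (e x)) = f (e x)"
proof -
  have "bij_betw e A (e ` A)" using assms by (simp add: bij_betw_def)
  moreover have "bij_betw (rk f (e ` A)) (e ` A) {1..card A}"
    using rk_bij_betw[of "e ` A" f] assms by (simp add: card_image)
  ultimately show "bij_betw (\<lambda>x. rk f (e ` A) (e x)) A {1..card A}"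
    using bij_betw_trans by (fastforce simp: comp_def)
  fix x assume x: "x \<in> A"
  have "rk f (e ` A) (e x) = rk (\<lambda>t. t) (f ` e ` A) (f (e x))"
    using assms by (intro rk_compose[symmetric]) auto
  then show "nth_elem (f ` e ` A) (rk f (e ` A) (e x)) = f (e x)"
    using nth_elem_rk[of "f ` e ` A" "f (e x)"] assms x by simp
qed

section \<open>Merging two linear extensions along a set of positions\<close>

definition merge :: "nat rel \<Rightarrow> nat rel \<Rightarrow> (nat \<Rightarrow> nat) \<times> (nat \<Rightarrow> nat) \<times> nat set \<Rightarrow> nat \<Rightarrow> nat" where
  "merge Q R = (\<lambda>(g, h, S). \<lambda>z\<in>Field (parallel_sum Q R).
     if even z then nth_elem S (g (z div 2))
     else nth_elem ({1..card (Field Q) + card (Field R)} - S) (h (z div 2)))"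

lemma merge_left: "x \<in> Field Q \<Longrightarrow> merge Q R (g, h, S) (2 * x) = nth_elem S (g x)"
  by (simp add: merge_def Field_parallel_sum)

lemma merge_right:
  "x \<in> Field R \<Longrightarrow>
    merge Q R (g, h, S) (Suc (2 * x)) = nth_elem ({1..card (Field Q) + card (Field R)} - S) (h x)"
  by (simp add: merge_def Field_parallel_sum)

lemma card_Field_parallel_sum:
  assumes "finite (Field Q)" "finite (Field R)"
  shows "card (Field (parallel_sum Q R)) = card (Field Q) + card (Field R)"
proof -
  have "2 * x \<noteq> Suc (2 * y)" for x y :: nat by presburger
  then have "(\<lambda>x. 2 * x) ` Field Q \<inter> (\<lambda>x. Suc (2 * x)) ` Field R = {}" by auto
  then show ?thesis
    using assms by (simp add: Field_parallel_sum card_Un_disjoint card_image inj_on_def)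
qed

lemma Field_ordinal_sum_eq: "Field (ordinal_sum Q R) = Field (parallel_sum Q R)"
  by (simp add: Field_ordinal_sum Field_parallel_sum)

lemma merge_image:
  assumes fin: "finite (Field Q)" "finite (Field R)"
    and t: "g \<in> linear_extensions Q" "h \<in> linear_extensions R"
      "S \<in> ksubsets (card (Field Q) + card (Field R)) (card (Field Q))"
  defines "f \<equiv> merge Q R (g, h, S)"
  shows "bij_betw f ((\<lambda>x. 2 * x) ` Field Q) S"
    "bij_betw f ((\<lambda>x. Suc (2 * x)) ` Field R) ({1..card (Field Q) + card (Field R)} - S)"
    "\<And>x. x \<in> Field Q \<Longrightarrow> rk f ((\<lambda>x. 2 * x) ` Field Q) (2 * x) = g x"
    "\<And>x. x \<in> Field R \<Longrightarrow> rk f ((\<lambda>x. Suc (2 * x)) ` Field R) (Suc (2 * x)) = h x"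
proof -
  note S = ksubsetsD[OF t(3)] and S' = ksubsetsD[OF ksubsets_complement(1)[OF t(3)]]
  show "bij_betw f ((\<lambda>x. 2 * x) ` Field Q) S"
    "\<And>x. x \<in> Field Q \<Longrightarrow> rk f ((\<lambda>x. 2 * x) ` Field Q) (2 * x) = g x"
    using half_merge[of S "Field Q" g "\<lambda>x. 2 * x" f] S linear_extensionsD(2)[OF t(1)]
    by (auto simp: f_def merge_left inj_on_def)
  show "bij_betw f ((\<lambda>x. Suc (2 * x)) ` Field R) ({1..card (Field Q) + card (Field R)} - S)"
    "\<And>x. x \<in> Field R \<Longrightarrow> rk f ((\<lambda>x. Suc (2 * x)) ` Field R) (Suc (2 * x)) = h x"
    using half_merge[of "{1..card (Field Q) + card (Field R)} - S" "Field R" h "\<lambda>x. Suc (2 * x)" f]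
      S' linear_extensionsD(2)[OF t(2)]
    by (auto simp: f_def merge_right inj_on_def)
qed

text \<open>The inverse records the ranks inside the two halves and the positions of the even half.
  The bijection turns a uniform linear extension of the sum into three independent uniform
  choices.\<close>

lemma merge_bij_parallel:
  assumes fin: "finite (Field Q)" "finite (Field R)"
  shows "bij_betw (merge Q R)
    (linear_extensions Q \<times> linear_extensions R \<times> ksubsets (card (Field Q) + card (Field R)) (card (Field Q)))
    (linear_extensions (parallel_sum Q R))"
proof -
  let ?q = "card (Field Q)" and ?N = "card (Field Q) + card (Field R)"
  let ?P = "parallel_sum Q R"
  let ?E = "(\<lambda>x. 2 * x) ` Field Q" and ?O = "(\<lambda>x. Suc (2 * x)) ` Field R"
  have inj: "inj_on (\<lambda>x. 2 * x) (Field Q)" "inj_on (\<lambda>x. Suc (2 * x)) (Field R)"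
    by (auto simp: inj_on_def)
  have "2 * x \<noteq> Suc (2 * y)" for x y :: nat by presburger
  then have disj: "?E \<inter> ?O = {}" by auto
  have F: "Field ?P = ?E \<union> ?O" by (rule Field_parallel_sum)
  have cF: "card (Field ?P) = ?N" by (rule card_Field_parallel_sum[OF fin])
  define sp where "sp f = (restrict (\<lambda>x. rk f ?E (2 * x)) (Field Q),
    restrict (\<lambda>x. rk f ?O (Suc (2 * x))) (Field R), f ` ?E)" for f
  have spl: "inj_on f ?E" "inj_on f ?O" "f ` ?O = {1..?N} - f ` ?E" "f ` ?E \<in> ksubsets ?N ?q"
    if f: "f \<in> linear_extensions ?P" for f
  proof -
    have b: "bij_betw f (?E \<union> ?O) {1..?N}" using linear_extensionsD(2)[OF f] by (simp add: F cF[unfolded F])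
    then show i: "inj_on f ?E" "inj_on f ?O" by (auto simp: bij_betw_def inj_on_Un)
    have "?O = (?E \<union> ?O) - ?E" using disj by auto
    moreover have "f ` ((?E \<union> ?O) - ?E) = f ` (?E \<union> ?O) - f ` ?E"
      using b by (intro inj_on_image_set_diff[of f "?E \<union> ?O"]) (auto simp: bij_betw_def)
    ultimately show "f ` ?O = {1..?N} - f ` ?E" using b by (simp add: bij_betw_def)
    have "f ` ?E \<subseteq> {1..?N}" using b unfolding bij_betw_def by blast
    moreover have "card (f ` ?E) = ?q" using i inj by (simp add: card_image)
    ultimately show "f ` ?E \<in> ksubsets ?N ?q" by (simp add: ksubsets_def)
  qed
  show ?thesis
  proof (rule bij_betw_byWitness[where f' = sp])
    show "\<forall>a\<in>linear_extensions Q \<times> linear_extensions R \<times> ksubsets ?N ?q. sp (merge Q R a) = a"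
    proof clarify
      fix g h S assume t: "g \<in> linear_extensions Q" "h \<in> linear_extensions R" "S \<in> ksubsets ?N ?q"
      note mi = merge_image[OF fin t]
      have "restrict (\<lambda>x. rk (merge Q R (g, h, S)) ?E (2 * x)) (Field Q) = g"
        using mi(3) linear_extensionsD(1)[OF t(1)] by (intro extensionalityI[of _ "Field Q"]) auto
      moreover have "restrict (\<lambda>x. rk (merge Q R (g, h, S)) ?O (Suc (2 * x))) (Field R) = h"
        using mi(4) linear_extensionsD(1)[OF t(2)] by (intro extensionalityI[of _ "Field R"]) auto
      ultimately show "sp (merge Q R (g, h, S)) = (g, h, S)"
        using mi(1) unfolding sp_def by (simp add: bij_betw_def)
    qed
    show "\<forall>f\<in>linear_extensions ?P. merge Q R (sp f) = f"
    proof
      fix f assume f: "f \<in> linear_extensions ?P"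
      note s = spl[OF f]
      show "merge Q R (sp f) = f"
      proof (rule extensionalityI[of _ "Field ?P"])
        show "merge Q R (sp f) \<in> extensional (Field ?P)" by (simp add: merge_def sp_def)
        show "f \<in> extensional (Field ?P)" using linear_extensionsD(1)[OF f] .
        fix z assume "z \<in> Field ?P"
        then consider x where "z = 2 * x" "x \<in> Field Q" | x where "z = Suc (2 * x)" "x \<in> Field R"
          unfolding F by auto
        then show "merge Q R (sp f) z = f z"
        proof cases
          case 1
          then show ?thesis
            using half_split(2)[OF fin(1) inj(1) s(1)] by (simp add: sp_def merge_left)
        next
          case 2
          then show ?thesis
            using half_split(2)[OF fin(2) inj(2) s(2)] s(3) by (simp add: sp_def merge_right)
        qed
      qed
    qed
    show "merge Q R ` (linear_extensions Q \<times> linear_extensions R \<times> ksubsets ?N ?q) \<subseteq> linear_extensions ?P"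
    proof clarify
      fix g h S assume t: "g \<in> linear_extensions Q" "h \<in> linear_extensions R" "S \<in> ksubsets ?N ?q"
      note mi = merge_image[OF fin t]
      note S = ksubsetsD[OF t(3)] and S' = ksubsetsD[OF ksubsets_complement(1)[OF t(3)]]
      show "merge Q R (g, h, S) \<in> linear_extensions ?P"
      proof (rule linear_extensionsI)
        show "merge Q R (g, h, S) \<in> extensional (Field ?P)" by (simp add: merge_def)
        have "bij_betw (merge Q R (g, h, S)) (?E \<union> ?O) (S \<union> ({1..?N} - S))"
          by (rule bij_betw_combine[OF mi(1,2)]) auto
        moreover have "S \<union> ({1..?N} - S) = {1..?N}" using S by auto
        ultimately show "bij_betw (merge Q R (g, h, S)) (Field ?P) {1..card (Field ?P)}"
          unfolding cF by (simp only: F)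
        fix x y assume "(x, y) \<in> ?P"
        then consider a b where "x = 2 * a" "y = 2 * b" "(a, b) \<in> Q"
          | a b where "x = Suc (2 * a)" "y = Suc (2 * b)" "(a, b) \<in> R"
          unfolding parallel_sum_iff by (metis dvd_mult_div_cancel odd_two_times_div_two_succ Suc_eq_plus1)
        then show "merge Q R (g, h, S) x \<le> merge Q R (g, h, S) y"
        proof cases
          case 1
          then have "a \<in> Field Q" "b \<in> Field Q" "g a \<le> g b"
            using linear_extensionsD(3)[OF t(1)] by (auto simp: Field_def)
          then show ?thesis
            using nth_elem_le_iff[of S "g a" "g b"] S linear_extension_range[OF t(1)]
            by (simp add: 1 merge_left)
        next
          case 2
          then have "a \<in> Field R" "b \<in> Field R" "h a \<le> h b"
            using linear_extensionsD(3)[OF t(2)] by (auto simp: Field_def)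
          then show ?thesis
            using nth_elem_le_iff[of "{1..?N} - S" "h a" "h b"] S' linear_extension_range[OF t(2)]
            by (simp add: 2 merge_right)
        qed
      qed
    qed
    show "sp ` linear_extensions ?P \<subseteq> linear_extensions Q \<times> linear_extensions R \<times> ksubsets ?N ?q"
    proof (rule image_subsetI)
      fix f assume f: "f \<in> linear_extensions ?P"
      note s = spl[OF f]
      have "restrict (\<lambda>x. rk f ?E (2 * x)) (Field Q) \<in> linear_extensions Q"
      proof (rule linear_extensionsI)
        show "bij_betw (restrict (\<lambda>x. rk f ?E (2 * x)) (Field Q)) (Field Q) {1..?q}"
          using half_split(1)[OF fin(1) inj(1) s(1)]
          by (subst bij_betw_cong[of _ _ "\<lambda>x. rk f ?E (2 * x)"]) auto
        fix x y assume xy: "(x, y) \<in> Q"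
        then have "f (2 * x) \<le> f (2 * y)"
          by (intro linear_extensionsD(3)[OF f]) (simp add: parallel_sum_iff)
        then show "restrict (\<lambda>x. rk f ?E (2 * x)) (Field Q) x \<le> restrict (\<lambda>x. rk f ?E (2 * x)) (Field Q) y"
          using xy fin by (simp add: FieldI1 FieldI2 rk_mono)
      qed simp
      moreover have "restrict (\<lambda>x. rk f ?O (Suc (2 * x))) (Field R) \<in> linear_extensions R"
      proof (rule linear_extensionsI)
        show "bij_betw (restrict (\<lambda>x. rk f ?O (Suc (2 * x))) (Field R)) (Field R) {1..card (Field R)}"
          using half_split(1)[OF fin(2) inj(2) s(2)]
          by (subst bij_betw_cong[of _ _ "\<lambda>x. rk f ?O (Suc (2 * x))"]) auto
        fix x y assume xy: "(x, y) \<in> R"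
        then have "f (Suc (2 * x)) \<le> f (Suc (2 * y))"
          by (intro linear_extensionsD(3)[OF f]) (simp add: parallel_sum_iff)
        then show "restrict (\<lambda>x. rk f ?O (Suc (2 * x))) (Field R) x \<le> restrict (\<lambda>x. rk f ?O (Suc (2 * x))) (Field R) y"
          using xy fin by (simp add: FieldI1 FieldI2 rk_mono)
      qed simp
      ultimately show "sp f \<in> linear_extensions Q \<times> linear_extensions R \<times> ksubsets ?N ?q"
        using s(4) by (simp add: sp_def)
    qed
  qed
qed

text \<open>Both kinds of sum are random merges; an ordinal sum is the degenerate case with a single
  admissible position set.\<close>

definition merge_sum :: "nat rel \<Rightarrow> nat rel \<Rightarrow> nat rel \<Rightarrow> nat set set \<Rightarrow> bool" where
  "merge_sum P Q R \<S> \<longleftrightarrow> finite (Field Q) \<and> finite (Field R) \<and>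
     Field P = Field (parallel_sum Q R) \<and> \<S> \<noteq> {} \<and>
     \<S> \<subseteq> ksubsets (card (Field Q) + card (Field R)) (card (Field Q)) \<and>
     bij_betw (merge Q R) (linear_extensions Q \<times> linear_extensions R \<times> \<S>) (linear_extensions P)"

lemma merge_sum_parallel:
  assumes "finite (Field Q)" "finite (Field R)"
  shows "merge_sum (parallel_sum Q R) Q R (ksubsets (card (Field Q) + card (Field R)) (card (Field Q)))"
proof -
  have "card (ksubsets (card (Field Q) + card (Field R)) (card (Field Q))) \<noteq> 0"
    by (simp add: card_ksubsets)
  then have "ksubsets (card (Field Q) + card (Field R)) (card (Field Q)) \<noteq> {}" by auto
  then show ?thesis using assms merge_bij_parallel unfolding merge_sum_def by simp
qed

text \<open>The first summand is forced into the lowest positions, so the linear extensions are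
  those of the parallel sum with this one position set.\<close>

lemma merge_sum_ordinal:
  assumes fin: "finite (Field Q)" "finite (Field R)"
  shows "merge_sum (ordinal_sum Q R) Q R {{1..card (Field Q)}}"
proof -
  let ?q = "card (Field Q)" and ?r = "card (Field R)"
  let ?E = "(\<lambda>x. 2 * x) ` Field Q" and ?O = "(\<lambda>x. Suc (2 * x)) ` Field R"
  have F: "Field (parallel_sum Q R) = ?E \<union> ?O" by (rule Field_parallel_sum)
  have cF: "card (Field (parallel_sum Q R)) = ?q + ?r" by (rule card_Field_parallel_sum[OF fin])
  have S: "{1..?q} \<in> ksubsets (?q + ?r) ?q" by (simp add: ksubsets_def)
  have cE: "card ?E = ?q" "card ?O = ?r" by (simp_all add: card_image inj_on_def)
  have "2 * x \<noteq> Suc (2 * y)" for x y :: nat by presburger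
  then have ne: "x \<noteq> y" if "x \<in> ?E" "y \<in> ?O" for x y using that by auto
  have eq: "linear_extensions (ordinal_sum Q R) = {f \<in> linear_extensions (parallel_sum Q R). f ` ?E = {1..?q}}"
  proof (intro equalityI subsetI)
    fix f assume f: "f \<in> linear_extensions (ordinal_sum Q R)"
    have fp: "f \<in> linear_extensions (parallel_sum Q R)"
      using linear_extensionsD[OF f] unfolding Field_ordinal_sum_eq
      by (intro linear_extensionsI) (auto simp: ordinal_sum_iff)
    have b: "bij_betw f (?E \<union> ?O) {1..?q + ?r}" using linear_extensionsD(2)[OF fp] by (simp only: F cF[unfolded F])
    have lt: "f x < f y" if "x \<in> ?E" "y \<in> ?O" for x y
    proof -
      have "(x, y) \<in> ordinal_sum Q R" using that by (auto simp: ordinal_sum_iff)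
      then have "f x \<le> f y" by (rule linear_extensionsD(3)[OF f])
      moreover have "f x \<noteq> f y"
        using b that ne[OF that] unfolding bij_betw_def inj_on_def by blast
      ultimately show ?thesis by simp
    qed
    \<comment> \<open>The \<open>?r\<close> values on the odd half are distinct and all exceed
      \<open>f x\<close>, which leaves at most \<open>?q\<close> for \<open>f x\<close>.\<close>
    have "f x \<in> {1..?q}" if x: "x \<in> ?E" for x
    proof -
      have "f x \<in> {1..?q + ?r}" using b x unfolding bij_betw_def by blast
      have sub: "f ` ?O \<subseteq> {f x<..?q + ?r}"
      proof (rule image_subsetI)
        fix y assume y: "y \<in> ?O"
        have "f y \<in> {1..?q + ?r}" using b y unfolding bij_betw_def by blast
        with lt[OF x y] show "f y \<in> {f x<..?q + ?r}" by auto
      qed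
      have "card (f ` ?O) = ?r"
        using b cE(2) by (metis bij_betw_def card_image inj_on_Un)
      with card_mono[OF _ sub] have "?r \<le> ?q + ?r - f x" by simp
      with \<open>f x \<in> {1..?q + ?r}\<close> show ?thesis by auto
    qed
    then have "f ` ?E \<subseteq> {1..?q}" by blast
    moreover have "card (f ` ?E) = card {1..?q}"
      using b cE(1) by (metis bij_betw_def card_image inj_on_Un card_atLeastAtMost diff_Suc_1 One_nat_def)
    ultimately have "f ` ?E = {1..?q}" by (intro card_subset_eq) auto
    with fp show "f \<in> {f \<in> linear_extensions (parallel_sum Q R). f ` ?E = {1..?q}}" by blast
  next
    fix f assume "f \<in> {f \<in> linear_extensions (parallel_sum Q R). f ` ?E = {1..?q}}"
    then have f: "f \<in> linear_extensions (parallel_sum Q R)" and E: "f ` ?E = {1..?q}" by auto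
    show "f \<in> linear_extensions (ordinal_sum Q R)"
    proof (rule linear_extensionsI)
      show "f \<in> extensional (Field (ordinal_sum Q R))"
        "bij_betw f (Field (ordinal_sum Q R)) {1..card (Field (ordinal_sum Q R))}"
        using linear_extensionsD(1,2)[OF f] unfolding Field_ordinal_sum_eq by auto
      fix x y assume "(x, y) \<in> ordinal_sum Q R"
      then consider "(x, y) \<in> parallel_sum Q R" | "x \<in> ?E" "y \<in> ?O"
        unfolding ordinal_sum_iff by (force simp: image_iff)
      then show "f x \<le> f y"
      proof cases
        case 1
        then show ?thesis by (rule linear_extensionsD(3)[OF f])
      next
        case 2
        have b: "bij_betw f (?E \<union> ?O) {1..?q + ?r}" using linear_extensionsD(2)[OF f] by (simp only: F cF[unfolded F])
        have "f x \<in> {1..?q}" using E 2(1) by blast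
        moreover have "f y \<notin> {1..?q}"
        proof
          assume "f y \<in> {1..?q}"
          then obtain z where z: "z \<in> ?E" "f y = f z" using E by (metis image_iff)
          have "inj_on f (?E \<union> ?O)" using b unfolding bij_betw_def by blast
          with z 2(2) have "y = z" unfolding inj_on_def by blast
          with ne[OF z(1) 2(2)] show False by simp
        qed
        moreover have "f y \<in> {1..?q + ?r}" using b 2 unfolding bij_betw_def by blast
        ultimately show ?thesis by auto
      qed
    qed
  qed
  have "bij_betw (merge Q R) (linear_extensions Q \<times> linear_extensions R \<times> {{1..?q}})
      (linear_extensions (ordinal_sum Q R))"
  proof (rule bij_betw_subset[OF merge_bij_parallel[OF fin]])
    show "linear_extensions Q \<times> linear_extensions R \<times> {{1..?q}}
      \<subseteq> linear_extensions Q \<times> linear_extensions R \<times> ksubsets (?q + ?r) ?q" using S by auto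
    show "merge Q R ` (linear_extensions Q \<times> linear_extensions R \<times> {{1..?q}}) = linear_extensions (ordinal_sum Q R)"
      unfolding eq
    proof (intro equalityI subsetI)
      fix f assume "f \<in> merge Q R ` (linear_extensions Q \<times> linear_extensions R \<times> {{1..?q}})"
      then obtain g h where gh: "g \<in> linear_extensions Q" "h \<in> linear_extensions R" "f = merge Q R (g, h, {1..?q})"
        by auto
      then show "f \<in> {f \<in> linear_extensions (parallel_sum Q R). f ` ?E = {1..?q}}"
        using merge_image(1)[OF fin gh(1,2) S] bij_betw_apply[OF merge_bij_parallel[OF fin], of "(g, h, {1..?q})"] S
        by (auto simp: bij_betw_def)
    next
      fix f assume f: "f \<in> {f \<in> linear_extensions (parallel_sum Q R). f ` ?E = {1..?q}}"
      then have "f \<in> merge Q R ` (linear_extensions Q \<times> linear_extensions R \<times> ksubsets (?q + ?r) ?q)"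
        using merge_bij_parallel[OF fin] by (simp add: bij_betw_def)
      then obtain g h S where gh: "g \<in> linear_extensions Q" "h \<in> linear_extensions R"
          "S \<in> ksubsets (?q + ?r) ?q" "f = merge Q R (g, h, S)"
        by auto
      then have "S = {1..?q}"
        using merge_image(1)[OF fin gh(1-3)] f by (simp add: bij_betw_def)
      with gh show "f \<in> merge Q R ` (linear_extensions Q \<times> linear_extensions R \<times> {{1..?q}})" by auto
    qed
  qed
  then show ?thesis using fin S unfolding merge_sum_def by (simp add: Field_ordinal_sum_eq)
qed

lemma linear_extensions_chain: "linear_extensions (chain_poset k) = {restrict Suc {..<k}}"
proof (intro equalityI subsetI)
  fix f assume f: "f \<in> linear_extensions (chain_poset k)"
  note D = linear_extensionsD[OF f, unfolded Field_chain_poset]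
  have "f x = Suc x" if x: "x < k" for x
  proof -
    have "f z \<le> f x \<longleftrightarrow> z \<le> x" if z: "z < k" for z
    proof
      assume le: "f z \<le> f x"
      show "z \<le> x"
      proof (rule ccontr)
        assume "\<not> z \<le> x"
        then have "f x \<le> f z" using z by (intro D(3)) (simp add: chain_poset_def)
        with le have "f x = f z" by simp
        then have "x = z" using D(2) x z by (auto simp: bij_betw_def inj_on_def)
        with \<open>\<not> z \<le> x\<close> show False by simp
      qed
    next
      assume "z \<le> x"
      then show "f z \<le> f x" using x by (intro D(3)) (simp add: chain_poset_def)
    qed
    then have "{z \<in> {..<k}. f z \<le> f x} = {..x}" using x by auto
    then have "rk f {..<k} x = Suc x" by (simp add: rk_def)
    then show ?thesis using rk_of_bij[of f "{..<k}" x] D(2) x by simp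
  qed
  then have "f = restrict Suc {..<k}"
    using D(1) by (intro extensionalityI[of _ "{..<k}"]) auto
  then show "f \<in> {restrict Suc {..<k}}" by simp
next
  fix f assume "f \<in> {restrict Suc {..<k}}"
  moreover have "bij_betw (restrict Suc {..<k}) {..<k} {1..k}"
    by (rule bij_betw_byWitness[where f' = "\<lambda>x. x - 1"]) auto
  ultimately show "f \<in> linear_extensions (chain_poset k)"
    by (intro linear_extensionsI, unfold Field_chain_poset) (auto simp: chain_poset_def)
qed

lemma sum_linear_extensions_merge:
  assumes "merge_sum P Q R \<S>"
  shows "(\<Sum>f\<in>linear_extensions P. F f) =
      (\<Sum>g\<in>linear_extensions Q. \<Sum>h\<in>linear_extensions R. \<Sum>S\<in>\<S>. F (merge Q R (g, h, S)))"
    and "card (linear_extensions P) = card (linear_extensions Q) * (card (linear_extensions R) * card \<S>)"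
proof -
  have b: "bij_betw (merge Q R) (linear_extensions Q \<times> linear_extensions R \<times> \<S>) (linear_extensions P)"
    using assms by (simp add: merge_sum_def)
  show "card (linear_extensions P) = card (linear_extensions Q) * (card (linear_extensions R) * card \<S>)"
    using bij_betw_same_card[OF b] by (simp add: card_cartesian_product)
  have "(\<Sum>f\<in>linear_extensions P. F f) = (\<Sum>t\<in>linear_extensions Q \<times> linear_extensions R \<times> \<S>. F (merge Q R t))"
    using sum.reindex_bij_betw[OF b, of F] by simp
  also have "\<dots> = (\<Sum>g\<in>linear_extensions Q. \<Sum>h\<in>linear_extensions R. \<Sum>S\<in>\<S>. F (merge Q R (g, h, S)))"
    by (simp add: sum.cartesian_product)
  finally show "(\<Sum>f\<in>linear_extensions P. F f) = \<dots>" .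
qed

lemma avg_height_eq:
  assumes "finite (Field P)" "linear_extensions P \<noteq> {}"
  shows "avg_height P x = (\<Sum>f\<in>linear_extensions P. real (f x)) / real (card (linear_extensions P))"
  unfolding avg_height_def random_linext_def
  by (rule integral_pmf_of_set) (use assms finite_linear_extensions in auto)

section \<open>Mean heights and gaps\<close>

lemma card_linear_extensions_pos:
  "finite (Field P) \<Longrightarrow> linear_extensions P \<noteq> {} \<Longrightarrow> real (card (linear_extensions P)) > 0"
  by (simp add: card_gt_0_iff finite_linear_extensions)

lemma merge_sum_nonempty:
  assumes "merge_sum P Q R \<S>" "linear_extensions Q \<noteq> {}" "linear_extensions R \<noteq> {}"
  shows "linear_extensions P \<noteq> {}"
  using assms bij_betw_empty2 unfolding merge_sum_def by fastforce

lemma merge_sumD: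
  assumes "merge_sum P Q R \<S>"
  shows "finite (Field Q)" "finite (Field R)" "finite (Field P)" "finite \<S>" "card \<S> > 0"
    "Field P = (\<lambda>x. 2 * x) ` Field Q \<union> (\<lambda>x. Suc (2 * x)) ` Field R"
    "card (Field P) = card (Field Q) + card (Field R)"
    "\<And>S. S \<in> \<S> \<Longrightarrow> S \<in> ksubsets (card (Field Q) + card (Field R)) (card (Field Q))"
proof -
  show f: "finite (Field Q)" "finite (Field R)"
    and F: "Field P = (\<lambda>x. 2 * x) ` Field Q \<union> (\<lambda>x. Suc (2 * x)) ` Field R"
    and "\<And>S. S \<in> \<S> \<Longrightarrow> S \<in> ksubsets (card (Field Q) + card (Field R)) (card (Field Q))"
    using assms by (auto simp: merge_sum_def Field_parallel_sum)
  show "finite (Field P)" using f F by simp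
  show "finite \<S>" using assms finite_ksubsets finite_subset unfolding merge_sum_def by blast
  then show "card \<S> > 0" using assms by (simp add: card_gt_0_iff merge_sum_def)
  show "card (Field P) = card (Field Q) + card (Field R)"
    using assms card_Field_parallel_sum by (simp add: merge_sum_def)
qed

text \<open>Averaging over the position set first: if the mean \<open>j\<close>-th position is
  affine in \<open>j\<close>, heights in the sum are the same affine function of heights in the
  summand. Parallel sums use \<open>\<alpha> = 0\<close>, ordinal sums
  \<open>\<beta> = 1\<close>.\<close>

lemma avg_height_merge:
  assumes ms: "merge_sum P Q R \<S>" and ne: "linear_extensions Q \<noteq> {}" "linear_extensions R \<noteq> {}"
  shows "\<lbrakk>x \<in> Field Q; \<And>j. j \<in> {1..card (Field Q)} \<Longrightarrow>
      (\<Sum>S\<in>\<S>. real (nth_elem S j)) = (\<alpha> + \<beta> * real j) * real (card \<S>)\<rbrakk>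
      \<Longrightarrow> avg_height P (2 * x) = \<alpha> + \<beta> * avg_height Q x"
    and "\<lbrakk>x \<in> Field R; \<And>j. j \<in> {1..card (Field R)} \<Longrightarrow>
      (\<Sum>S\<in>\<S>. real (nth_elem ({1..card (Field Q) + card (Field R)} - S) j)) = (\<alpha> + \<beta> * real j) * real (card \<S>)\<rbrakk>
      \<Longrightarrow> avg_height P (Suc (2 * x)) = \<alpha> + \<beta> * avg_height R x"
proof -
  let ?a = "real (card (linear_extensions Q))" and ?b = "real (card (linear_extensions R))"
  let ?c = "real (card \<S>)"
  note D = merge_sumD[OF ms]
  have pos: "?a > 0" "?b > 0" "?c > 0"
    using card_linear_extensions_pos[OF D(1) ne(1)] card_linear_extensions_pos[OF D(2) ne(2)] D(5) by auto
  have cP: "real (card (linear_extensions P)) = ?a * ?b * ?c"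
    by (simp add: sum_linear_extensions_merge(2)[OF ms])
  have hP: "avg_height P z = (\<Sum>f\<in>linear_extensions P. real (f z)) / (?a * ?b * ?c)" for z
    using avg_height_eq[OF D(3) merge_sum_nonempty[OF ms ne]] by (simp add: cP)
  have lin: "(\<Sum>g\<in>linear_extensions T. (\<alpha> + \<beta> * real (g x)) * k)
      = (\<alpha> + \<beta> * avg_height T x) * k * real (card (linear_extensions T))"
    if "finite (Field T)" "linear_extensions T \<noteq> {}" for T :: "nat rel" and k :: real
  proof -
    have "real (card (linear_extensions T)) > 0"
      by (rule card_linear_extensions_pos[OF that])
    then show ?thesis
      using avg_height_eq[OF that]
      by (simp add: sum.distrib algebra_simps flip: sum_distrib_left sum_distrib_right)
  qed
  {
    assume x: "x \<in> Field Q" and el: "\<And>j. j \<in> {1..card (Field Q)} \<Longrightarrow>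
      (\<Sum>S\<in>\<S>. real (nth_elem S j)) = (\<alpha> + \<beta> * real j) * real (card \<S>)"
    have "(\<Sum>f\<in>linear_extensions P. real (f (2 * x))) =
        (\<Sum>g\<in>linear_extensions Q. \<Sum>h\<in>linear_extensions R. \<Sum>S\<in>\<S>. real (nth_elem S (g x)))"
      by (simp add: sum_linear_extensions_merge(1)[OF ms] merge_left[OF x])
    also have "\<dots> = (\<Sum>g\<in>linear_extensions Q. (\<alpha> + \<beta> * real (g x)) * (?b * ?c))"
      using el linear_extension_range[OF _ x] by (intro sum.cong refl) simp
    also have "\<dots> = (\<alpha> + \<beta> * avg_height Q x) * (?b * ?c) * ?a"
      by (rule lin[OF D(1) ne(1)])
    finally show "avg_height P (2 * x) = \<alpha> + \<beta> * avg_height Q x"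
      using pos by (simp add: hP)
  }
  {
    assume x: "x \<in> Field R" and el: "\<And>j. j \<in> {1..card (Field R)} \<Longrightarrow>
      (\<Sum>S\<in>\<S>. real (nth_elem ({1..card (Field Q) + card (Field R)} - S) j)) = (\<alpha> + \<beta> * real j) * real (card \<S>)"
    have "(\<Sum>f\<in>linear_extensions P. real (f (Suc (2 * x)))) =
        (\<Sum>g\<in>linear_extensions Q. \<Sum>h\<in>linear_extensions R. \<Sum>S\<in>\<S>.
          real (nth_elem ({1..card (Field Q) + card (Field R)} - S) (h x)))"
      by (simp add: sum_linear_extensions_merge(1)[OF ms] merge_right[OF x])
    also have "\<dots> = ?a * (\<Sum>h\<in>linear_extensions R. (\<alpha> + \<beta> * real (h x)) * ?c)"
      using el linear_extension_range[OF _ x] by simp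
    also have "\<dots> = ?a * ((\<alpha> + \<beta> * avg_height R x) * ?c * ?b)"
      by (subst lin[OF D(2) ne(2)]) simp
    finally show "avg_height P (Suc (2 * x)) = \<alpha> + \<beta> * avg_height R x"
      using pos by (simp add: hP)
  }
qed

lemma avg_height_parallel:
  assumes fin: "finite (Field Q)" and ne: "linear_extensions Q \<noteq> {}" and x: "x \<in> Field Q"
  defines "c \<equiv> (2 * real (card (Field Q)) + 1) / (real (card (Field Q)) + 1)"
  shows "avg_height (parallel_sum Q Q) (2 * x) = c * avg_height Q x"
    "avg_height (parallel_sum Q Q) (Suc (2 * x)) = c * avg_height Q x"
proof -
  let ?q = "card (Field Q)"
  note ms = merge_sum_parallel[OF fin fin]
  have el: "(\<Sum>S\<in>ksubsets (?q + ?q) ?q. real (nth_elem S j)) = (0 + c * real j) * real (card (ksubsets (?q + ?q) ?q))"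
    if "j \<in> {1..?q}" for j
    using sum_elem_ksubsets[OF that, of "?q + ?q"] by (simp add: c_def)
  show "avg_height (parallel_sum Q Q) (2 * x) = c * avg_height Q x"
    using avg_height_merge(1)[OF ms ne ne x el] by simp
  \<comment> \<open>The complement of a uniform \<open>?q\<close>-subset of
    \<open>{1..?q + ?q}\<close> is again uniform, so both copies get the same factor.\<close>
  show "avg_height (parallel_sum Q Q) (Suc (2 * x)) = c * avg_height Q x"
    using avg_height_merge(2)[OF ms ne ne x, of 0 c] el
    unfolding sum_ksubsets_complement[of "\<lambda>T. real (nth_elem T j)" for j] by simp
qed

lemma avg_height_ordinal:
  assumes fin: "finite (Field Q)" "finite (Field R)"
    and ne: "linear_extensions Q \<noteq> {}" "linear_extensions R \<noteq> {}"
  shows "x \<in> Field Q \<Longrightarrow> avg_height (ordinal_sum Q R) (2 * x) = avg_height Q x"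
    "x \<in> Field R \<Longrightarrow> avg_height (ordinal_sum Q R) (Suc (2 * x)) = real (card (Field Q)) + avg_height R x"
proof -
  let ?q = "card (Field Q)" and ?r = "card (Field R)"
  note ms = merge_sum_ordinal[OF fin]
  have "{1..?q + ?r} - {1..?q} = {?q + 1..?q + ?r}" by auto
  then have el: "nth_elem ({1..?q + ?r} - {1..?q}) j = ?q + j" if "j \<in> {1..?r}" for j
    using nth_elem_interval[OF that, of ?q] by simp
  have el': "nth_elem {1..?q} j = j" if "j \<in> {1..?q}" for j
    using nth_elem_interval[OF that, of 0] by simp
  show "x \<in> Field Q \<Longrightarrow> avg_height (ordinal_sum Q R) (2 * x) = avg_height Q x"
    using avg_height_merge(1)[OF ms ne, of x 0 1] el' by simp
  show "x \<in> Field R \<Longrightarrow> avg_height (ordinal_sum Q R) (Suc (2 * x)) = real ?q + avg_height R x"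
    using avg_height_merge(2)[OF ms ne, of x "real ?q" 1] el by simp
qed

lemma avg_height_chain: "i < k \<Longrightarrow> avg_height (chain_poset k) i = real i + 1"
  by (subst avg_height_eq) (auto simp: Field_chain_poset linear_extensions_chain)

section \<open>The gap as a property of the set of heights\<close>

definition heights :: "nat rel \<Rightarrow> real set" where
  "heights P = insert 0 (insert (real (card (Field P)) + 1) (avg_height P ` Field P))"

text \<open>A description of gaps without lists: the end points \<open>0\<close> and
  \<open>N\<close> turn the two boundary terms of \<open>gap\<close> into ordinary gaps, and
  coinciding heights only contribute gaps of size 0, so a set suffices. The universal clause bounds
  all gaps by \<open>g\<close>, the existential one exhibits a gap equal to \<open>g\<close>. With
  \<open>g \<ge> 1\<close> the unit steps along a chain respect the bound.\<close>

definition max_gap :: "real set \<Rightarrow> real \<Rightarrow> real \<Rightarrow> bool" where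
  "max_gap A N g \<longleftrightarrow> 0 \<in> A \<and> N \<in> A \<and> A \<subseteq> {0..N} \<and> g \<ge> 1 \<and>
     (\<forall>a\<in>A. a < N \<longrightarrow> (\<exists>b\<in>A. a < b \<and> b \<le> a + g)) \<and>
     (\<exists>a\<in>A. a + g \<in> A \<and> A \<inter> {a<..<a + g} = {})"

lemma max_gapI:
  assumes "0 \<in> A" "N \<in> A" "A \<subseteq> {0..N}" "g \<ge> 1"
    "\<And>x. x \<in> A \<Longrightarrow> x < N \<Longrightarrow> \<exists>b\<in>A. x < b \<and> b \<le> x + g"
    "a \<in> A" "a + g \<in> A" "A \<inter> {a<..<a + g} = {}"
  shows "max_gap A N g"
  using assms unfolding max_gap_def by blast

lemma gap_eqI:
  assumes fin: "finite (Field P)" and ne: "Field P \<noteq> {}"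
    and g: "max_gap (heights P) (real (card (Field P)) + 1) g"
  shows "gap P = g"
proof -
  define s where "s = sorted_heights P"
  define n where "n = card (Field P)"
  define N where "N = real n + 1"
  let ?A = "heights P"
  have n0: "n > 0" using fin ne by (simp add: n_def card_gt_0_iff)
  have len: "length s = n"
    unfolding s_def sorted_heights_def n_def by (metis mset_sorted_list_of_multiset size_mset size_image_mset size_mset_set)
  have srt: "sorted s" unfolding s_def sorted_heights_def by simp
  have sets: "set s = avg_height P ` Field P"
    using fin by (simp add: s_def sorted_heights_def)
  then have A: "?A = insert 0 (insert N (set s))" by (simp add: heights_def N_def n_def)
  have mono: "s ! i \<le> s ! j" if "i \<le> j" "j < n" for i j
    using srt that len by (simp add: sorted_nth_mono)
  have inA: "s ! i \<in> ?A" if "i < n" for i using that len A by auto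
  have g1: "g \<ge> 1" and sub: "?A \<subseteq> {0..N}"
    and up: "\<And>a. a \<in> ?A \<Longrightarrow> a < N \<Longrightarrow> \<exists>b\<in>?A. a < b \<and> b \<le> a + g"
    and lo: "\<exists>a\<in>?A. a + g \<in> ?A \<and> ?A \<inter> {a<..<a + g} = {}"
    using g unfolding max_gap_def N_def n_def by blast+
  have rng: "0 \<le> s ! i" "s ! i \<le> N" if "i < n" for i using inA[OF that] sub by auto
  define G where "G = {s ! 0} \<union> {s ! (i + 1) - s ! i | i. i + 1 < n} \<union> {real n + 1 - s ! (n - 1)}"
  have "{s ! (i + 1) - s ! i | i. i + 1 < n} = (\<lambda>i. s ! (i + 1) - s ! i) ` {i. i + 1 < n}" by auto
  moreover have "finite {i. i + 1 < n}" by (rule finite_subset[of _ "{..<n}"]) auto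
  ultimately have finG: "finite G" by (simp add: G_def)
  have "x \<le> g" if xG: "x \<in> G" for x
  proof -
    consider "x = s ! 0" | i where "i + 1 < n" "x = s ! (i + 1) - s ! i" | "x = N - s ! (n - 1)"
      using xG unfolding G_def N_def by blast
    then show ?thesis
    proof cases
      case 1
      have "0 \<in> ?A" "0 < N" using A by (auto simp: N_def)
      then obtain b where "b \<in> ?A" "0 < b" "b \<le> 0 + g" using up[of 0] by blast
      then consider "b = N" | j where "j < n" "b = s ! j" using A len by (auto simp: in_set_conv_nth)
      then have "s ! 0 \<le> b" using rng(2)[of 0] n0 mono[of 0] by cases auto
      with 1 \<open>b \<le> 0 + g\<close> show ?thesis by simp
    next
      case 2
      show ?thesis
      proof (cases "s ! i < N")
        case True
        then obtain b where b: "b \<in> ?A" "s ! i < b" "b \<le> s ! i + g" using up[OF inA[of i]] 2 by auto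
        then consider "b = N" | j where "j < n" "b = s ! j"
          using A len rng(1)[of i] 2 by (auto simp: in_set_conv_nth)
        then have "s ! (i + 1) \<le> b"
        proof cases
          case (2 j)
          have "\<not> j \<le> i" using mono[of j i] \<open>i + 1 < n\<close> b 2 by auto
          then show ?thesis using mono[of "i + 1" j] 2 by auto
        qed (use rng(2)[of "i + 1"] 2 in auto)
        then show ?thesis using b 2 by linarith
      next
        \<comment> \<open>Once \<open>s ! i\<close> has reached \<open>N\<close>, the next entry
          cannot exceed it, and the difference is at most 0.\<close>
        case False
        then show ?thesis using rng(2)[of "i + 1"] 2 g1 by auto
      qed
    next
      case 3
      show ?thesis
      proof (cases "s ! (n - 1) < N")
        case True
        then obtain b where b: "b \<in> ?A" "s ! (n - 1) < b" "b \<le> s ! (n - 1) + g"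
          using up[OF inA[of "n - 1"]] n0 by auto
        then consider "b = N" | j where "j < n" "b = s ! j"
          using A len rng(1)[of "n - 1"] n0 by (auto simp: in_set_conv_nth)
        then have "b = N"
        proof cases
          case (2 j)
          then have "s ! j \<le> s ! (n - 1)" by (intro mono) auto
          then show ?thesis using b 2 by auto
        qed
        then show ?thesis using 3 b by linarith
      qed (use 3 g1 in auto)
    qed
  qed
  then have le: "Max G \<le> g" using finG by (intro Max.boundedI) (auto simp: G_def)
  obtain a where a: "a \<in> ?A" "a + g \<in> ?A" "?A \<inter> {a<..<a + g} = {}" using lo by blast
  \<comment> \<open>Since no height lies strictly between \<open>a\<close> and \<open>a + g\<close>,
    the first list entry above \<open>a\<close> already leaps over the whole gap.\<close>
  have jump: "s ! i \<ge> a + g" if "i < n" "s ! i > a" for i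
    using inA[OF that(1)] that(2) a(3) by force
  have a0: "0 \<le> a" "a + g \<le> N" using a sub by auto
  have "\<exists>x\<in>G. g \<le> x"
  proof (cases "\<exists>i<n. a < s ! i")
    case True
    define i where "i = (LEAST i. i < n \<and> a < s ! i)"
    have i: "i < n" "a < s ! i" using LeastI_ex[OF True] unfolding i_def by auto
    show ?thesis
    proof (cases i)
      case 0
      then show ?thesis using jump[OF i] a0 unfolding G_def by auto
    next
      case (Suc k)
      then have "\<not> (k < n \<and> a < s ! k)" using not_less_Least[of k "\<lambda>i. i < n \<and> a < s ! i"] i_def by auto
      then have "s ! k \<le> a" using i Suc by auto
      then have "g \<le> s ! (k + 1) - s ! k" using jump[OF i] Suc by simp
      moreover have "s ! (k + 1) - s ! k \<in> G" unfolding G_def using i Suc by auto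
      ultimately show ?thesis by blast
    qed
  next
    case False
    then have "s ! (n - 1) \<le> a" using n0 by (meson diff_less not_le zero_less_one)
    then have "g \<le> real n + 1 - s ! (n - 1)" using a0 by (simp add: N_def)
    then show ?thesis unfolding G_def by blast
  qed
  then have "g \<le> Max G" using finG by (meson Max_ge order_trans)
  with le have "Max G = g" by simp
  then show ?thesis by (simp add: gap_def Let_def G_def s_def n_def)
qed

lemma max_gap_scale:
  assumes "max_gap A N g" "c \<ge> 1"
  shows "max_gap ((\<lambda>x. c * x) ` A) (c * N) (c * g)"
proof -
  have c: "c > 0" using assms(2) by simp
  from assms obtain a where a: "a \<in> A" "a + g \<in> A" "A \<inter> {a<..<a + g} = {}" unfolding max_gap_def by blast
  have up: "\<exists>b\<in>A. x < b \<and> b \<le> x + g" if "x \<in> A" "x < N" for x using assms that unfolding max_gap_def by blast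
  have *: "c * a + c * g = c * (a + g)" for a by (simp add: algebra_simps)
  have disj: "(\<lambda>x. c * x) ` A \<inter> {c * a<..<c * a + c * g} = {}"
    using a(3) c unfolding * by auto
  have "\<exists>b\<in>(\<lambda>x. c * x) ` A. c * x < b \<and> b \<le> c * x + c * g" if x: "x \<in> A" "c * x < c * N" for x
  proof -
    obtain b where "b \<in> A" "x < b" "b \<le> x + g" using up[of x] x c by auto
    then show ?thesis unfolding * using c by (intro bexI[of _ "c * b"]) auto
  qed
  then have up': "\<exists>b\<in>(\<lambda>x. c * x) ` A. y < b \<and> b \<le> y + c * g"
    if "y \<in> (\<lambda>x. c * x) ` A" "y < c * N" for y
    using that by blast
  have N: "0 \<in> A" "N \<in> A" "A \<subseteq> {0..N}" "g \<ge> 1" using assms unfolding max_gap_def by blast+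
  show ?thesis
  proof (rule max_gapI[OF _ _ _ _ up' _ _ disj])
    show "c * a \<in> (\<lambda>x. c * x) ` A" "c * a + c * g \<in> (\<lambda>x. c * x) ` A"
      unfolding * using a by blast+
    have "1 * 1 \<le> c * g" using assms N by (intro mult_mono) auto
    then show "1 \<le> c * g" by simp
    show "0 \<in> (\<lambda>x. c * x) ` A" using N by (intro image_eqI[of _ _ 0]) auto
    show "(\<lambda>x. c * x) ` A \<subseteq> {0..c * N}" "c * N \<in> (\<lambda>x. c * x) ` A" using N c by auto
  qed
qed

text \<open>The shifted copy of \<open>A\<close> meets the lower chain at \<open>l\<close> and the
  upper chain at \<open>l + N\<close>. Hence only unit gaps are added, and the extremal gap of
  \<open>A\<close> survives inside the shifted copy.\<close>

lemma max_gap_pad: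
  fixes l :: nat
  assumes mg: "max_gap A N g"
  shows "max_gap (real ` {..l} \<union> (\<lambda>x. real l + x) ` A \<union> (\<lambda>i. real l + N + real i) ` {..l}) (2 * real l + N) g"
    (is "max_gap ?B _ _")
proof -
  have N: "0 \<in> A" "N \<in> A" "A \<subseteq> {0..N}" "g \<ge> 1" using mg unfolding max_gap_def by blast+
  have N0: "N \<ge> 0" using N by auto
  from mg obtain a where a: "a \<in> A" "a + g \<in> A" "A \<inter> {a<..<a + g} = {}" unfolding max_gap_def by blast
  have up: "\<exists>b\<in>A. x < b \<and> b \<le> x + g" if "x \<in> A" "x < N" for x using mg that unfolding max_gap_def by blast
  have upA: "\<exists>b\<in>?B. real l + x < b \<and> b \<le> real l + x + g" if "x \<in> A" "x < N" for x
    using up[OF that] by (auto intro!: bexI[of _ "real l + _"])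
  have upR: "\<exists>b\<in>?B. real l + N + real i < b \<and> b \<le> real l + N + real i + g" if "i < l" for i
    using that N(4) by (intro bexI[of _ "real l + N + real (Suc i)"] UnI2 imageI) auto
  have up: "\<exists>b\<in>?B. x < b \<and> b \<le> x + g" if x: "x \<in> ?B" "x < 2 * real l + N" for x
  proof -
    consider i where "i < l" "x = real i" | "x = real l" | y where "y \<in> A" "x = real l + y"
      | i where "i \<le> l" "x = real l + N + real i"
      using x(1) by (auto simp: le_less)
    then show ?thesis
    proof cases
      case 1
      then show ?thesis using N(4) by (intro bexI[of _ "real (Suc i)"] UnI1 imageI) auto
    next
      case 2
      show ?thesis
      proof (cases "N > 0")
        case True
        then show ?thesis using upA[of 0] N 2 by simp
      next
        case False
        then have "N = 0" using N0 by simp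
        then show ?thesis using upR[of 0] x 2 by auto
      qed
    next
      case 3
      show ?thesis
      proof (cases "y < N")
        case True
        then show ?thesis using upA[of y] 3 by simp
      next
        case False
        then have "y = N" using 3 N by force
        then show ?thesis using upR[of 0] x 3 by auto
      qed
    next
      case 4
      then show ?thesis using upR[of i] x by auto
    qed
  qed
  have disj: "?B \<inter> {real l + a<..<real l + a + g} = {}"
  proof -
    have "0 \<le> a" "a + g \<le> N" using a N by auto
    moreover have "\<not> (a < x \<and> x < a + g)" if "x \<in> A" for x using a(3) that by auto
    ultimately have "x \<notin> {real l + a<..<real l + a + g}" if "x \<in> ?B" for x
      using that by (elim UnE imageE) (auto simp: not_less)
    then show ?thesis by blast
  qed
  show ?thesis
  proof (rule max_gapI[OF _ _ _ N(4) up _ _ disj])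
    show "?B \<subseteq> {0..2 * real l + N}" using N N0 by auto
    show "0 \<in> ?B" by auto
    show "2 * real l + N \<in> ?B" by (rule UnI2, rule image_eqI[of _ _ l]) auto
    show "real l + a \<in> ?B" "real l + a + g \<in> ?B" using a by (auto simp: add.assoc)
  qed
qed

lemma finite_Field_padded: "finite (Field Q) \<Longrightarrow> finite (Field (padded l Q))"
  by (simp add: padded_def Field_ordinal_sum Field_chain_poset)

lemma card_Field_ordinal_sum:
  "finite (Field Q) \<Longrightarrow> finite (Field R) \<Longrightarrow> card (Field (ordinal_sum Q R)) = card (Field Q) + card (Field R)"
  by (simp add: Field_ordinal_sum_eq card_Field_parallel_sum)

lemma card_Field_padded: "finite (Field Q) \<Longrightarrow> card (Field (padded l Q)) = 2 * l + card (Field Q)"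
  unfolding padded_def
  by (subst card_Field_ordinal_sum, simp_all add: Field_chain_poset Field_ordinal_sum)
     (subst card_Field_ordinal_sum[unfolded Field_ordinal_sum, of "chain_poset l", unfolded Field_chain_poset], simp_all)

lemma linear_extensions_padded_nonempty:
  assumes "finite (Field Q)" "linear_extensions Q \<noteq> {}"
  shows "linear_extensions (padded l Q) \<noteq> {}"
  unfolding padded_def
  by (intro merge_sum_nonempty[OF merge_sum_ordinal])
     (use assms in \<open>auto simp: Field_chain_poset Field_ordinal_sum linear_extensions_chain\<close>)

lemma avg_height_padded:
  assumes "finite (Field Q)" "linear_extensions Q \<noteq> {}"
  shows "i < l \<Longrightarrow> avg_height (padded l Q) (2 * (2 * i)) = real i + 1"
    "x \<in> Field Q \<Longrightarrow> avg_height (padded l Q) (2 * Suc (2 * x)) = real l + avg_height Q x"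
    "i < l \<Longrightarrow> avg_height (padded l Q) (Suc (2 * i)) = real l + real (card (Field Q)) + real i + 1"
proof -
  let ?C = "chain_poset l"
  have C: "finite (Field ?C)" "linear_extensions ?C \<noteq> {}"
    by (simp_all add: Field_chain_poset linear_extensions_chain)
  have O: "finite (Field (ordinal_sum ?C Q))" "linear_extensions (ordinal_sum ?C Q) \<noteq> {}"
    using C assms merge_sum_nonempty[OF merge_sum_ordinal[OF C(1) assms(1)]] by (auto simp: Field_ordinal_sum)
  note inner = avg_height_ordinal[OF C(1) assms(1) C(2) assms(2)]
  note outer = avg_height_ordinal[OF O(1) C(1) O(2) C(2)]
  have F: "Field ?C = {..<l}" by (rule Field_chain_poset)
  have FO: "Field (ordinal_sum ?C Q) = (\<lambda>x. 2 * x) ` {..<l} \<union> (\<lambda>x. Suc (2 * x)) ` Field Q"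
    by (simp add: Field_ordinal_sum F)
  show "i < l \<Longrightarrow> avg_height (padded l Q) (2 * (2 * i)) = real i + 1"
    using outer(1)[of "2 * i"] inner(1)[of i] avg_height_chain[of i l] unfolding padded_def FO F by auto
  show "x \<in> Field Q \<Longrightarrow> avg_height (padded l Q) (2 * Suc (2 * x)) = real l + avg_height Q x"
    using outer(1)[of "Suc (2 * x)"] inner(2)[of x] unfolding padded_def FO F by auto
  have "card (Field (ordinal_sum ?C Q)) = l + card (Field Q)"
    using card_Field_ordinal_sum[OF C(1) assms(1)] by (simp add: F)
  then show "i < l \<Longrightarrow> avg_height (padded l Q) (Suc (2 * i)) = real l + real (card (Field Q)) + real i + 1"
    using outer(2)[of i] avg_height_chain[of i l] unfolding padded_def F by auto
qed

lemma Field_padded: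
  "Field (padded l Q) = (\<lambda>i. 2 * (2 * i)) ` {..<l} \<union> (\<lambda>x. 2 * Suc (2 * x)) ` Field Q \<union> (\<lambda>i. Suc (2 * i)) ` {..<l}"
  by (simp add: padded_def Field_ordinal_sum Field_chain_poset image_Un image_image)

text \<open>The artificial end points of \<open>heights Q\<close> become heights of real elements:
  the top of the lower chain and the bottom of the upper chain. This is where \<open>l > 0\<close>
  enters.\<close>

lemma heights_padded:
  assumes "finite (Field Q)" "linear_extensions Q \<noteq> {}" "l > 0"
  shows "heights (padded l Q) = real ` {..l} \<union> (\<lambda>x. real l + x) ` heights Q \<union>
    (\<lambda>i. real l + (real (card (Field Q)) + 1) + real i) ` {..l}"
proof -
  let ?n = "real (card (Field Q))"
  have "avg_height (padded l Q) ` Field (padded l Q) =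
      (\<lambda>i. real i + 1) ` {..<l} \<union> (\<lambda>x. real l + avg_height Q x) ` Field Q \<union> (\<lambda>i. real l + ?n + real i + 1) ` {..<l}"
    unfolding Field_padded image_Un image_image
    using avg_height_padded[OF assms(1,2)] by (intro arg_cong2[of _ _ _ _ "(\<union>)"] image_cong refl) auto
  moreover have "(\<lambda>i. real i + 1) ` {..<l} = real ` {1..l}"
  proof -
    have "{1..l} = Suc ` {..<l}" by (auto simp: image_iff) (metis Suc_le_D Suc_le_eq lessThan_iff)
    then show ?thesis by (simp add: image_image add.commute)
  qed
  moreover have "real ` {..l} = insert 0 (real ` {1..l})"
  proof -
    have "{..l} = insert 0 {1..l}" by auto
    then show ?thesis by simp
  qed
  moreover have "(\<lambda>i. real l + (?n + 1) + real i) ` {..l} =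
      insert (2 * real l + ?n + 1) ((\<lambda>i. real l + ?n + real i + 1) ` {..<l})"
  proof -
    have "{..l} = insert l {..<l}" by auto
    then show ?thesis by (simp add: algebra_simps)
  qed
  moreover have "real l \<in> real ` {1..l}" using assms(3) by auto
  moreover have "real l + (?n + 1) \<in> (\<lambda>i. real l + ?n + real i + 1) ` {..<l}"
    using assms(3) by (intro image_eqI[of _ _ 0]) auto
  moreover have "real (card (Field (padded l Q))) + 1 = 2 * real l + ?n + 1"
    using card_Field_padded[OF assms(1)] by simp
  ultimately show ?thesis
    unfolding heights_def image_insert image_image by auto
qed

text \<open>Both copies have the same heights, and the upper end point scales along with them,
  because c (m + 1) = 2m + 1 for m = \<open>card (Field Q)\<close>.\<close>

lemma heights_parallel:
  assumes "finite (Field Q)" "linear_extensions Q \<noteq> {}"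
  defines "c \<equiv> (2 * real (card (Field Q)) + 1) / (real (card (Field Q)) + 1)"
  shows "heights (parallel_sum Q Q) = (\<lambda>x. c * x) ` heights Q"
proof -
  have "avg_height (parallel_sum Q Q) ` Field (parallel_sum Q Q) = (\<lambda>x. c * avg_height Q x) ` Field Q"
    unfolding Field_parallel_sum image_Un image_image
    using avg_height_parallel[OF assms(1,2)] by (simp add: c_def)
  moreover have "c * (real (card (Field Q)) + 1) = 2 * real (card (Field Q)) + 1"
    by (simp add: c_def add_nonneg_eq_0_iff)
  moreover have "card (Field (parallel_sum Q Q)) = 2 * card (Field Q)"
    using card_Field_parallel_sum[OF assms(1,1)] by simp
  ultimately show ?thesis
    unfolding heights_def image_insert image_image by simp
qed

section \<open>The gap of the recursive posets\<close>

lemma P_poset_linear_extensions_nonempty: "linear_extensions (P_poset L r) \<noteq> {}"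
proof (induction r)
  case 0
  then show ?case by (simp add: linear_extensions_chain)
next
  case (Suc r)
  let ?R = "padded (L (Suc r)) (P_poset L r)"
  have "linear_extensions ?R \<noteq> {}" "finite (Field ?R)"
    using Suc linear_extensions_padded_nonempty finite_Field_padded finite_Field_P_poset by auto
  then show ?case using merge_sum_nonempty[OF merge_sum_parallel] by simp
qed

lemma P_poset_Field_nonempty: "Field (P_poset L r) \<noteq> {}"
  by (induction r) (auto simp: Field_chain_poset Field_parallel_sum Field_padded lessThan_empty_iff)

lemma P_poset_max_gap:
  assumes L: "\<And>r. r \<ge> 1 \<Longrightarrow> L r > 0"
  shows "max_gap (heights (P_poset L r)) (real (card (Field (P_poset L r))) + 1)
    (\<Prod>s=1..r. (2 * real (card (Field (R_poset L s))) + 1) / (real (card (Field (R_poset L s))) + 1))"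
proof (induction r)
  case 0
  have "{..<2} = {0, 1::nat}" by auto
  then have "heights (chain_poset 2) = {0, 1, 2, 3}"
    by (auto simp: heights_def Field_chain_poset avg_height_chain)
  then show ?case by (auto simp: max_gap_def Field_chain_poset intro: bexI[of _ 0])
next
  case (Suc r)
  let ?Q = "P_poset L r" and ?l = "L (Suc r)"
  let ?R = "padded ?l ?Q"
  let ?m = "real (card (Field ?R))"
  let ?c = "(2 * ?m + 1) / (?m + 1)"
  have Q: "finite (Field ?Q)" "linear_extensions ?Q \<noteq> {}" "?l > 0"
    using finite_Field_P_poset P_poset_linear_extensions_nonempty L by auto
  have R: "finite (Field ?R)" "linear_extensions ?R \<noteq> {}"
    using finite_Field_padded linear_extensions_padded_nonempty Q by auto
  have m: "?m + 1 = 2 * real ?l + (real (card (Field ?Q)) + 1)"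
    using card_Field_padded[OF Q(1)] by simp
  have c: "?c \<ge> 1" "?c * (?m + 1) = 2 * ?m + 1" by (simp_all add: field_simps add_nonneg_eq_0_iff)
  have "max_gap (heights ?R) (?m + 1) (\<Prod>s=1..r. (2 * real (card (Field (R_poset L s))) + 1) / (real (card (Field (R_poset L s))) + 1))"
    unfolding heights_padded[OF Q] m by (rule max_gap_pad[OF Suc.IH])
  from max_gap_scale[OF this c(1)]
  have "max_gap (heights (parallel_sum ?R ?R)) (2 * ?m + 1)
     (?c * (\<Prod>s=1..r. (2 * real (card (Field (R_poset L s))) + 1) / (real (card (Field (R_poset L s))) + 1)))"
    unfolding heights_parallel[OF R] c(2) .
  moreover have "card (Field (parallel_sum ?R ?R)) = card (Field ?R) + card (Field ?R)"
    by (rule card_Field_parallel_sum[OF R(1) R(1)])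
  moreover have "R_poset L (Suc r) = ?R" by (simp add: R_poset_def)
  ultimately show ?case by (simp add: mult.commute)
qed

lemma P_poset_gap:
  assumes "\<And>r. r \<ge> 1 \<Longrightarrow> L r > 0"
  shows "gap (P_poset L r) =
    (\<Prod>s=1..r. (2 * real (card (Field (R_poset L s))) + 1) / (real (card (Field (R_poset L s))) + 1))"
  using assms by (intro gap_eqI finite_Field_P_poset P_poset_Field_nonempty P_poset_max_gap)

lemma gap_factor_prod_ge:
  assumes "\<And>r. r \<ge> 1 \<Longrightarrow> L r > 0"
  shows "(\<Prod>s=1..r. (2 * real (card (Field (R_poset L s))) + 1) / (real (card (Field (R_poset L s))) + 1)) \<ge> (3 / 2) ^ r"
proof -
  have "(3 / 2) ^ r = (\<Prod>s=1..r. 3 / 2 :: real)" by simp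
  also have "\<dots> \<le> (\<Prod>s=1..r. (2 * real (card (Field (R_poset L s))) + 1) / (real (card (Field (R_poset L s))) + 1))"
  proof (rule prod_mono)
    fix s assume "s \<in> {1..r}"
    then have "card (Field (R_poset L s)) \<ge> 1"
      using assms[of s] card_Field_padded[OF finite_Field_P_poset] by (simp add: R_poset_def)
    then have "real (card (Field (R_poset L s))) \<ge> 1" by simp
    then show "0 \<le> (3 / 2 :: real) \<and> 3 / 2 \<le> (2 * real (card (Field (R_poset L s))) + 1) / (real (card (Field (R_poset L s))) + 1)"
      by (simp add: field_simps)
  qed
  finally show ?thesis .
qed

section \<open>Codes for induced orders\<close>

text \<open>Code lengths on the orders induced on \<open>X\<close> that satisfy Kraft's inequality and have mean at
  most \<open>b\<close>. Unlike entropies, such codes are composed without conditioning or independence.\<close>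

definition codable :: "'a rel \<Rightarrow> 'a set \<Rightarrow> real \<Rightarrow> bool" where
  "codable P X b \<longleftrightarrow> (\<exists>\<l>.
     (\<Sum>\<rho>\<in>(\<lambda>f. ord_on f X) ` linear_extensions P. 2 powr - \<l> \<rho>) \<le> 1 \<and>
     (\<Sum>f\<in>linear_extensions P. \<l> (ord_on f X)) \<le> b * real (card (linear_extensions P)))"

lemma codable_mono:
  assumes "codable P X b" "b \<le> b'"
  shows "codable P X b'"
  using assms(1) mult_right_mono[OF assms(2), of "real (card (linear_extensions P))"]
  unfolding codable_def by fastforce

lemma codable_0:
  assumes "finite (linear_extensions P)"
    and "\<And>f f'. f \<in> linear_extensions P \<Longrightarrow> f' \<in> linear_extensions P \<Longrightarrow> ord_on f X = ord_on f' X"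
  shows "codable P X 0"
proof -
  have "card ((\<lambda>f. ord_on f X) ` linear_extensions P) \<le> 1"
  proof (cases "linear_extensions P = {}")
    case False
    then obtain f where "f \<in> linear_extensions P" by blast
    then have "(\<lambda>f. ord_on f X) ` linear_extensions P \<subseteq> {ord_on f X}" using assms(2) by blast
    then show ?thesis using card_mono[of "{ord_on f X}"] by fastforce
  qed simp
  then have "(\<Sum>\<rho>\<in>(\<lambda>f. ord_on f X) ` linear_extensions P. 2 powr - (0::real)) \<le> 1" by simp
  then show ?thesis unfolding codable_def by (intro exI[of _ "\<lambda>_. 0"]) simp
qed

lemma codable_empty: "finite (Field P) \<Longrightarrow> codable P {} 0"
  by (rule codable_0) (auto simp: ord_on_def finite_linear_extensions)

lemma codable_chain: "codable (chain_poset k) X 0"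
  by (rule codable_0) (auto simp: linear_extensions_chain)

text \<open>Gibbs' inequality. Applying \<open>ln x \<le> x - 1\<close> to the ratio of
  \<open>2 powr - \<l> \<rho>\<close> and \<open>p \<rho>\<close> bounds each entropy term by its
  share of the mean length plus a correction; by Kraft's inequality the corrections add up to at
  most 0.\<close>

lemma codable_entropy:
  assumes fin: "finite (Field P)" and ne: "linear_extensions P \<noteq> {}" and X: "X \<subseteq> Field P"
    and cod: "codable P X b"
  shows "induced_entropy P X \<le> b"
proof -
  let ?L = "linear_extensions P"
  let ?A = "(\<lambda>f. ord_on f X) ` ?L"
  from cod obtain \<l> where kraft: "(\<Sum>\<rho>\<in>?A. 2 powr - \<l> \<rho>) \<le> 1"
    and avg: "(\<Sum>f\<in>?L. \<l> (ord_on f X)) \<le> b * real (card ?L)"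
    unfolding codable_def by blast
  have fL: "finite ?L" by (rule finite_linear_extensions[OF fin])
  have fX: "finite X" using X fin by (rule finite_subset)
  define M where "M = map_pmf (\<lambda>\<sigma>. Restr \<sigma> X) (random_order P)"
  define p where "p = pmf M"
  have "Restr (linext_order P f) X = ord_on f X" for f
    using X by (auto simp: linext_order_def ord_on_def)
  then have M: "M = map_pmf (\<lambda>f. ord_on f X) (pmf_of_set ?L)"
    by (simp add: M_def random_order_def random_linext_def map_pmf_comp)
  have sM: "set_pmf M = ?A" using fL ne by (simp add: M)
  have fR: "finite (range (\<lambda>\<sigma>. Restr \<sigma> X))"
    by (rule finite_subset[of _ "Pow (X \<times> X)"]) (use fX in auto)
  have sub: "?A \<subseteq> range (\<lambda>\<sigma>. Restr \<sigma> X)" unfolding sM[symmetric] M_def by auto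
  have pos: "p \<rho> > 0" if "\<rho> \<in> ?A" for \<rho>
    using that sM unfolding p_def by (simp add: pmf_positive)
  have zero: "p \<rho> = 0" if "\<rho> \<notin> ?A" for \<rho>
    using that sM unfolding p_def by (simp add: pmf_eq_0_set_pmf)
  have "induced_entropy P X = - (\<Sum>\<rho>\<in>range (\<lambda>\<sigma>. Restr \<sigma> X). p \<rho> * log 2 (p \<rho>))"
    using induced_entropy_eq[OF fX, of P] by (simp add: p_def M_def Let_def)
  also have "(\<Sum>\<rho>\<in>range (\<lambda>\<sigma>. Restr \<sigma> X). p \<rho> * log 2 (p \<rho>)) = (\<Sum>\<rho>\<in>?A. p \<rho> * log 2 (p \<rho>))"
    by (rule sum.mono_neutral_right[OF fR sub]) (simp add: zero)
  finally have ent: "induced_entropy P X = - (\<Sum>\<rho>\<in>?A. p \<rho> * log 2 (p \<rho>))" .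
  have "- (p \<rho> * log 2 (p \<rho>)) \<le> p \<rho> * \<l> \<rho> + (2 powr - \<l> \<rho> - p \<rho>) / ln 2" if "\<rho> \<in> ?A" for \<rho>
  proof -
    have "ln (2 powr - \<l> \<rho> / p \<rho>) \<le> 2 powr - \<l> \<rho> / p \<rho> - 1"
      using pos[OF that] by (intro ln_le_minus_one) simp
    then have "- \<l> \<rho> * ln 2 - ln (p \<rho>) \<le> 2 powr - \<l> \<rho> / p \<rho> - 1"
      using pos[OF that] by (simp add: ln_div ln_powr)
    then have "p \<rho> * (- \<l> \<rho> * ln 2 - ln (p \<rho>)) \<le> p \<rho> * (2 powr - \<l> \<rho> / p \<rho> - 1)"
      using pos[OF that] by (intro mult_left_mono) auto
    also have "\<dots> = 2 powr - \<l> \<rho> - p \<rho>" using pos[OF that] by (simp add: field_simps)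
    finally have "p \<rho> * (- \<l> \<rho> * ln 2 - ln (p \<rho>)) / ln 2 \<le> (2 powr - \<l> \<rho> - p \<rho>) / ln 2"
      by (simp add: divide_right_mono)
    moreover have "p \<rho> * (- \<l> \<rho> * ln 2 - ln (p \<rho>)) / ln 2 = - (p \<rho> * \<l> \<rho>) - p \<rho> * log 2 (p \<rho>)"
      by (simp add: log_def field_simps)
    ultimately show ?thesis by simp
  qed
  then have "- (\<Sum>\<rho>\<in>?A. p \<rho> * log 2 (p \<rho>)) \<le> (\<Sum>\<rho>\<in>?A. p \<rho> * \<l> \<rho> + (2 powr - \<l> \<rho> - p \<rho>) / ln 2)"
    unfolding sum_negf[symmetric] by (intro sum_mono)
  also have "\<dots> = (\<Sum>\<rho>\<in>?A. p \<rho> * \<l> \<rho>) + ((\<Sum>\<rho>\<in>?A. 2 powr - \<l> \<rho>) - (\<Sum>\<rho>\<in>?A. p \<rho>)) / ln 2"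
    by (simp add: sum.distrib sum_subtractf flip: sum_divide_distrib)
  also have "(\<Sum>\<rho>\<in>?A. p \<rho>) = 1"
    unfolding p_def using fL by (intro sum_pmf_eq_1) (auto simp: sM)
  also have "(\<Sum>\<rho>\<in>?A. p \<rho> * \<l> \<rho>) = measure_pmf.expectation M \<l>"
    unfolding p_def using fL sM
    by (subst integral_measure_pmf[of ?A]) auto
  also have "\<dots> = (\<Sum>f\<in>?L. \<l> (ord_on f X)) / real (card ?L)"
    unfolding M using fL ne by (simp add: integral_pmf_of_set)
  also have "\<dots> + ((\<Sum>\<rho>\<in>?A. 2 powr - \<l> \<rho>) - 1) / ln 2 \<le> b + 0"
  proof (rule add_mono)
    show "(\<Sum>f\<in>?L. \<l> (ord_on f X)) / real (card ?L) \<le> b"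
      using avg card_linear_extensions_pos[OF fin ne] by (simp add: pos_divide_le_eq)
    show "((\<Sum>\<rho>\<in>?A. 2 powr - \<l> \<rho>) - 1) / ln 2 \<le> 0"
      using kraft by (simp add: divide_nonpos_pos)
  qed
  finally show ?thesis unfolding ent by simp
qed

section \<open>Composing codes along sums of posets\<close>

lemma sum_product_le_1:
  fixes u :: "'b \<Rightarrow> real" and v :: "'c \<Rightarrow> real" and w :: "'d \<Rightarrow> real"
  assumes fin: "finite A1" "finite A2" "finite A3"
    and inj: "inj_on (\<lambda>\<rho>. (\<phi>1 \<rho>, \<phi>2 \<rho>, \<phi>3 \<rho>)) A"
    and maps: "\<And>\<rho>. \<rho> \<in> A \<Longrightarrow> \<phi>1 \<rho> \<in> A1 \<and> \<phi>2 \<rho> \<in> A2 \<and> \<phi>3 \<rho> \<in> A3"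
    and nonneg: "\<And>x. 0 \<le> u x" "\<And>x. 0 \<le> v x" "\<And>x. 0 \<le> w x"
    and le: "sum u A1 \<le> 1" "sum v A2 \<le> 1" "sum w A3 \<le> 1"
  shows "(\<Sum>\<rho>\<in>A. u (\<phi>1 \<rho>) * v (\<phi>2 \<rho>) * w (\<phi>3 \<rho>)) \<le> 1"
proof -
  let ?\<phi> = "\<lambda>\<rho>. (\<phi>1 \<rho>, \<phi>2 \<rho>, \<phi>3 \<rho>)"
  have "(\<Sum>\<rho>\<in>A. u (\<phi>1 \<rho>) * v (\<phi>2 \<rho>) * w (\<phi>3 \<rho>)) = (\<Sum>(x, y, z)\<in>?\<phi> ` A. u x * v y * w z)"
    by (subst sum.reindex[OF inj]) simp
  also have "\<dots> \<le> (\<Sum>(x, y, z)\<in>A1 \<times> A2 \<times> A3. u x * v y * w z)"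
    using fin maps nonneg by (intro sum_mono2) auto
  also have "\<dots> = (\<Sum>x\<in>A1. \<Sum>y\<in>A2. \<Sum>z\<in>A3. u x * v y * w z)"
    by (simp add: sum.cartesian_product)
  also have "\<dots> = sum u A1 * (sum v A2 * sum w A3)"
    by (simp only: sum_distrib_right) (simp only: sum_distrib_left mult.assoc)
  also have "\<dots> \<le> 1 * (1 * 1)"
    using le nonneg by (intro mult_mono mult_nonneg_nonneg sum_nonneg) auto
  finally show ?thesis by simp
qed

text \<open>Concatenates codes for the order on the even half, the order on the odd half and a datum
  \<open>D\<close> about their interleaving. Since the three parts determine the order, Kraft's
  inequality is inherited from the product. Mean lengths simply add, so it does not matter how
  \<open>D\<close> correlates with the halves. \<open>D\<close> has to be a function of the induced
  order, as code lengths are.\<close>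

lemma codable_merge:
  fixes D :: "nat rel \<Rightarrow> 'w" and \<w> :: "'w \<Rightarrow> real"
  assumes ms: "merge_sum P Q R \<S>" and X: "X \<subseteq> Field P"
    and cQ: "codable Q {x. 2 * x \<in> X} b1" and cR: "codable R {x. Suc (2 * x) \<in> X} b2"
    and inj: "\<And>f f'. \<lbrakk>f \<in> linear_extensions P; f' \<in> linear_extensions P;
      ord_on f (X \<inter> {z. even z}) = ord_on f' (X \<inter> {z. even z});
      ord_on f (X \<inter> {z. odd z}) = ord_on f' (X \<inter> {z. odd z});
      D (ord_on f X) = D (ord_on f' X)\<rbrakk> \<Longrightarrow> ord_on f X = ord_on f' X"
    and W: "finite W" "\<And>f. f \<in> linear_extensions P \<Longrightarrow> D (ord_on f X) \<in> W"
    and kW: "(\<Sum>w\<in>W. 2 powr - \<w> w) \<le> 1"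
    and aW: "(\<Sum>f\<in>linear_extensions P. \<w> (D (ord_on f X))) \<le> b3 * real (card (linear_extensions P))"
  shows "codable P X (b1 + b2 + b3)"
proof -
  let ?X1 = "{x. 2 * x \<in> X}" and ?X2 = "{x. Suc (2 * x) \<in> X}"
  let ?LP = "linear_extensions P" and ?LQ = "linear_extensions Q" and ?LR = "linear_extensions R"
  note MD = merge_sumD[OF ms]
  \<comment> \<open>\<open>e\<close> and \<open>d\<close> read off the orders on the two halves in
    the coordinates of \<open>Q\<close> and \<open>R\<close>.\<close>
  define e where "e \<rho> = {(a, b). (2 * a, 2 * b) \<in> \<rho>}" for \<rho> :: "nat rel"
  define d where "d \<rho> = {(a, b). (Suc (2 * a), Suc (2 * b)) \<in> \<rho>}" for \<rho> :: "nat rel"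
  have X1: "?X1 \<subseteq> Field Q" and X2: "?X2 \<subseteq> Field R"
  proof -
    have "2 * x \<noteq> Suc (2 * y)" "Suc (2 * y) \<noteq> 2 * x" for x y :: nat by presburger+
    then show "?X1 \<subseteq> Field Q" "?X2 \<subseteq> Field R" using X unfolding MD(6) by auto
  qed
  have em: "e (ord_on (merge Q R (g, h, S)) X) = ord_on g ?X1"
      "d (ord_on (merge Q R (g, h, S)) X) = ord_on h ?X2"
    if t: "g \<in> ?LQ" "h \<in> ?LR" "S \<in> \<S>" for g h S
  proof -
    note S = ksubsetsD[OF MD(8)[OF t(3)]] and S' = ksubsetsD[OF ksubsets_complement(1)[OF MD(8)[OF t(3)]]]
    have "merge Q R (g, h, S) (2 * a) \<le> merge Q R (g, h, S) (2 * b) \<longleftrightarrow> g a \<le> g b"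
      if "a \<in> ?X1" "b \<in> ?X1" for a b
    proof -
      have "a \<in> Field Q" "b \<in> Field Q" using that X1 by auto
      then show ?thesis
        using nth_elem_le_iff[of S "g a" "g b"] S linear_extension_range[OF t(1)] by (simp add: merge_left)
    qed
    then show "e (ord_on (merge Q R (g, h, S)) X) = ord_on g ?X1" by (auto simp: e_def ord_on_def)
    have "merge Q R (g, h, S) (Suc (2 * a)) \<le> merge Q R (g, h, S) (Suc (2 * b)) \<longleftrightarrow> h a \<le> h b"
      if "a \<in> ?X2" "b \<in> ?X2" for a b
    proof -
      have "a \<in> Field R" "b \<in> Field R" using that X2 by auto
      then show ?thesis
        using nth_elem_le_iff[of "{1..card (Field Q) + card (Field R)} - S" "h a" "h b"] S'
          linear_extension_range[OF t(2)] by (simp add: merge_right)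
    qed
    then show "d (ord_on (merge Q R (g, h, S)) X) = ord_on h ?X2" by (auto simp: d_def ord_on_def)
  qed
  have LP: "?LP = merge Q R ` (?LQ \<times> ?LR \<times> \<S>)" using ms by (simp add: merge_sum_def bij_betw_def)
  from cQ obtain u where u: "(\<Sum>\<rho>\<in>(\<lambda>f. ord_on f ?X1) ` ?LQ. 2 powr - u \<rho>) \<le> 1"
      "(\<Sum>f\<in>?LQ. u (ord_on f ?X1)) \<le> b1 * real (card ?LQ)" unfolding codable_def by blast
  from cR obtain v where v: "(\<Sum>\<rho>\<in>(\<lambda>f. ord_on f ?X2) ` ?LR. 2 powr - v \<rho>) \<le> 1"
      "(\<Sum>f\<in>?LR. v (ord_on f ?X2)) \<le> b2 * real (card ?LR)" unfolding codable_def by blast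
  define \<l> where "\<l> \<rho> = u (e \<rho>) + v (d \<rho>) + \<w> (D \<rho>)" for \<rho>
  have "(\<Sum>\<rho>\<in>(\<lambda>f. ord_on f X) ` ?LP. 2 powr - \<l> \<rho>) =
      (\<Sum>\<rho>\<in>(\<lambda>f. ord_on f X) ` ?LP. 2 powr - u (e \<rho>) * 2 powr - v (d \<rho>) * 2 powr - \<w> (D \<rho>))"
    by (intro sum.cong refl) (simp add: \<l>_def flip: powr_add)
  also have "\<dots> \<le> 1"
  proof (rule sum_product_le_1[where u = "\<lambda>\<rho>. 2 powr - u \<rho>" and v = "\<lambda>\<rho>. 2 powr - v \<rho>"
        and w = "\<lambda>x. 2 powr - \<w> x" and ?\<phi>1.0 = e and ?\<phi>2.0 = d and ?\<phi>3.0 = D, OF _ _ W(1) _ _ _ _ _ u(1) v(1) kW])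
    show "finite ((\<lambda>f. ord_on f ?X1) ` ?LQ)" "finite ((\<lambda>f. ord_on f ?X2) ` ?LR)"
      using finite_linear_extensions[OF MD(1)] finite_linear_extensions[OF MD(2)] by auto
    show "e \<rho> \<in> (\<lambda>f. ord_on f ?X1) ` ?LQ \<and> d \<rho> \<in> (\<lambda>f. ord_on f ?X2) ` ?LR \<and> D \<rho> \<in> W"
      if "\<rho> \<in> (\<lambda>f. ord_on f X) ` ?LP" for \<rho>
    proof -
      from that obtain f where f: "f \<in> ?LP" "\<rho> = ord_on f X" by blast
      then obtain g h S where "g \<in> ?LQ" "h \<in> ?LR" "S \<in> \<S>" "f = merge Q R (g, h, S)" unfolding LP by auto
      then show ?thesis using em[of g h S] f W(2)[of f] by auto
    qed
    have ev: "ord_on f (X \<inter> {z. even z}) = (\<lambda>(a, b). (2 * a, 2 * b)) ` e (ord_on f X)" for f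
    proof (intro equalityI subrelI)
      fix x y assume xy: "(x, y) \<in> ord_on f (X \<inter> {z. even z})"
      then have "even x" "even y" by (auto simp: ord_on_def)
      then obtain a b where "x = 2 * a" "y = 2 * b" by (auto elim!: evenE)
      then show "(x, y) \<in> (\<lambda>(a, b). (2 * a, 2 * b)) ` e (ord_on f X)"
        using xy by (intro image_eqI[of _ _ "(a, b)"]) (auto simp: ord_on_def e_def)
    qed (auto simp: ord_on_def e_def)
    have od: "ord_on f (X \<inter> {z. odd z}) = (\<lambda>(a, b). (Suc (2 * a), Suc (2 * b))) ` d (ord_on f X)" for f
    proof (intro equalityI subrelI)
      fix x y assume xy: "(x, y) \<in> ord_on f (X \<inter> {z. odd z})"
      then have "odd x" "odd y" by (auto simp: ord_on_def)
      then obtain a b where "x = Suc (2 * a)" "y = Suc (2 * b)" by (auto elim!: oddE)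
      then show "(x, y) \<in> (\<lambda>(a, b). (Suc (2 * a), Suc (2 * b))) ` d (ord_on f X)"
        using xy by (intro image_eqI[of _ _ "(a, b)"]) (auto simp: ord_on_def d_def)
    qed (auto simp: ord_on_def d_def)
    show "inj_on (\<lambda>\<rho>. (e \<rho>, d \<rho>, D \<rho>)) ((\<lambda>f. ord_on f X) ` ?LP)"
    proof (rule inj_onI)
      fix \<rho> \<rho>' assume "\<rho> \<in> (\<lambda>f. ord_on f X) ` ?LP" "\<rho>' \<in> (\<lambda>f. ord_on f X) ` ?LP"
        and eq: "(e \<rho>, d \<rho>, D \<rho>) = (e \<rho>', d \<rho>', D \<rho>')"
      then obtain f f' where f: "f \<in> ?LP" "f' \<in> ?LP" "\<rho> = ord_on f X" "\<rho>' = ord_on f' X" by blast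
      show "\<rho> = \<rho>'" unfolding f(3,4)
        by (rule inj[OF f(1,2)]) (use eq in \<open>simp_all add: ev od f(3,4)\<close>)
    qed
  qed auto
  finally have kraft: "(\<Sum>\<rho>\<in>(\<lambda>f. ord_on f X) ` ?LP. 2 powr - \<l> \<rho>) \<le> 1" .
  let ?q = "real (card ?LQ)" and ?r = "real (card ?LR)" and ?s = "real (card \<S>)"
  have cP: "real (card ?LP) = ?q * (?r * ?s)" by (simp add: sum_linear_extensions_merge(2)[OF ms])
  \<comment> \<open>The order on the even half depends on \<open>g\<close> alone, so the sums over
    \<open>h\<close> and \<open>S\<close> only contribute their cardinalities.\<close>
  have "(\<Sum>f\<in>?LP. u (e (ord_on f X))) = (\<Sum>g\<in>?LQ. \<Sum>h\<in>?LR. \<Sum>S\<in>\<S>. u (ord_on g ?X1))"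
    unfolding sum_linear_extensions_merge(1)[OF ms] by (intro sum.cong refl) (simp add: em)
  also have "\<dots> = (\<Sum>g\<in>?LQ. u (ord_on g ?X1)) * (?r * ?s)" by (simp add: mult_ac flip: sum_distrib_left)
  also have "\<dots> \<le> (b1 * ?q) * (?r * ?s)" by (intro mult_right_mono u(2)) auto
  finally have 1: "(\<Sum>f\<in>?LP. u (e (ord_on f X))) \<le> b1 * real (card ?LP)" by (simp add: cP mult_ac)
  have "(\<Sum>f\<in>?LP. v (d (ord_on f X))) = (\<Sum>g\<in>?LQ. \<Sum>h\<in>?LR. \<Sum>S\<in>\<S>. v (ord_on h ?X2))"
    unfolding sum_linear_extensions_merge(1)[OF ms] by (intro sum.cong refl) (simp add: em)
  also have "\<dots> = (\<Sum>h\<in>?LR. v (ord_on h ?X2)) * (?q * ?s)"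
    by (simp add: mult_ac flip: sum_distrib_left)
  also have "\<dots> \<le> (b2 * ?r) * (?q * ?s)" by (intro mult_right_mono v(2)) auto
  finally have 2: "(\<Sum>f\<in>?LP. v (d (ord_on f X))) \<le> b2 * real (card ?LP)" by (simp add: cP mult_ac)
  have "(\<Sum>f\<in>?LP. \<l> (ord_on f X)) \<le> (b1 + b2 + b3) * real (card ?LP)"
    using 1 2 aW unfolding \<l>_def sum.distrib by (simp add: algebra_simps)
  with kraft show ?thesis unfolding codable_def by blast
qed

lemma linear_extension_inj: "f \<in> linear_extensions P \<Longrightarrow> X \<subseteq> Field P \<Longrightarrow> inj_on f X"
  using linear_extensionsD(2) by (metis bij_betw_def inj_on_subset)

text \<open>All comparisons between the summands are forced, so the interleaving carries no
  information and \<open>D\<close> can be trivial.\<close>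

lemma codable_ordinal:
  assumes fin: "finite (Field Q)" "finite (Field R)" and X: "X \<subseteq> Field (ordinal_sum Q R)"
    and cQ: "codable Q {x. 2 * x \<in> X} b1" and cR: "codable R {x. Suc (2 * x) \<in> X} b2"
  shows "codable (ordinal_sum Q R) X (b1 + b2)"
proof -
  have "codable (ordinal_sum Q R) X (b1 + b2 + 0)"
  proof (rule codable_merge[OF merge_sum_ordinal[OF fin] X cQ cR, where D = "\<lambda>_. ()" and W = "{()}" and \<w> = "\<lambda>_. 0"])
    fix f f' assume f: "f \<in> linear_extensions (ordinal_sum Q R)" "f' \<in> linear_extensions (ordinal_sum Q R)"
      and eq: "ord_on f (X \<inter> {z. even z}) = ord_on f' (X \<inter> {z. even z})"
        "ord_on f (X \<inter> {z. odd z}) = ord_on f' (X \<inter> {z. odd z})"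
    have cross: "f x < f y" if "f \<in> linear_extensions (ordinal_sum Q R)" "x \<in> X" "y \<in> X" "even x" "odd y" for f x y
    proof -
      have "x div 2 \<in> Field Q" "y div 2 \<in> Field R"
        using that X unfolding Field_ordinal_sum by auto
      then have "(x, y) \<in> ordinal_sum Q R" using that by (simp add: ordinal_sum_iff)
      then have "f x \<le> f y" by (rule linear_extensionsD(3)[OF that(1)])
      moreover have "f x \<noteq> f y"
        using linear_extension_inj[OF that(1) X] that unfolding inj_on_def by metis
      ultimately show ?thesis by simp
    qed
    have "f x \<le> f y \<longleftrightarrow> f' x \<le> f' y" if xy: "x \<in> X" "y \<in> X" for x y
    proof -
      consider "even x" "even y" | "odd x" "odd y" | "even x" "odd y" | "odd x" "even y" by blast
      then show ?thesis
      proof cases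
        case 1
        then have "(x, y) \<in> ord_on f (X \<inter> {z. even z}) \<longleftrightarrow> (x, y) \<in> ord_on f' (X \<inter> {z. even z})"
          using eq by simp
        then show ?thesis using 1 xy by (simp add: ord_on_def)
      next
        case 2
        then have "(x, y) \<in> ord_on f (X \<inter> {z. odd z}) \<longleftrightarrow> (x, y) \<in> ord_on f' (X \<inter> {z. odd z})"
          using eq by simp
        then show ?thesis using 2 xy by (simp add: ord_on_def)
      next
        case 3
        then show ?thesis using cross[OF f(1), of x y] cross[OF f(2), of x y] xy by auto
      next
        case 4
        then show ?thesis using cross[OF f(1), of y x] cross[OF f(2), of y x] xy by auto
      qed
    qed
    then show "ord_on f X = ord_on f' X" by (auto simp: ord_on_def)
  qed auto
  then show ?thesis by simp
qed

lemma codable_padded: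
  assumes fin: "finite (Field Q)" and X: "X \<subseteq> Field (padded l Q)"
    and c: "codable Q {x. 2 * Suc (2 * x) \<in> X} b"
  shows "codable (padded l Q) X b"
proof -
  let ?C = "chain_poset l"
  have fC: "finite (Field ?C)" by (simp add: Field_chain_poset)
  have fO: "finite (Field (ordinal_sum ?C Q))" using fin fC by (simp add: Field_ordinal_sum)
  have no: "2 * x \<noteq> Suc (2 * y)" for x y :: nat by presburger
  have "{x. 2 * x \<in> X} \<subseteq> Field (ordinal_sum ?C Q)"
    using X no unfolding padded_def Field_ordinal_sum[of "ordinal_sum ?C Q"] by auto
  then have "codable (ordinal_sum ?C Q) {x. 2 * x \<in> X} (0 + b)"
    using c by (intro codable_ordinal[OF fC fin] codable_chain) auto
  then have "codable (padded l Q) X (0 + b + 0)"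
    unfolding padded_def using X by (intro codable_ordinal[OF fO fC] codable_chain) (auto simp: padded_def)
  then show ?thesis by simp
qed

text \<open>Ranks recovered from the relation by counting predecessors: a code may look at the
  induced order only, not at the linear extension behind it.\<close>

definition pattern :: "'a rel \<Rightarrow> 'a set \<Rightarrow> nat set" where
  "pattern \<rho> Y = (\<lambda>x. card {z. (z, x) \<in> \<rho>}) ` Y"

lemma pattern_ord_on: "Y \<subseteq> X \<Longrightarrow> pattern (ord_on f X) Y = rk f X ` Y"
  unfolding pattern_def rk_def
  by (intro image_cong refl arg_cong[of _ _ card]) (auto simp: ord_on_def)

lemma pattern_in_ksubsets:
  assumes "finite X" "inj_on f X" "Y \<subseteq> X"
  shows "pattern (ord_on f X) Y \<in> ksubsets (card X) (card Y)"
proof -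
  have b: "bij_betw (rk f X) X {1..card X}" by (rule rk_bij_betw[OF assms(1,2)])
  then have "rk f X ` Y \<subseteq> {1..card X}" using assms(3) unfolding bij_betw_def by blast
  moreover have "card (rk f X ` Y) = card Y"
    using b assms(3) by (meson bij_betw_def card_image inj_on_subset)
  ultimately show ?thesis using pattern_ord_on[OF assms(3)] by (simp add: ksubsets_def)
qed

text \<open>The plain code: every possible set of ranks of the even half gets the same length, the
  logarithm of their number.\<close>

lemma codable_parallel:
  assumes fin: "finite (Field Q)" "finite (Field R)" and X: "X \<subseteq> Field (parallel_sum Q R)"
    and cQ: "codable Q {x. 2 * x \<in> X} b1" and cR: "codable R {x. Suc (2 * x) \<in> X} b2"
  shows "codable (parallel_sum Q R) X (b1 + b2 + log 2 (real (card X choose card (X \<inter> {z. even z}))))"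
proof -
  let ?P = "parallel_sum Q R" and ?E = "X \<inter> {z. even z}" and ?O = "X \<inter> {z. odd z}"
  let ?c = "card X choose card ?E"
  have fX: "finite X" using X fin finite_subset by (fastforce simp: Field_parallel_sum)
  have "card ?E \<le> card X" using fX by (intro card_mono) auto
  then have c0: "real ?c > 0" by simp
  show ?thesis
  proof (rule codable_merge[OF merge_sum_parallel[OF fin] X cQ cR, where D = "\<lambda>\<rho>. pattern \<rho> ?E"
        and W = "ksubsets (card X) (card ?E)" and \<w> = "\<lambda>_. log 2 (real ?c)"])
    show "finite (ksubsets (card X) (card ?E))" by (rule finite_ksubsets)
    show "(\<Sum>w\<in>ksubsets (card X) (card ?E). 2 powr - log 2 (real ?c)) \<le> 1"
      using c0 by (simp add: card_ksubsets powr_minus)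
    show "(\<Sum>f\<in>linear_extensions ?P. log 2 (real ?c)) \<le> log 2 (real ?c) * real (card (linear_extensions ?P))"
      by (simp add: mult.commute)
    show "pattern (ord_on f X) ?E \<in> ksubsets (card X) (card ?E)" if "f \<in> linear_extensions ?P" for f
      using pattern_in_ksubsets[OF fX linear_extension_inj[OF that X]] by simp
    fix f f' assume f: "f \<in> linear_extensions ?P" "f' \<in> linear_extensions ?P"
      and eq: "ord_on f ?E = ord_on f' ?E" "ord_on f ?O = ord_on f' ?O"
        "pattern (ord_on f X) ?E = pattern (ord_on f' X) ?E"
    show "ord_on f X = ord_on f' X"
      by (rule ord_on_determined[of X ?E ?O])
         (use fX eq linear_extension_inj[OF f(1) X] linear_extension_inj[OF f(2) X] in \<open>auto simp: pattern_ord_on\<close>)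
  qed
qed

text \<open>By Pascal's rule the entry is a sum of at most two entries of row \<open>k - 1\<close>,
  whose total is \<open>2 ^ (k - 1)\<close>. The bit saved over \<open>2 ^ k\<close> is what the
  collapsing code lives on.\<close>

lemma choose_le_two_power: "k \<ge> 1 \<Longrightarrow> k choose i \<le> 2 ^ (k - 1)"
proof -
  assume "k \<ge> 1"
  then obtain n where n: "k = Suc n" by (cases k) auto
  have s: "(\<Sum>j\<in>A. n choose j) \<le> 2 ^ n" if "A \<subseteq> {..n}" for A
    using sum_mono2[of "{..n}" A "\<lambda>j. n choose j"] that choose_row_sum[of n] by simp
  show ?thesis
  proof (cases i)
    case 0
    then show ?thesis by simp
  next
    case (Suc j)
    show ?thesis
    proof (cases "Suc j \<le> n")
      case True
      then show ?thesis using s[of "{j, Suc j}"] n Suc by simp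
    next
      case False
      then have "n choose Suc j = 0" by (intro binomial_eq_0) simp
      moreover have "n choose j \<le> 2 ^ n" by (rule binomial_le_pow2)
      ultimately show ?thesis using n Suc by (simp only: binomial_Suc_Suc) simp
    qed
  qed
qed

text \<open>For a good order, passing to representatives changes no comparison between the halves,
  and comparisons inside a half are already coded. So the interleaving of \<open>X'\<close> suffices
  for good orders; bad ones, a fraction of at most \<open>\<delta>\<close>, fall back on the
  interleaving of all of \<open>X\<close>.\<close>

lemma codable_parallel_collapse:
  fixes rep :: "nat \<Rightarrow> nat" and \<delta> :: real
  assumes fin: "finite (Field Q)" "finite (Field R)" and X: "X \<subseteq> Field (parallel_sum Q R)"
    and cQ: "codable Q {x. 2 * x \<in> X} b1" and cR: "codable R {x. Suc (2 * x) \<in> X} b2"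
    and X': "X' \<subseteq> X" "X' \<noteq> {}" and rep: "\<And>x. x \<in> X \<Longrightarrow> rep x \<in> X' \<and> (even (rep x) \<longleftrightarrow> even x)"
  defines "good \<equiv> \<lambda>\<rho>. \<forall>x\<in>X. \<forall>y\<in>X. even x \<longrightarrow> odd y \<longrightarrow> ((x, y) \<in> \<rho> \<longleftrightarrow> (rep x, rep y) \<in> \<rho>)"
  assumes bad: "real (card {f \<in> linear_extensions (parallel_sum Q R). \<not> good (ord_on f X)})
      \<le> \<delta> * real (card (linear_extensions (parallel_sum Q R)))"
    and \<delta>: "\<delta> * (2 + real (card X)) \<le> 1 / 2"
  shows "codable (parallel_sum Q R) X (b1 + b2 + real (card X'))"
proof -
  let ?P = "parallel_sum Q R" and ?E = "X \<inter> {z. even z}" and ?O = "X \<inter> {z. odd z}"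
  let ?E' = "X' \<inter> {z. even z}" and ?O' = "X' \<inter> {z. odd z}"
  let ?L = "linear_extensions ?P"
  have fX: "finite X" using X fin finite_subset by (fastforce simp: Field_parallel_sum)
  have fX': "finite X'" using X'(1) fX finite_subset by blast
  have c1: "card X' \<ge> 1" using X'(2) fX' by (simp add: Suc_le_eq card_gt_0_iff)
  define \<kappa> where "\<kappa> = real (card X')"
  have \<kappa>1: "\<kappa> \<ge> 1" using c1 by (simp add: \<kappa>_def)
  define D :: "nat rel \<Rightarrow> nat set + nat set"
    where "D \<rho> = (if good \<rho> then Inl (pattern (Restr \<rho> X') ?E') else Inr (pattern \<rho> ?E))" for \<rho>
  \<comment> \<open>At most \<open>2 powr (\<kappa> - 1)\<close> patterns of length
    \<open>\<kappa> - 1 / 2\<close> contribute at most 1 / sqrt 2 <= 3/4 to Kraft's sum, and at most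
    \<open>2 ^ card X\<close> patterns of length \<open>2 + card X\<close> contribute at most 1/4.
    The half bit left below \<open>\<kappa>\<close> absorbs the mean cost of bad orders.\<close>
  define \<w> :: "nat set + nat set \<Rightarrow> real"
    where "\<w> = case_sum (\<lambda>_. \<kappa> - 1 / 2) (\<lambda>_. 2 + real (card X))"
  let ?W1 = "ksubsets (card X') (card ?E')" and ?W2 = "ksubsets (card X) (card ?E)"
  have Restr: "Restr (ord_on f X) X' = ord_on f X'" for f :: "nat \<Rightarrow> nat"
    using X'(1) by (auto simp: ord_on_def)
  show ?thesis
  proof (rule codable_merge[OF merge_sum_parallel[OF fin] X cQ cR, where D = D and W = "?W1 <+> ?W2" and \<w> = \<w>])
    show "finite (?W1 <+> ?W2)" by (intro finite_Plus finite_ksubsets)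
    show "(\<Sum>w\<in>?W1 <+> ?W2. 2 powr - \<w> w) \<le> 1"
    proof -
      have "(\<Sum>w\<in>?W1 <+> ?W2. 2 powr - \<w> w) = (\<Sum>w\<in>?W1. 2 powr - (\<kappa> - 1 / 2)) + (\<Sum>w\<in>?W2. 2 powr - (2 + real (card X)))"
        by (subst sum.Plus) (simp_all add: finite_ksubsets \<w>_def)
      also have "\<dots> = real (card X' choose card ?E') * 2 powr - (\<kappa> - 1 / 2) + real (card X choose card ?E) * 2 powr - (2 + real (card X))"
        by (simp add: card_ksubsets)
      also have "real (card X' choose card ?E') * 2 powr - (\<kappa> - 1 / 2) \<le> 3 / 4"
      proof -
        have "real (card X' choose card ?E') \<le> real (2 ^ (card X' - 1))"
          using choose_le_two_power[OF c1] by (intro of_nat_mono)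
        also have "\<dots> = 2 powr (\<kappa> - 1)"
          using c1 by (simp add: \<kappa>_def flip: powr_realpow)
        finally have "real (card X' choose card ?E') * 2 powr - (\<kappa> - 1 / 2) \<le> 2 powr (\<kappa> - 1) * 2 powr - (\<kappa> - 1 / 2)"
          by (rule mult_right_mono) simp
        also have "\<dots> = 2 powr - (1 / 2)" by (simp flip: powr_add)
        also have "\<dots> = 1 / sqrt 2"
          by (subst powr_minus_divide) (simp only: powr_half_sqrt zero_le_numeral)
        also have "\<dots> \<le> 3 / 4"
        proof -
          have "4 / 3 \<le> sqrt 2" by (rule real_le_rsqrt) (simp add: power2_eq_square)
          then show ?thesis by (simp add: field_simps)
        qed
        finally show ?thesis .
      qed
      also have "real (card X choose card ?E) * 2 powr - (2 + real (card X)) \<le> 1 / 4"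
      proof -
        have "real (card X choose card ?E) \<le> real (2 ^ card X)" by (intro of_nat_mono binomial_le_pow2)
        also have "\<dots> = 2 powr real (card X)" by (simp add: powr_realpow)
        finally have "real (card X choose card ?E) * 2 powr - (2 + real (card X)) \<le> 2 powr real (card X) * 2 powr - (2 + real (card X))"
          by (rule mult_right_mono) simp
        also have "\<dots> = 2 powr - 2" by (simp flip: powr_add)
        finally show ?thesis by (simp add: powr_minus)
      qed
      finally show ?thesis by simp
    qed
    show "D (ord_on f X) \<in> ?W1 <+> ?W2" if f: "f \<in> ?L" for f
      using pattern_in_ksubsets[OF fX linear_extension_inj[OF f X], of ?E]
        pattern_in_ksubsets[OF fX' inj_on_subset[OF linear_extension_inj[OF f X] X'(1)], of ?E']
      by (auto simp: D_def Restr)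
    show "(\<Sum>f\<in>?L. \<w> (D (ord_on f X))) \<le> real (card X') * real (card ?L)"
    proof -
      have fL: "finite ?L" using fin by (intro finite_linear_extensions) (simp add: Field_parallel_sum)
      have "(\<Sum>f\<in>?L. \<w> (D (ord_on f X))) \<le> (\<Sum>f\<in>?L. (\<kappa> - 1 / 2) + (if \<not> good (ord_on f X) then 2 + real (card X) else 0))"
        using \<kappa>1 by (intro sum_mono) (simp add: D_def \<w>_def)
      also have "\<dots> = (\<kappa> - 1 / 2) * real (card ?L) + (2 + real (card X)) * real (card {f \<in> ?L. \<not> good (ord_on f X)})"
        using fL by (simp add: sum.distrib sum.If_cases Int_def mult.commute)
      also have "\<dots> \<le> (\<kappa> - 1 / 2) * real (card ?L) + (2 + real (card X)) * (\<delta> * real (card ?L))"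
        using bad by (intro add_left_mono mult_left_mono) auto
      also have "\<dots> = (\<kappa> - 1 / 2) * real (card ?L) + (\<delta> * (2 + real (card X))) * real (card ?L)"
        by (simp add: mult_ac)
      also have "\<dots> \<le> (\<kappa> - 1 / 2) * real (card ?L) + 1 / 2 * real (card ?L)"
        using \<delta> by (intro add_left_mono mult_right_mono) auto
      finally show ?thesis by (simp add: \<kappa>_def algebra_simps)
    qed
    fix f f' assume f: "f \<in> ?L" "f' \<in> ?L"
      and eq: "ord_on f ?E = ord_on f' ?E" "ord_on f ?O = ord_on f' ?O"
        "D (ord_on f X) = D (ord_on f' X)"
    note inj = linear_extension_inj[OF f(1) X] linear_extension_inj[OF f(2) X]
    show "ord_on f X = ord_on f' X"
    proof (cases "good (ord_on f X)")
      case False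
      with eq(3) have "pattern (ord_on f X) ?E = pattern (ord_on f' X) ?E"
        by (auto simp: D_def split: if_splits)
      then show ?thesis
        by (intro ord_on_determined[of X ?E ?O]) (use fX eq inj in \<open>auto simp: pattern_ord_on\<close>)
    next
      case True
      \<comment> \<open>The two sides of the sum type tell which code is in use, so the second order
        is good as well.\<close>
      with eq(3) have g: "good (ord_on f X)" "good (ord_on f' X)"
        and pat: "pattern (ord_on f X') ?E' = pattern (ord_on f' X') ?E'"
        by (auto simp: D_def Restr split: if_splits)
      have sub: "ord_on F ?E' = Restr (ord_on F ?E) ?E'" "ord_on F ?O' = Restr (ord_on F ?O) ?O'" for F :: "nat \<Rightarrow> nat"
        using X'(1) by (auto simp: ord_on_def)
      have eq': "ord_on f X' = ord_on f' X'"
      proof (rule ord_on_determined[of X' ?E' ?O'])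
        show "inj_on f X'" "inj_on f' X'" using inj X'(1) inj_on_subset by blast+
        show "ord_on f ?E' = ord_on f' ?E'" "ord_on f ?O' = ord_on f' ?O'" unfolding sub eq(1,2) by auto
        show "rk f X' ` ?E' = rk f' X' ` ?E'" using pat by (simp add: pattern_ord_on)
      qed (use fX' in auto)
      have cross: "f x \<le> f y \<longleftrightarrow> f' x \<le> f' y" if "x \<in> X" "y \<in> X" "even x" "odd y" for x y
      proof -
        have "F x \<le> F y \<longleftrightarrow> (rep x, rep y) \<in> ord_on F X'" if "good (ord_on F X)" for F :: "nat \<Rightarrow> nat"
        proof -
          have "(x, y) \<in> ord_on F X \<longleftrightarrow> (rep x, rep y) \<in> ord_on F X"
            using that \<open>x \<in> X\<close> \<open>y \<in> X\<close> \<open>even x\<close> \<open>odd y\<close> unfolding good_def by blast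
          moreover have "rep x \<in> X'" "rep y \<in> X'" using rep \<open>x \<in> X\<close> \<open>y \<in> X\<close> by auto
          ultimately show ?thesis using \<open>x \<in> X\<close> \<open>y \<in> X\<close> X'(1) by (auto simp: ord_on_def)
        qed
        then show ?thesis using g eq' by simp
      qed
      have "f x \<le> f y \<longleftrightarrow> f' x \<le> f' y" if xy: "x \<in> X" "y \<in> X" for x y
      proof -
        consider "even x" "even y" | "odd x" "odd y" | "even x" "odd y" | "odd x" "even y" by blast
        then show ?thesis
        proof cases
          case 1
          then have "(x, y) \<in> ord_on f ?E \<longleftrightarrow> (x, y) \<in> ord_on f' ?E" using eq by simp
          then show ?thesis using 1 xy by (simp add: ord_on_def)
        next
          case 2
          then have "(x, y) \<in> ord_on f ?O \<longleftrightarrow> (x, y) \<in> ord_on f' ?O" using eq by simp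
          then show ?thesis using 2 xy by (simp add: ord_on_def)
        next
          case 3
          then show ?thesis using cross xy by simp
        next
          case 4
          \<comment> \<open>\<open>cross\<close> only covers comparisons from an even to an odd
            point; the reverse ones follow since no ties occur.\<close>
          have "x \<noteq> y" using 4 by auto
          then have "f x \<noteq> f y" "f' x \<noteq> f' y" using inj xy by (auto simp: inj_on_def)
          then show ?thesis using cross[of y x] 4 xy by linarith
        qed
      qed
      then show ?thesis by (auto simp: ord_on_def)
    qed
  qed
qed

section \<open>The recursive construction\<close>

lemma linear_extension_ordinal:
  assumes fin: "finite (Field Q)" "finite (Field R)" and f: "f \<in> linear_extensions (ordinal_sum Q R)"
  obtains g h where "g \<in> linear_extensions Q" "h \<in> linear_extensions R"
    "\<And>x. x \<in> Field Q \<Longrightarrow> f (2 * x) = g x"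
    "\<And>y. y \<in> Field R \<Longrightarrow> f (Suc (2 * y)) = card (Field Q) + h y"
proof -
  let ?q = "card (Field Q)" and ?r = "card (Field R)"
  have "f \<in> merge Q R ` (linear_extensions Q \<times> linear_extensions R \<times> {{1..?q}})"
    using merge_sum_ordinal[OF fin] f by (simp add: merge_sum_def bij_betw_def)
  then obtain g h where gh: "g \<in> linear_extensions Q" "h \<in> linear_extensions R" "f = merge Q R (g, h, {1..?q})"
    by auto
  have eq: "{1..?q + ?r} - {1..?q} = {?q + 1..?q + ?r}" by auto
  show ?thesis
  proof (rule that[OF gh(1,2)])
    show "f (2 * x) = g x" if "x \<in> Field Q" for x
      using nth_elem_interval[OF linear_extension_range[OF gh(1) that], of 0] that by (simp add: gh(3) merge_left)
    show "f (Suc (2 * y)) = ?q + h y" if "y \<in> Field R" for y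
      using nth_elem_interval[OF linear_extension_range[OF gh(2) that], of ?q] that
      unfolding gh(3) merge_right[OF that] eq by simp
  qed
qed

lemma linear_extension_padded_middle:
  assumes fin: "finite (Field Q)" and f: "f \<in> linear_extensions (padded l Q)" and x: "x \<in> Field Q"
  shows "f (2 * Suc (2 * x)) \<in> {l + 1..l + card (Field Q)}"
proof -
  let ?C = "chain_poset l"
  have fC: "finite (Field ?C)" "card (Field ?C) = l" by (simp_all add: Field_chain_poset)
  have fO: "finite (Field (ordinal_sum ?C Q))" using fin fC by (simp add: Field_ordinal_sum)
  from linear_extension_ordinal[OF fO fC(1) f[unfolded padded_def]]
  obtain g where g: "g \<in> linear_extensions (ordinal_sum ?C Q)"
    "\<And>x. x \<in> Field (ordinal_sum ?C Q) \<Longrightarrow> f (2 * x) = g x" by metis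
  from linear_extension_ordinal[OF fC(1) fin g(1)]
  obtain h where h: "h \<in> linear_extensions Q" "\<And>y. y \<in> Field Q \<Longrightarrow> g (Suc (2 * y)) = l + h y"
    using fC(2) by metis
  have "f (2 * Suc (2 * x)) = l + h x"
    using g(2)[of "Suc (2 * x)"] h(2)[OF x] x by (simp add: Field_ordinal_sum)
  then show ?thesis using linear_extension_range[OF h(1) x] by auto
qed

text \<open>The \<open>j\<close>-th element of the complement equals j + a, where a counts the
  elements of \<open>S\<close> below it. Lying between elements of \<open>S\<close> whose ranks are
  in \<open>{l + 1..l + n}\<close> forces l + 1 <= a < l + n.\<close>

lemma nth_elem_between_window:
  assumes S: "S \<in> ksubsets (m + m) m" and m: "m = 2 * l + n" and j: "j \<in> {1..m}"
    and i: "i \<in> {l + 1..l + n}" "i' \<in> {l + 1..l + n}"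
    and lt: "nth_elem S i < nth_elem ({1..m + m} - S) j" "nth_elem ({1..m + m} - S) j < nth_elem S i'"
  shows "l + j < nth_elem ({1..m + m} - S) j \<and> nth_elem ({1..m + m} - S) j < l + n + j"
proof -
  let ?T = "{1..m + m} - S"
  define v where "v = nth_elem ?T j"
  note S' = ksubsetsD[OF S] and T' = ksubsetsD[OF ksubsets_complement(1)[OF S]]
  have T: "card {t \<in> ?T. t \<le> v} = j" using rk_elem[of ?T j] T' j by (simp add: rk_def v_def)
  have v: "v \<in> ?T" using nth_elem_in[of ?T j] T' j unfolding v_def by auto
  have rS: "card {s \<in> S. s \<le> nth_elem S k} = k" if "k \<in> {l + 1..l + n}" for k
    using rk_elem[of S k] S' that m by (simp add: rk_def)
  have inS: "nth_elem S k \<in> S" if "k \<in> {l + 1..l + n}" for k using nth_elem_in[of S k] S' that m by auto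
  define a where "a = card {s \<in> S. s \<le> v}"
  have "{1..v} = {t \<in> ?T. t \<le> v} \<union> {s \<in> S. s \<le> v}" using S' v by auto
  then have "card {1..v} = card ({t \<in> ?T. t \<le> v} \<union> {s \<in> S. s \<le> v})" by (rule arg_cong)
  also have "\<dots> = j + a" unfolding T[symmetric] a_def using S' by (intro card_Un_disjoint) auto
  finally have va: "v = j + a" by simp
  have "i \<le> a" unfolding a_def using lt(1) S' by (subst rS[OF i(1), symmetric], intro card_mono) (auto simp: v_def)
  moreover have "a < i'"
  proof -
    have "{s \<in> S. s \<le> v} \<subset> {s \<in> S. s \<le> nth_elem S i'}"
      using lt(2) inS[OF i(2)] unfolding v_def[symmetric] by (auto simp: psubset_eq set_eq_iff intro: exI[of _ "nth_elem S i'"])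
    then have "a < card {s \<in> S. s \<le> nth_elem S i'}" unfolding a_def using S' by (intro psubset_card_mono) auto
    then show ?thesis by (simp add: rS[OF i(2)])
  qed
  ultimately show ?thesis using va i unfolding v_def by auto
qed

text \<open>Conditioning on the orders of the two summands: a bound on the fraction of bad position
  sets that is uniform in \<open>g\<close> and \<open>h\<close> carries over to linear
  extensions.\<close>

lemma card_linear_extensions_merge_le:
  assumes ms: "merge_sum P Q R \<S>"
    and le: "\<And>g h. g \<in> linear_extensions Q \<Longrightarrow> h \<in> linear_extensions R \<Longrightarrow>
      real (card {S \<in> \<S>. B (merge Q R (g, h, S))}) \<le> \<epsilon> * real (card \<S>)"
  shows "real (card {f \<in> linear_extensions P. B f}) \<le> \<epsilon> * real (card (linear_extensions P))"
proof -
  note MD = merge_sumD[OF ms]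
  have "real (card {f \<in> linear_extensions P. B f}) = (\<Sum>f\<in>linear_extensions P. of_bool (B f))"
    using finite_linear_extensions[OF MD(3)] by (simp add: of_bool_def sum.If_cases Int_def)
  also have "\<dots> = (\<Sum>g\<in>linear_extensions Q. \<Sum>h\<in>linear_extensions R. real (card {S \<in> \<S>. B (merge Q R (g, h, S))}))"
    unfolding sum_linear_extensions_merge(1)[OF ms] using MD(4)
    by (intro sum.cong refl) (simp add: of_bool_def sum.If_cases Int_def)
  also have "\<dots> \<le> (\<Sum>g\<in>linear_extensions Q. \<Sum>h\<in>linear_extensions R. \<epsilon> * real (card \<S>))"
    by (intro sum_mono le)
  also have "\<dots> = \<epsilon> * real (card (linear_extensions P))"
    by (simp add: sum_linear_extensions_merge(2)[OF ms] mult_ac)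
  finally show ?thesis .
qed

text \<open>Once the orders on both copies of \<open>R\<close> are fixed, \<open>y\<close> has a
  fixed rank j on its side, and the opposite middle copy has ranks in \<open>{l + 1..l + n}\<close>
  on the other. Separation then forces the \<open>j\<close>-th position on the side of
  \<open>y\<close> into the window, whatever these orders are.\<close>

lemma mixing_probability:
  fixes l n :: nat
  assumes fin: "finite (Field Q)" and n: "n = card (Field Q)"
  defines "R \<equiv> padded l Q"
  assumes y: "y \<in> Field R"
  shows "real (card {f \<in> linear_extensions (parallel_sum R R). \<exists>x\<in>Field Q. \<exists>x'\<in>Field Q.
        f (2 * (2 * Suc (2 * x))) < f (Suc (2 * y)) \<and> f (Suc (2 * y)) < f (2 * (2 * Suc (2 * x')))})
      \<le> real n / sqrt (real l + 1) * real (card (linear_extensions (parallel_sum R R)))" (is ?right)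
    and "real (card {f \<in> linear_extensions (parallel_sum R R). \<exists>x\<in>Field Q. \<exists>x'\<in>Field Q.
        f (Suc (2 * (2 * Suc (2 * x)))) < f (2 * y) \<and> f (2 * y) < f (Suc (2 * (2 * Suc (2 * x'))))})
      \<le> real n / sqrt (real l + 1) * real (card (linear_extensions (parallel_sum R R)))" (is ?left)
proof -
  define m where "m = card (Field R)"
  have m: "m = 2 * l + n" unfolding m_def R_def n by (rule card_Field_padded[OF fin])
  have fR: "finite (Field R)" unfolding R_def by (rule finite_Field_padded[OF fin])
  have ms: "merge_sum (parallel_sum R R) R R (ksubsets (m + m) m)"
    using merge_sum_parallel[OF fR fR] by (simp add: m_def)
  have mid: "g (2 * Suc (2 * x)) \<in> {l + 1..l + n}" "2 * Suc (2 * x) \<in> Field R"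
    if "g \<in> linear_extensions R" "x \<in> Field Q" for g x
    using linear_extension_padded_middle[OF fin, of g l x] that unfolding n R_def Field_padded by auto
  let ?w = "\<lambda>j T. l + j < nth_elem T j \<and> nth_elem T j < l + n + j"
  let ?\<epsilon> = "real n / sqrt (real l + 1)"
  have win: "real (card {T \<in> ksubsets (m + m) m. ?w j T}) \<le> ?\<epsilon> * real (card (ksubsets (m + m) m))" if "j \<in> {1..m}" for j
    using card_ksubsets_window[OF m that] by (simp add: mult_2)
  show ?right
  proof (rule card_linear_extensions_merge_le[OF ms])
    fix g h assume g: "g \<in> linear_extensions R" and h: "h \<in> linear_extensions R"
    let ?f = "\<lambda>S. merge R R (g, h, S)"
    let ?B = "{S \<in> ksubsets (m + m) m. \<exists>x\<in>Field Q. \<exists>x'\<in>Field Q.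
        ?f S (2 * (2 * Suc (2 * x))) < ?f S (Suc (2 * y)) \<and> ?f S (Suc (2 * y)) < ?f S (2 * (2 * Suc (2 * x')))}"
    have j: "h y \<in> {1..m}" using linear_extension_range[OF h y] by (simp add: m_def)
    \<comment> \<open>The window concerns the positions of the right half, that is the complement of
      \<open>S\<close>; complementation does not change the count.\<close>
    have "?B \<subseteq> (\<lambda>T. {1..m + m} - T) ` {T \<in> ksubsets (m + m) m. ?w (h y) T}"
    proof
      fix S assume "S \<in> ?B"
      then obtain x x' where S: "S \<in> ksubsets (m + m) m" and x: "x \<in> Field Q" "x' \<in> Field Q"
        and lt: "?f S (2 * (2 * Suc (2 * x))) < ?f S (Suc (2 * y))" "?f S (Suc (2 * y)) < ?f S (2 * (2 * Suc (2 * x')))"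
        by blast
      have "?w (h y) ({1..m + m} - S)"
        using lt unfolding merge_left[OF mid(2)[OF g x(1)]] merge_left[OF mid(2)[OF g x(2)]] merge_right[OF y] m_def[symmetric]
        by (intro nth_elem_between_window[OF S m j mid(1)[OF g x(1)] mid(1)[OF g x(2)]])
      then show "S \<in> (\<lambda>T. {1..m + m} - T) ` {T \<in> ksubsets (m + m) m. ?w (h y) T}"
        using ksubsets_complement[OF S] by (intro image_eqI[of _ _ "{1..m + m} - S"]) auto
    qed
    then have "card ?B \<le> card {T \<in> ksubsets (m + m) m. ?w (h y) T}"
      by (rule surj_card_le[rotated]) (simp add: finite_ksubsets)
    then show "real (card ?B) \<le> ?\<epsilon> * real (card (ksubsets (m + m) m))"
      using win[OF j] by linarith
  qed
  show ?left
  proof (rule card_linear_extensions_merge_le[OF ms])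
    fix g h assume g: "g \<in> linear_extensions R" and h: "h \<in> linear_extensions R"
    let ?f = "\<lambda>S. merge R R (g, h, S)"
    let ?B = "{S \<in> ksubsets (m + m) m. \<exists>x\<in>Field Q. \<exists>x'\<in>Field Q.
        ?f S (Suc (2 * (2 * Suc (2 * x)))) < ?f S (2 * y) \<and> ?f S (2 * y) < ?f S (Suc (2 * (2 * Suc (2 * x'))))}"
    have j: "g y \<in> {1..m}" using linear_extension_range[OF g y] by (simp add: m_def)
    have "?B \<subseteq> {T \<in> ksubsets (m + m) m. ?w (g y) T}"
    proof
      fix S assume "S \<in> ?B"
      then obtain x x' where S: "S \<in> ksubsets (m + m) m" and x: "x \<in> Field Q" "x' \<in> Field Q"
        and lt: "?f S (Suc (2 * (2 * Suc (2 * x)))) < ?f S (2 * y)" "?f S (2 * y) < ?f S (Suc (2 * (2 * Suc (2 * x'))))"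
        by blast
      \<comment> \<open>The middle copy now sits in the right half, so the window lemma is applied
        to \<open>?T\<close>, whose complement is \<open>S\<close>.\<close>
      let ?T = "{1..m + m} - S"
      have T: "?T \<in> ksubsets (m + m) m" "{1..m + m} - ?T = S" using ksubsets_complement[OF S] by auto
      have "?w (g y) ({1..m + m} - ?T)"
        using lt unfolding T(2) merge_right[OF mid(2)[OF h x(1)]] merge_right[OF mid(2)[OF h x(2)]] merge_left[OF y] m_def[symmetric]
        by (intro nth_elem_between_window[OF T(1) m j mid(1)[OF h x(1)] mid(1)[OF h x(2)], unfolded T(2)])
      with S show "S \<in> {T \<in> ksubsets (m + m) m. ?w (g y) T}" unfolding T(2) by simp
    qed
    then have "card ?B \<le> card {T \<in> ksubsets (m + m) m. ?w (g y) T}"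
      by (intro card_mono) (simp_all add: finite_ksubsets)
    then show "real (card ?B) \<le> ?\<epsilon> * real (card (ksubsets (m + m) m))"
      using win[OF j] by linarith
  qed
qed

lemma log_choose_le: "log 2 (real (k choose i)) \<le> real k"
proof (cases "k choose i = 0")
  case False
  then have "real (k choose i) > 0" by (simp only: of_nat_0_less_iff neq0_conv)
  moreover have "real (k choose i) \<le> 2 powr real k"
    using of_nat_mono[OF binomial_le_pow2[of k i], where 'a = real] by (simp add: powr_realpow)
  ultimately show ?thesis by (simp add: log_le_iff)
\<comment> \<open>For \<open>i > k\<close> the logarithm of 0 is 0 by convention.\<close>
qed (simp add: binomial_eq_0 log_def)

text \<open>\<open>Y1\<close> and \<open>Y2\<close> are the traces of \<open>X\<close> on the two
  middle copies, \<open>Z0\<close> is the rest of \<open>X\<close>. If \<open>X\<close> lies on one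
  side there is nothing to interleave; if \<open>Z0\<close> makes up at least a third of
  \<open>X\<close>, the plain code is affordable; otherwise each middle copy is collapsed.\<close>

lemma codable_step:
  fixes l n :: nat
  assumes fin: "finite (Field Q)" and n: "n = card (Field Q)" "n \<ge> 2" and l: "l \<ge> (24 * n ^ 3)\<^sup>2"
    and IH: "\<And>Y. Y \<subseteq> Field Q \<Longrightarrow> Y \<noteq> {} \<Longrightarrow> codable Q Y (3 * real (card Y) - 2)"
  defines "R \<equiv> padded l Q"
  assumes X: "X \<subseteq> Field (parallel_sum R R)" "X \<noteq> {}"
  shows "codable (parallel_sum R R) X (3 * real (card X) - 2)"
proof -
  let ?P = "parallel_sum R R" and ?L = "linear_extensions (parallel_sum R R)"
  let ?e1 = "\<lambda>x. 2 * (2 * Suc (2 * x)) :: nat" and ?e2 = "\<lambda>x. Suc (2 * (2 * Suc (2 * x))) :: nat"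
  have fR: "finite (Field R)" unfolding R_def by (rule finite_Field_padded[OF fin])
  have fX: "finite X" using X(1) fR finite_subset by (fastforce simp: Field_parallel_sum)
  have cX: "card X \<ge> 1" using X(2) fX by (simp add: Suc_le_eq card_gt_0_iff)
  define X1 where "X1 = {x. 2 * x \<in> X}"
  define X2 where "X2 = {x. Suc (2 * x) \<in> X}"
  define Y1 where "Y1 = {x. ?e1 x \<in> X}"
  define Y2 where "Y2 = {x. ?e2 x \<in> X}"
  have no: "2 * a \<noteq> Suc (2 * b)" "Suc (2 * b) \<noteq> 2 * a" for a b :: nat by presburger+
  have XR: "X1 \<subseteq> Field R" "X2 \<subseteq> Field R"
    using X(1) no unfolding X1_def X2_def Field_parallel_sum by auto
  have "2 * Suc (2 * x) \<in> Field R \<Longrightarrow> x \<in> Field Q" for x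
    using no unfolding R_def Field_padded by (auto simp del: mult_Suc_right)
  then have YQ: "Y1 \<subseteq> Field Q" "Y2 \<subseteq> Field Q"
    using XR unfolding Y1_def Y2_def X1_def X2_def by blast+
  have fY: "finite Y1" "finite Y2" using YQ fin finite_subset by blast+
  have cY: "card Y1 \<le> n" "card Y2 \<le> n" unfolding n using YQ fin by (auto intro: card_mono)
  \<comment> \<open>For an empty trace \<open>3 * card Y - 2\<close> would be negative, so only a
    nonempty trace brings the saving of 2 bits; the case distinctions below account for
    this.\<close>
  define \<beta> where "\<beta> Y = (if Y = {} then 0 else 3 * real (card Y) - 2)" for Y :: "nat set"
  have c\<beta>: "codable Q Y (\<beta> Y)" if "Y \<subseteq> Field Q" for Y
    using IH[OF that] codable_empty[OF fin] by (simp add: \<beta>_def)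
  have c1: "codable R {x. 2 * x \<in> X} (\<beta> Y1)"
    unfolding R_def
    by (rule codable_padded[OF fin]) (use XR(1) c\<beta>[OF YQ(1)] in \<open>simp_all add: X1_def Y1_def R_def\<close>)
  have c2: "codable R {x. Suc (2 * x) \<in> X} (\<beta> Y2)"
    unfolding R_def
    by (rule codable_padded[OF fin]) (use XR(2) c\<beta>[OF YQ(2)] in \<open>simp_all add: X2_def Y2_def R_def\<close>)
  define Z1 where "Z1 = ?e1 ` Y1"
  define Z2 where "Z2 = ?e2 ` Y2"
  have Z: "Z1 \<subseteq> X" "Z2 \<subseteq> X" "\<And>z. z \<in> Z1 \<Longrightarrow> even z" "\<And>z. z \<in> Z2 \<Longrightarrow> odd z"
    unfolding Z1_def Z2_def Y1_def Y2_def by auto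
  have cZ: "card Z1 = card Y1" "card Z2 = card Y2"
    unfolding Z1_def Z2_def by (auto intro!: card_image simp: inj_on_def)
  have fZ: "finite Z1" "finite Z2" using fY unfolding Z1_def Z2_def by auto
  define Z0 where "Z0 = X - Z1 - Z2"
  have disj: "Z1 \<inter> Z2 = {}" using Z by auto
  have "card Z0 = card X - (card Z1 + card Z2)"
  proof -
    have "Z0 = X - (Z1 \<union> Z2)" by (auto simp: Z0_def)
    then show ?thesis using Z fZ disj by (simp add: card_Diff_subset card_Un_disjoint)
  qed
  moreover have "card Z1 + card Z2 \<le> card X"
    using card_mono[OF fX, of "Z1 \<union> Z2"] Z fZ disj by (simp add: card_Un_disjoint)
  ultimately have cXsum: "card X = card Y1 + card Y2 + card Z0" using cZ by simp
  note plain = codable_parallel[OF fR fR X(1) c1 c2]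
  consider (one) "X1 = {} \<or> X2 = {}" | (many) "card Y1 + card Y2 \<le> 2 * card Z0"
    | (few) "X1 \<noteq> {}" "X2 \<noteq> {}" "card Y1 + card Y2 > 2 * card Z0" by linarith
  then show ?thesis
  proof cases
    case one
    have "X \<inter> {z. even z} = {} \<or> X \<inter> {z. even z} = X"
    proof -
      have "odd z" if "X1 = {}" "z \<in> X" for z using that unfolding X1_def by (auto elim!: evenE)
      moreover have "even z" if "X2 = {}" "z \<in> X" for z
      proof (rule ccontr)
        assume "odd z"
        then obtain a where "z = Suc (2 * a)" by (auto elim!: oddE)
        with that show False unfolding X2_def by auto
      qed
      ultimately show ?thesis using one by blast
    qed
    then have "log 2 (real (card X choose card (X \<inter> {z. even z}))) = 0" by auto
    with plain have pl: "codable ?P X (\<beta> Y1 + \<beta> Y2)" by simp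
    have "Y1 = {} \<or> Y2 = {}" using one unfolding X1_def X2_def Y1_def Y2_def by blast
    then have "\<beta> Y1 + \<beta> Y2 \<le> 3 * real (card X) - 2"
      using cXsum cX by (auto simp: \<beta>_def)
    then show ?thesis using codable_mono[OF pl] by blast
  next
    case many
    have "\<beta> Y1 + \<beta> Y2 + log 2 (real (card X choose card (X \<inter> {z. even z}))) \<le> \<beta> Y1 + \<beta> Y2 + real (card X)"
      using log_choose_le by simp
    \<comment> \<open>By the case assumption the additional \<open>card X\<close> bits are at most
      \<open>3 * card Z0\<close>.\<close>
    also have "\<dots> \<le> 3 * real (card X) - 2"
    proof (cases "Y1 = {} \<and> Y2 = {}")
      case True
      then show ?thesis using cX by (simp add: \<beta>_def)
    next
      case False
      then have "\<beta> Y1 + \<beta> Y2 \<le> 3 * real (card Y1) + 3 * real (card Y2) - 2" by (auto simp: \<beta>_def)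
      moreover have "real (card Y1) + real (card Y2) \<le> 2 * real (card Z0)"
        using of_nat_mono[OF many, where 'a = real] by simp
      moreover have "real (card X) = real (card Y1) + real (card Y2) + real (card Z0)" by (simp add: cXsum)
      ultimately show ?thesis by linarith
    qed
    finally show ?thesis using codable_mono[OF plain] by blast
  next
    case few
    define z1 where "z1 = (SOME z. z \<in> Z1)"
    define z2 where "z2 = (SOME z. z \<in> Z2)"
    have z: "Z1 \<noteq> {} \<Longrightarrow> z1 \<in> Z1" "Z2 \<noteq> {} \<Longrightarrow> z2 \<in> Z2"
      unfolding z1_def z2_def by (auto intro: someI)
    define rep where "rep x = (if x \<in> Z1 then z1 else if x \<in> Z2 then z2 else x)" for x
    define X' where "X' = rep ` X"
    have repX: "rep x \<in> X" "even (rep x) \<longleftrightarrow> even x" if "x \<in> X" for x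
      using z Z that unfolding rep_def by (auto split: if_splits)
    have rep1: "x \<in> Z1 \<and> rep x \<in> Z1" if "even x" "rep x \<noteq> x" for x
      using z Z that unfolding rep_def by (auto split: if_splits)
    have rep2: "x \<in> Z2 \<and> rep x \<in> Z2" if "odd x" "rep x \<noteq> x" for x
      using z Z that unfolding rep_def by (auto split: if_splits)
    define B where "B f y \<longleftrightarrow> (odd y \<and> (\<exists>z\<in>Z1. \<exists>z'\<in>Z1. f z < f y \<and> f y < f z')) \<or>
      (even y \<and> (\<exists>z\<in>Z2. \<exists>z'\<in>Z2. f z < f y \<and> f y < f z'))" for f :: "nat \<Rightarrow> nat" and y
    define good where "good \<rho> \<longleftrightarrow> (\<forall>x\<in>X. \<forall>y\<in>X. even x \<longrightarrow> odd y \<longrightarrow>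
      ((x, y) \<in> \<rho> \<longleftrightarrow> (rep x, rep y) \<in> \<rho>))" for \<rho>
    let ?\<epsilon> = "real n / sqrt (real l + 1)"
    have fL: "finite ?L" using fR by (intro finite_linear_extensions) (simp add: Field_parallel_sum)
    \<comment> \<open>Go from \<open>(x, y)\<close> to \<open>(rep x, y)\<close> and on to
      \<open>(rep x, rep y)\<close>. If the comparison changes, it changes in one of these moves: in
      the first, \<open>y\<close> separates two points of \<open>Z1\<close>; in the second,
      \<open>rep x\<close> separates two points of \<open>Z2\<close>.\<close>
    have goodI: "\<exists>y\<in>X. B f y" if f: "f \<in> ?L" and ng: "\<not> good (ord_on f X)" for f
    proof -
      have inj: "inj_on f X" by (rule linear_extension_inj[OF f X(1)])
      have ne: "f a \<noteq> f b" if "a \<in> X" "b \<in> X" "even a" "odd b" for a b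
        using inj that unfolding inj_on_def by metis
      from ng obtain x y where xy: "x \<in> X" "y \<in> X" "even x" "odd y"
        and "((x, y) \<in> ord_on f X) \<noteq> ((rep x, rep y) \<in> ord_on f X)" unfolding good_def by blast
      then have d: "(f x \<le> f y) \<noteq> (f (rep x) \<le> f (rep y))" using repX by (simp add: ord_on_def)
      have rx: "rep x \<in> X" "even (rep x)" and ry: "rep y \<in> X" "odd (rep y)" using repX xy by auto
      show ?thesis
      proof (cases "(f x \<le> f y) = (f (rep x) \<le> f y)")
        case False
        then have "rep x \<noteq> x" by force
        then have "x \<in> Z1" "rep x \<in> Z1" using rep1[of x] xy by blast+
        moreover have "f x < f y \<and> f y < f (rep x) \<or> f (rep x) < f y \<and> f y < f x"
          using False ne[of x y] ne[of "rep x" y] xy rx by linarith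
        ultimately show ?thesis using xy unfolding B_def by blast
      next
        case True
        with d have d': "(f (rep x) \<le> f y) \<noteq> (f (rep x) \<le> f (rep y))" by simp
        then have "rep y \<noteq> y" by force
        then have "y \<in> Z2" "rep y \<in> Z2" using rep2[of y] xy by blast+
        moreover have "f y < f (rep x) \<and> f (rep x) < f (rep y) \<or> f (rep y) < f (rep x) \<and> f (rep x) < f y"
          using d' ne[of "rep x" y] ne[of "rep x" "rep y"] xy rx ry by linarith
        ultimately show ?thesis using rx unfolding B_def by blast
      qed
    qed
    have prob: "real (card {f \<in> ?L. B f y}) \<le> ?\<epsilon> * real (card ?L)" if y: "y \<in> X" for y
    proof (cases "even y")
      case True
      then obtain a where a: "y = 2 * a" by (auto elim!: evenE)
      then have aR: "a \<in> Field R" using y XR by (auto simp: X1_def)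
      have "{f \<in> ?L. B f y} \<subseteq> {f \<in> ?L. \<exists>x\<in>Field Q. \<exists>x'\<in>Field Q. f (?e2 x) < f (2 * a) \<and> f (2 * a) < f (?e2 x')}"
        using YQ(2) unfolding B_def Z2_def a by auto
      then have "card {f \<in> ?L. B f y} \<le> card {f \<in> ?L. \<exists>x\<in>Field Q. \<exists>x'\<in>Field Q. f (?e2 x) < f (2 * a) \<and> f (2 * a) < f (?e2 x')}"
        by (rule card_mono[rotated]) (simp add: fL)
      then show ?thesis
        using mixing_probability(2)[OF fin n(1), of a l] aR unfolding R_def[symmetric] by linarith
    next
      case False
      then obtain a where a: "y = Suc (2 * a)" by (auto elim!: oddE)
      then have aR: "a \<in> Field R" using y XR by (auto simp: X2_def)
      have "{f \<in> ?L. B f y} \<subseteq> {f \<in> ?L. \<exists>x\<in>Field Q. \<exists>x'\<in>Field Q. f (?e1 x) < f (Suc (2 * a)) \<and> f (Suc (2 * a)) < f (?e1 x')}"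
        using YQ(1) unfolding B_def Z1_def a by auto
      then have "card {f \<in> ?L. B f y} \<le> card {f \<in> ?L. \<exists>x\<in>Field Q. \<exists>x'\<in>Field Q. f (?e1 x) < f (Suc (2 * a)) \<and> f (Suc (2 * a)) < f (?e1 x')}"
        by (rule card_mono[rotated]) (simp add: fL)
      then show ?thesis
        using mixing_probability(1)[OF fin n(1), of a l] aR unfolding R_def[symmetric] by linarith
    qed
    have bad: "real (card {f \<in> ?L. \<not> good (ord_on f X)}) \<le> (real (card X) * ?\<epsilon>) * real (card ?L)"
    proof -
      have "{f \<in> ?L. \<not> good (ord_on f X)} \<subseteq> (\<Union>y\<in>X. {f \<in> ?L. B f y})" using goodI by blast
      then have "card {f \<in> ?L. \<not> good (ord_on f X)} \<le> card (\<Union>y\<in>X. {f \<in> ?L. B f y})"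
        using fL fX by (intro card_mono) auto
      also have "\<dots> \<le> (\<Sum>y\<in>X. card {f \<in> ?L. B f y})" by (rule card_UN_le[OF fX])
      finally have "real (card {f \<in> ?L. \<not> good (ord_on f X)}) \<le> real (\<Sum>y\<in>X. card {f \<in> ?L. B f y})"
        by (rule of_nat_mono)
      also have "\<dots> = (\<Sum>y\<in>X. real (card {f \<in> ?L. B f y}))" by simp
      also have "\<dots> \<le> (\<Sum>y\<in>X. ?\<epsilon> * real (card ?L))" by (intro sum_mono prob)
      finally show ?thesis by simp
    qed
    \<comment> \<open>\<open>card Z0\<close> is less than half of \<open>card Y1 + card Y2\<close>,
      which is at most \<open>2 * n\<close>.\<close>
    have small: "real (card X) \<le> 3 * real n"
      using cXsum few(3) cY by linarith
    have \<delta>: "(real (card X) * ?\<epsilon>) * (2 + real (card X)) \<le> 1 / 2"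
    proof -
      have "real ((24 * n ^ 3)\<^sup>2) \<le> real l" using l by (rule of_nat_mono)
      then have "24 * real n ^ 3 \<le> sqrt (real l + 1)" by (intro real_le_rsqrt) simp
      moreover have pos: "24 * real n ^ 3 > 0" using n(2) by simp
      ultimately have \<epsilon>: "?\<epsilon> \<le> real n / (24 * real n ^ 3)" by (intro divide_left_mono) auto
      \<comment> \<open>By \<open>n \<ge> 2\<close> also \<open>2 + card X \<le> 4 * n\<close>. The
        factors 3 and 4 against the target 1/2 produce the constant 24.\<close>
      have "(real (card X) * ?\<epsilon>) * (2 + real (card X)) \<le> (3 * real n * (real n / (24 * real n ^ 3))) * (4 * real n)"
        using small n(2) \<epsilon> by (intro mult_mono) auto
      also have "\<dots> = 1 / 2" using n(2) by (simp add: field_simps power3_eq_cube)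
      finally show ?thesis .
    qed
    have "codable ?P X (\<beta> Y1 + \<beta> Y2 + real (card X'))"
    proof (rule codable_parallel_collapse[OF fR fR X(1) c1 c2, of X' rep "real (card X) * ?\<epsilon>"])
      show "X' \<subseteq> X" "X' \<noteq> {}" using repX X(2) unfolding X'_def by auto
      show "rep x \<in> X' \<and> (even (rep x) \<longleftrightarrow> even x)" if "x \<in> X" for x
        using repX that unfolding X'_def by auto
    qed (use bad[unfolded good_def] \<delta> in simp_all)
    moreover have "\<beta> Y1 + \<beta> Y2 + real (card X') \<le> 3 * real (card X) - 2"
    proof -
      have Xr: "real (card X) = real (card Y1) + real (card Y2) + real (card Z0)" by (simp add: cXsum)
      have fZ0: "finite Z0" using fX by (simp add: Z0_def)
      have sub: "X' \<subseteq> Z0 \<union> (if Y1 = {} then {} else {z1}) \<union> (if Y2 = {} then {} else {z2})"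
        unfolding X'_def rep_def Z0_def by (auto simp: Z1_def Z2_def split: if_splits)
      have "card X' \<le> card Z0 + card (if Y1 = {} then {} else {z1}) + card (if Y2 = {} then {} else {z2})"
        using card_mono[OF _ sub] fZ0 card_Un_le[of "Z0 \<union> (if Y1 = {} then {} else {z1})" "if Y2 = {} then {} else {z2}"]
          card_Un_le[of Z0 "if Y1 = {} then {} else {z1}"]
        by (auto split: if_splits)
      then have cX': "real (card X') \<le> real (card Z0) + (if Y1 = {} then 0 else 1) + (if Y2 = {} then 0 else 1)"
        by (auto split: if_splits)
      \<comment> \<open>With both traces nonempty, savings of 2 + 2 bits against two collapsed
        points leave the required 2. With one, a saving of 2 against one collapsed point leaves only
        1; the missing bit comes from a point of \<open>Z0\<close> on the other side, which is
        allotted three bits and uses one.\<close>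
      consider "Y1 \<noteq> {}" "Y2 \<noteq> {}" | "Y1 \<noteq> {}" "Y2 = {}" | "Y1 = {}" "Y2 \<noteq> {}"
        using few(3) by fastforce
      then show ?thesis
      proof cases
        case 1
        then show ?thesis using cX' Xr by (simp add: \<beta>_def)
      next
        case 2
        obtain a where "a \<in> X2" using few(2) by blast
        then have "Suc (2 * a) \<in> Z0" using 2 Z(3)[of "Suc (2 * a)"] unfolding Z0_def X2_def Z2_def by auto
        then have "card Z0 \<ge> 1" using fZ0 by (auto simp: Suc_le_eq card_gt_0_iff)
        then show ?thesis using cX' Xr 2 by (simp add: \<beta>_def)
      next
        case 3
        obtain a where "a \<in> X1" using few(1) by blast
        then have "2 * a \<in> Z0" using 3 Z(4)[of "2 * a"] unfolding Z0_def X1_def Z1_def by auto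
        then have "card Z0 \<ge> 1" using fZ0 by (auto simp: Suc_le_eq card_gt_0_iff)
        then show ?thesis using cX' Xr 3 by (simp add: \<beta>_def)
      qed
    qed
    ultimately show ?thesis by (rule codable_mono)
  qed
qed

text \<open>\<open>P_poset\<close> takes the whole sequence of chain lengths as an argument, while
  each length depends on the size of the preceding poset. Tabulating the sizes by the recursion n to
  2 (2l + n) beforehand breaks this circle.\<close>

primrec poset_size :: "nat \<Rightarrow> nat" where
  "poset_size 0 = 2"
| "poset_size (Suc r) = 2 * (2 * (24 * poset_size r ^ 3)\<^sup>2 + poset_size r)"

definition chain_length :: "nat \<Rightarrow> nat" where
  "chain_length r = (24 * poset_size (r - 1) ^ 3)\<^sup>2"

lemma poset_size_ge_2: "poset_size r \<ge> 2"
  by (induction r) auto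

lemma chain_length_pos: "chain_length r > 0"
  using poset_size_ge_2[of "r - 1"] by (simp add: chain_length_def)

lemma chain_length_Suc: "chain_length (Suc r) = (24 * poset_size r ^ 3)\<^sup>2"
  by (simp add: chain_length_def)

lemma card_Field_P_poset: "card (Field (P_poset chain_length r)) = poset_size r"
proof (induction r)
  case 0
  then show ?case by (simp add: Field_chain_poset)
next
  case (Suc r)
  let ?R = "padded (chain_length (Suc r)) (P_poset chain_length r)"
  have "finite (Field ?R)" by (intro finite_Field_padded finite_Field_P_poset)
  then show ?case
    using card_Field_parallel_sum[of ?R ?R] card_Field_padded[OF finite_Field_P_poset, of _ chain_length r] Suc
    by (simp add: chain_length_Suc)
qed

lemma codable_P_poset:
  "X \<subseteq> Field (P_poset chain_length r) \<Longrightarrow> X \<noteq> {} \<Longrightarrow> codable (P_poset chain_length r) X (3 * real (card X) - 2)"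
proof (induction r arbitrary: X)
  case 0
  then have "finite X" using finite_Field_P_poset[of chain_length 0] finite_subset by blast
  then have "card X \<ge> 1" using 0 by (simp add: Suc_le_eq card_gt_0_iff)
  \<comment> \<open>A chain costs no bits, and \<open>3 * card X - 2\<close> is positive because
    \<open>X\<close> is nonempty.\<close>
  then show ?case using codable_mono[OF codable_chain] by simp
next
  case (Suc r)
  have "codable (parallel_sum (padded (chain_length (Suc r)) (P_poset chain_length r))
      (padded (chain_length (Suc r)) (P_poset chain_length r))) X (3 * real (card X) - 2)"
    by (rule codable_step[OF finite_Field_P_poset card_Field_P_poset[symmetric] poset_size_ge_2])
       (use Suc in \<open>auto simp: chain_length_Suc\<close>)
  then show ?case by simp
qed

text \<open>The \<open>- 2\<close> kept for the induction also makes the inequality strict, since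
  the maximum runs over finitely many \<open>X\<close>.\<close>

lemma hereditary_entropy_P_poset: "hereditary_entropy (P_poset chain_length r) < 3"
proof -
  let ?P = "P_poset chain_length r"
  let ?XS = "{X. X \<subseteq> Field ?P \<and> X \<noteq> {}}"
  have "finite ?XS" using finite_Field_P_poset by (rule finite_subset[of _ "Pow (Field ?P)", rotated, OF finite_Pow_iff[THEN iffD2]]) auto
  moreover have "?XS \<noteq> {}" using P_poset_Field_nonempty by blast
  moreover have "induced_entropy ?P X / real (card X) < 3" if X: "X \<in> ?XS" for X
  proof -
    have "finite X" using X finite_Field_P_poset finite_subset by blast
    then have c: "real (card X) > 0" using X by (simp add: card_gt_0_iff)
    have "induced_entropy ?P X \<le> 3 * real (card X) - 2"
      using X by (intro codable_entropy finite_Field_P_poset P_poset_linear_extensions_nonempty codable_P_poset) auto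
    then show ?thesis using c by (simp add: pos_divide_less_eq)
  qed
  ultimately show ?thesis unfolding hereditary_entropy_def by (subst Max_less_iff) auto
qed

theorem theorem6p1:
  shows "\<exists>L :: nat \<Rightarrow> nat. (\<forall>r\<ge>1. L r > 0) \<and>
    (let P = P_poset L; m = (\<lambda>s. card (Field (R_poset L s))) in
     \<forall>r. hereditary_entropy (P r) < 3 \<and>
         gap (P r) = (\<Prod>s=1..r. (2 * real (m s) + 1) / (real (m s) + 1)) \<and>
         (\<Prod>s=1..r. (2 * real (m s) + 1) / (real (m s) + 1)) \<ge> (3 / 2) ^ r)"
  using chain_length_pos hereditary_entropy_P_poset P_poset_gap[of chain_length] gap_factor_prod_ge[of chain_length]
  unfolding Let_def by (intro exI[of _ chain_length]) blast

end
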